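(* Let $H$ be an infinite index stable subgroup of a finitely generated group $G$. Suppose $G$ has a non-elementary WPD action on a hyperbolic space $X$. Then there exists a loxodromic element $f\in G$ such that $H^g\cap\langle f\rangle=\{1\}$ for all $g\in G$.
   Context: $H^g$ denotes the conjugate of $H$ by $g$. Let $G$ be generated by a finite set $S$. A finitely generated subgroup $H\le G$ is stable if $H$ (with a word metric of a finite generating set) is quasi-isometrically embedded in $\operatorname{Cay}(G,S)$ and for all $\lambda\ge1,c\ge0$ there is $R=R(\lambda,c)$ such that if $p,q$ are $(\lambda,c)$-quasi-geodesics in $\operatorname{Cay}(G,S)$ with equal endpoints in $H$, then $p$ lies in the $R$-neighborhood of $q$. This does not depend on the finite generating sets. Let $G$ act by isometries on a hyperbolic (geodesic, Gromov $\delta$-hyperbolic) metric space $X$. An element $f\in G$ is loxodromic if it acts as a non-trivial translation along a bi-infinite quasi-geodesic axis $\alpha_f$; it then has two limit points $f^{\pm\infty}\in\partial X$. The action is non-elementary if there are loxodromic $f_1,f_2\in G$ with $\{f_1^{\pm\infty}\}\cap\{f_2^{\pm\infty}\}=\emptyset$. A loxodromic $f$ is a WPD element if for all $\kappa>0$ there is $N$ such that for any $x\in\alpha_f$ the set $\{g\in G: d(x,gx)\le\kappa,\ d(f^Nx,gf^Nx)\le\kappa\}$ is finite. The action is a WPD action if every loxodromic element is a WPD element. *)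

theory Defs
  imports
    "HOL-Algebra.Group_Action"
    "HOL-Algebra.Generated_Groups"
    "HOL-Analysis.Abstract_Metric_Spaces"
begin

section \<open>Quasi-isometric embeddings and quasi-geodesics\<close>

definition qi_embedding ::
  "real \<Rightarrow> real \<Rightarrow> 'p set \<Rightarrow> ('p \<Rightarrow> 'p \<Rightarrow> real) \<Rightarrow> 'q set \<Rightarrow> ('q \<Rightarrow> 'q \<Rightarrow> real) \<Rightarrow> ('p \<Rightarrow> 'q) \<Rightarrow> bool"
  where "qi_embedding l c M d M' d' f \<longleftrightarrow>
    l \<ge> 1 \<and> c \<ge> 0 \<and> f ` M \<subseteq> M' \<and>
    (\<forall>x\<in>M. \<forall>y\<in>M. d x y / l - c \<le> d' (f x) (f y) \<and> d' (f x) (f y) \<le> l * d x y + c)"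

text \<open>Quasi-geodesics are not required to be continuous.\<close>

definition quasi_geodesic ::
  "real \<Rightarrow> real \<Rightarrow> 'p set \<Rightarrow> ('p \<Rightarrow> 'p \<Rightarrow> real) \<Rightarrow> real set \<Rightarrow> (real \<Rightarrow> 'p) \<Rightarrow> bool"
  where "quasi_geodesic l c M d I p \<longleftrightarrow> is_interval I \<and> qi_embedding l c I dist M d p"


section \<open>Word metrics and Cayley graphs\<close>

definition word_length :: "('a, 'm) monoid_scheme \<Rightarrow> 'a set \<Rightarrow> 'a \<Rightarrow> nat"
  where "word_length G S g =
    (LEAST n. \<exists>w. length w = n \<and> set w \<subseteq> S \<union> m_inv G ` S \<and> foldr (mult G) w \<one>\<^bsub>G\<^esub> = g)"

definition word_dist :: "('a, 'm) monoid_scheme \<Rightarrow> 'a set \<Rightarrow> 'a \<Rightarrow> 'a \<Rightarrow> real"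
  where "word_dist G S g h = real (word_length G S (inv\<^bsub>G\<^esub> g \<otimes>\<^bsub>G\<^esub> h))"

definition cayley_adj :: "('a, 'm) monoid_scheme \<Rightarrow> 'a set \<Rightarrow> 'a \<Rightarrow> 'a \<Rightarrow> bool"
  where "cayley_adj G S g h \<longleftrightarrow>
    g \<in> carrier G \<and> h \<in> carrier G \<and> g \<noteq> h \<and> (\<exists>s\<in>S. h = g \<otimes>\<^bsub>G\<^esub> s \<or> g = h \<otimes>\<^bsub>G\<^esub> s)"

text \<open>
  The Cayley graph as a metric graph with edges of length one (loops and multiple edges are
  discarded). A point is given by its barycentric coordinates: a function
  on the vertices that sums to one and is supported on a single vertex or on the two ends of an edge.
\<close>

definition coord_support :: "('a \<Rightarrow> real) \<Rightarrow> 'a set"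
  where "coord_support x = {g. x g \<noteq> 0}"

definition cayley_graph :: "('a, 'm) monoid_scheme \<Rightarrow> 'a set \<Rightarrow> ('a \<Rightarrow> real) set"
  where "cayley_graph G S =
    {x. (\<forall>g. 0 \<le> x g) \<and> (\<Sum>g\<in>coord_support x. x g) = 1 \<and>
        ((\<exists>g\<in>carrier G. coord_support x = {g}) \<or>
         (\<exists>g h. cayley_adj G S g h \<and> coord_support x = {g, h}))}"

definition cayley_vertex :: "'a \<Rightarrow> 'a \<Rightarrow> real"
  where "cayley_vertex g = indicat_real {g}"

text \<open>
  The path metric. A point \<open>x\<close> has distance \<open>1 - x g\<close> to an end \<open>g\<close> of the edge carrying it, and a
  path between points that do not lie on a common closed edge leaves and enters through such ends.
\<close>

definition cayley_dist ::
  "('a, 'm) monoid_scheme \<Rightarrow> 'a set \<Rightarrow> ('a \<Rightarrow> real) \<Rightarrow> ('a \<Rightarrow> real) \<Rightarrow> real"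
  where "cayley_dist G S x y =
    (if \<exists>g h. cayley_adj G S g h \<and> coord_support x \<union> coord_support y \<subseteq> {g, h}
     then Max ((\<lambda>k. \<bar>x k - y k\<bar>) ` (coord_support x \<union> coord_support y))
     else Min ((\<lambda>(g, h). (1 - x g) + word_dist G S g h + (1 - y h)) `
                 (coord_support x \<times> coord_support y)))"


section \<open>Stable subgroups\<close>

definition stable_subgroup :: "('a, 'm) monoid_scheme \<Rightarrow> 'a set \<Rightarrow> 'a set \<Rightarrow> bool"
  where "stable_subgroup G S H \<longleftrightarrow>
    subgroup H G \<and>
    (\<exists>T. finite T \<and> T \<subseteq> H \<and> generate G T = H \<and>
      (\<exists>l c. qi_embedding l c H (word_dist G T) (cayley_graph G S) (cayley_dist G S) cayley_vertex)) \<and>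
    (\<forall>l\<ge>1. \<forall>c\<ge>0. \<exists>R. \<forall>p q a b a' b'.
      a \<le> b \<and> a' \<le> b' \<and>
      quasi_geodesic l c (cayley_graph G S) (cayley_dist G S) {a..b} p \<and>
      quasi_geodesic l c (cayley_graph G S) (cayley_dist G S) {a'..b'} q \<and>
      p a = q a' \<and> p b = q b' \<and> p a \<in> cayley_vertex ` H \<and> p b \<in> cayley_vertex ` H
      \<longrightarrow> (\<forall>s\<in>{a..b}. \<exists>t\<in>{a'..b'}. cayley_dist G S (p s) (q t) \<le> R))"


section \<open>Hyperbolic spaces and their boundary\<close>

definition geodesic_space :: "'b set \<Rightarrow> ('b \<Rightarrow> 'b \<Rightarrow> real) \<Rightarrow> bool"
  where "geodesic_space X d \<longleftrightarrow>
    (\<forall>x\<in>X. \<forall>y\<in>X. \<exists>p. p ` {0..d x y} \<subseteq> X \<and> p 0 = x \<and> p (d x y) = y \<and>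
      (\<forall>s\<in>{0..d x y}. \<forall>t\<in>{0..d x y}. d (p s) (p t) = \<bar>s - t\<bar>))"

definition gromov_product :: "('b \<Rightarrow> 'b \<Rightarrow> real) \<Rightarrow> 'b \<Rightarrow> 'b \<Rightarrow> 'b \<Rightarrow> real"
  where "gromov_product d w x y = (d w x + d w y - d x y) / 2"

definition hyperbolic_space :: "'b set \<Rightarrow> ('b \<Rightarrow> 'b \<Rightarrow> real) \<Rightarrow> bool"
  where "hyperbolic_space X d \<longleftrightarrow>
    Metric_space X d \<and> geodesic_space X d \<and>
    (\<exists>\<delta>\<ge>0. \<forall>w\<in>X. \<forall>x\<in>X. \<forall>y\<in>X. \<forall>z\<in>X.
      gromov_product d w x z \<ge> min (gromov_product d w x y) (gromov_product d w y z) - \<delta>)"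

text \<open>
  The sequential Gromov boundary: sequences with \<open>(x\<^sub>i|x\<^sub>j) \<longlonglongrightarrow> \<infinity>\<close>, where \<open>x\<close> and \<open>y\<close> are identified
  if \<open>(x\<^sub>i|y\<^sub>j) \<longlonglongrightarrow> \<infinity>\<close> as \<open>i, j \<longlonglongrightarrow> \<infinity>\<close>. These conditions do not depend on the base point.
\<close>

definition products_to_infinity ::
  "'b set \<Rightarrow> ('b \<Rightarrow> 'b \<Rightarrow> real) \<Rightarrow> (nat \<Rightarrow> 'b) \<Rightarrow> (nat \<Rightarrow> 'b) \<Rightarrow> bool"
  where "products_to_infinity X d x y \<longleftrightarrow>
    (\<forall>w\<in>X. filterlim (\<lambda>(i, j). gromov_product d w (x i) (y j)) at_top
             (sequentially \<times>\<^sub>F sequentially))"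

definition gromov_sequences :: "'b set \<Rightarrow> ('b \<Rightarrow> 'b \<Rightarrow> real) \<Rightarrow> (nat \<Rightarrow> 'b) set"
  where "gromov_sequences X d = {x. range x \<subseteq> X \<and> products_to_infinity X d x x}"

definition gromov_boundary :: "'b set \<Rightarrow> ('b \<Rightarrow> 'b \<Rightarrow> real) \<Rightarrow> (nat \<Rightarrow> 'b) set set"
  where "gromov_boundary X d =
    gromov_sequences X d //
      {(x, y). x \<in> gromov_sequences X d \<and> y \<in> gromov_sequences X d \<and> products_to_infinity X d x y}"


section \<open>Loxodromic and WPD elements\<close>

definition isometric_action ::
  "('a, 'm) monoid_scheme \<Rightarrow> 'b set \<Rightarrow> ('b \<Rightarrow> 'b \<Rightarrow> real) \<Rightarrow> ('a \<Rightarrow> 'b \<Rightarrow> 'b) \<Rightarrow> bool"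
  where "isometric_action G X d \<phi> \<longleftrightarrow>
    group_action G X \<phi> \<and>
    (\<forall>g\<in>carrier G. \<forall>x\<in>X. \<forall>y\<in>X. d (\<phi> g x) (\<phi> g y) = d x y)"

definition quasi_axis ::
  "'b set \<Rightarrow> ('b \<Rightarrow> 'b \<Rightarrow> real) \<Rightarrow> ('a \<Rightarrow> 'b \<Rightarrow> 'b) \<Rightarrow> 'a \<Rightarrow> (real \<Rightarrow> 'b) \<Rightarrow> bool"
  where "quasi_axis X d \<phi> f \<alpha> \<longleftrightarrow>
    (\<exists>l c. quasi_geodesic l c X d UNIV \<alpha>) \<and>
    (\<exists>\<tau>. \<tau> \<noteq> 0 \<and> (\<forall>t. \<phi> f (\<alpha> t) = \<alpha> (t + \<tau>)))"

definition loxodromic ::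
  "('a, 'm) monoid_scheme \<Rightarrow> 'b set \<Rightarrow> ('b \<Rightarrow> 'b \<Rightarrow> real) \<Rightarrow> ('a \<Rightarrow> 'b \<Rightarrow> 'b) \<Rightarrow> 'a \<Rightarrow> bool"
  where "loxodromic G X d \<phi> f \<longleftrightarrow> f \<in> carrier G \<and> (\<exists>\<alpha>. quasi_axis X d \<phi> f \<alpha>)"

definition axis_ends :: "'b set \<Rightarrow> ('b \<Rightarrow> 'b \<Rightarrow> real) \<Rightarrow> (real \<Rightarrow> 'b) \<Rightarrow> (nat \<Rightarrow> 'b) set set"
  where "axis_ends X d \<alpha> =
    {\<xi> \<in> gromov_boundary X d. (\<lambda>n. \<alpha> (real n)) \<in> \<xi> \<or> (\<lambda>n. \<alpha> (- real n)) \<in> \<xi>}"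

text \<open>
  Any two quasi-axes of a loxodromic element of an action on a hyperbolic space are at finite
  Hausdorff distance, so the choice of axes below is immaterial.
\<close>

definition non_elementary ::
  "('a, 'm) monoid_scheme \<Rightarrow> 'b set \<Rightarrow> ('b \<Rightarrow> 'b \<Rightarrow> real) \<Rightarrow> ('a \<Rightarrow> 'b \<Rightarrow> 'b) \<Rightarrow> bool"
  where "non_elementary G X d \<phi> \<longleftrightarrow>
    (\<exists>f\<^sub>1 f\<^sub>2 \<alpha>\<^sub>1 \<alpha>\<^sub>2. loxodromic G X d \<phi> f\<^sub>1 \<and> loxodromic G X d \<phi> f\<^sub>2 \<and>
      quasi_axis X d \<phi> f\<^sub>1 \<alpha>\<^sub>1 \<and> quasi_axis X d \<phi> f\<^sub>2 \<alpha>\<^sub>2 \<and>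
      axis_ends X d \<alpha>\<^sub>1 \<inter> axis_ends X d \<alpha>\<^sub>2 = {})"

definition WPD_element ::
  "('a, 'm) monoid_scheme \<Rightarrow> 'b set \<Rightarrow> ('b \<Rightarrow> 'b \<Rightarrow> real) \<Rightarrow> ('a \<Rightarrow> 'b \<Rightarrow> 'b) \<Rightarrow> 'a \<Rightarrow> bool"
  where "WPD_element G X d \<phi> f \<longleftrightarrow>
    loxodromic G X d \<phi> f \<and>
    (\<exists>\<alpha>. quasi_axis X d \<phi> f \<alpha> \<and>
      (\<forall>\<kappa>>0. \<exists>N::nat. \<forall>x\<in>range \<alpha>.
        finite {g \<in> carrier G. d x (\<phi> g x) \<le> \<kappa> \<and>
          d (\<phi> (f [^]\<^bsub>G\<^esub> N) x) (\<phi> g (\<phi> (f [^]\<^bsub>G\<^esub> N) x)) \<le> \<kappa>}))"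

definition WPD_action ::
  "('a, 'm) monoid_scheme \<Rightarrow> 'b set \<Rightarrow> ('b \<Rightarrow> 'b \<Rightarrow> real) \<Rightarrow> ('a \<Rightarrow> 'b \<Rightarrow> 'b) \<Rightarrow> bool"
  where "WPD_action G X d \<phi> \<longleftrightarrow>
    (\<forall>f\<in>carrier G. loxodromic G X d \<phi> f \<longrightarrow> WPD_element G X d \<phi> f)"

end

theory Submission
  imports Defs
begin

text \<open>
  The idea is to build a loxodromic element \<open>w\<close> whose axis in the Cayley graph reads off an element \<open>v\<close>
  that cannot be read off near \<open>H\<close>.

  If \<open>w\<^sup>k = g h g\<inverse>\<close> with \<open>h \<in> H\<close> and \<open>k \<noteq> 0\<close>, then the translate by \<open>g\<inverse>\<close> of the periodic path through the
  powers of \<open>w\<close> stays at bounded distance from \<open>H\<close>. If this path is a quasi-geodesic, a long piece of it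
  becomes a quasi-geodesic with both ends on \<open>H\<close>, with constants that do not depend on \<open>g\<close> and \<open>k\<close>, once
  it is joined to \<open>H\<close> by geodesics that enter it at nearest points
  (\<open>glue_geodesics_to_nearest_points\<close>). Stability then puts a whole period of the path within a distance
  \<open>R\<close> of \<open>H\<close>, where \<open>R\<close> depends only on the quasi-geodesic constants
  (\<open>stable_subgroup_near_periodic_path\<close>). If the path passes through \<open>p\<close> and \<open>p v\<close>, it follows that
  \<open>v \<in> B H B\<close> for the ball \<open>B\<close> of radius \<open>R\<close> in \<open>G\<close>. But \<open>B H B\<close> is a finite union of cosets of conjugates
  of \<open>H\<close>, so it is not all of \<open>G\<close> by B. H. Neumann's lemma (\<open>infinite_index_not_covered\<close>). It remains to
  find, for every \<open>v\<close> with a large displacement in \<open>X\<close>, a loxodromic \<open>w\<close> with a periodic path through some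
  \<open>p\<close> and \<open>p v\<close> that is a quasi-geodesic with constants independent of \<open>v\<close> (\<open>bridge_exists\<close>).

  The action provides a Schottky pair, that is, two independent loxodromic elements with long translations
  (\<open>schottky_pair_exists\<close>). As seen from the base point, each point of \<open>X\<close> lies in the direction of at most
  one of the two axes, so there are \<open>a\<close> and \<open>b\<close> among the two elements and their inverses such that all paths
  \<open>a\<^sup>m v b\<^sup>n\<close> are broken geodesics of \<open>X\<close> with wide corners. Hence so is the periodic path of
  \<open>w = a\<^sup>N v b\<^sup>N c\<^sup>N\<close> for a suitable \<open>c\<close>, and \<open>w\<close> is loxodromic. Since the orbit map is Lipschitz, the
  number of letters also bounds distances in \<open>G\<close> from below, up to a factor; but \<open>v\<close> counts as a single letter
  there.

  In \<open>G\<close> the letter \<open>v\<close> has to be spelled out. A geodesic from \<open>1\<close> to \<open>v\<close> may first run along the powers of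
  \<open>a\<inverse>\<close>, although \<open>v\<close> does not go in that direction in \<open>X\<close>, and then the path along \<open>a\<^sup>N\<close> and this geodesic
  backtracks. So \<open>v\<close> is written as \<open>a\<^sup>i v' b\<^sup>j\<close> with \<open>v'\<close> of least length in \<open>\<langle>a\<rangle> v \<langle>b\<rangle>\<close>; exchanging \<open>a\<close> or
  \<open>b\<close> with its inverse gives \<open>i, j \<ge> 0\<close>. Now \<open>a\<^sup>N a\<^sup>i v' b\<^sup>j b\<^sup>N\<close> is a quasi-geodesic with uniform constants,
  because a geodesic between nearest points of two sets moves away from both as directly as possible, and the
  displacement in \<open>X\<close> takes care of long powers (\<open>bridge_path_lower_bound\<close>). Finally \<open>N\<close> is chosen so large in terms of
  \<open>i\<close>, \<open>j\<close> and \<open>v'\<close> that every piece of the periodic path longer than \<open>N\<close> is mostly made of powers of \<open>a\<close>,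
  \<open>b\<close>, \<open>c\<close>, where the bound from \<open>X\<close> suffices (\<open>cyclic_path_lower_bound\<close>).
\<close>

section \<open>Words and word metrics\<close>

definition word_value :: "('a, 'm) monoid_scheme \<Rightarrow> 'a list \<Rightarrow> 'a"
  where "word_value G w = foldr (mult G) w \<one>\<^bsub>G\<^esub>"

lemma word_value_simps [simp]:
  "word_value G [] = \<one>\<^bsub>G\<^esub>"
  "word_value G (x # w) = x \<otimes>\<^bsub>G\<^esub> word_value G w"
  by (simp_all add: word_value_def)

lemma word_length_eq: "word_length G S g =
    (LEAST n. \<exists>w. length w = n \<and> set w \<subseteq> S \<union> m_inv G ` S \<and> word_value G w = g)"
  by (simp add: word_length_def word_value_def)

context group
begin

lemma word_value_closed [simp, intro]: "set w \<subseteq> carrier G \<Longrightarrow> word_value G w \<in> carrier G"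
  by (induction w) auto

lemma set_replicate_closed [simp]: "a \<in> carrier G \<Longrightarrow> set (replicate n a) \<subseteq> carrier G"
  by (cases "n = 0") auto

lemma word_value_append:
  "set u \<subseteq> carrier G \<Longrightarrow> set w \<subseteq> carrier G \<Longrightarrow> word_value G (u @ w) = word_value G u \<otimes> word_value G w"
  by (induction u) (auto simp: m_assoc)

lemma word_value_replicate: "a \<in> carrier G \<Longrightarrow> word_value G (replicate n a) = a [^] n"
proof (induction n)
  case (Suc n)
  then show ?case using nat_pow_Suc2[of a n] by (simp del: nat_pow_Suc)
qed simp

lemma word_value_concat_replicate:
  "set w \<subseteq> carrier G \<Longrightarrow> word_value G (concat (replicate n w)) = word_value G w [^] n"
proof (induction n)
  case (Suc n)
  moreover have "set (concat (replicate n w)) \<subseteq> carrier G" using Suc.prems by auto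
  ultimately show ?case
    using nat_pow_Suc2[of "word_value G w" n] by (simp add: word_value_append del: nat_pow_Suc)
qed simp

lemma word_value_rev_inv:
  "set w \<subseteq> carrier G \<Longrightarrow> word_value G (rev (map (m_inv G) w)) = inv (word_value G w)"
proof (induction w)
  case (Cons a w)
  moreover have "set (rev (map (m_inv G) w)) \<subseteq> carrier G" using Cons.prems by auto
  ultimately show ?case
    by (simp add: word_value_append inv_mult_group)
qed simp

lemma mult_inv_cancel_left [simp]: "x \<in> carrier G \<Longrightarrow> y \<in> carrier G \<Longrightarrow> x \<otimes> (inv x \<otimes> y) = y"
  by (simp add: m_assoc[symmetric])

lemma inv_mult_cancel_left [simp]: "x \<in> carrier G \<Longrightarrow> y \<in> carrier G \<Longrightarrow> inv x \<otimes> (x \<otimes> y) = y"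
  by (simp add: m_assoc[symmetric])

lemma word_letters_closed: "S \<subseteq> carrier G \<Longrightarrow> S \<union> m_inv G ` S \<subseteq> carrier G"
  by auto

lemma word_value_in_generate:
  assumes "S \<subseteq> carrier G" "set w \<subseteq> S \<union> m_inv G ` S" shows "word_value G w \<in> generate G S"
  using assms(2) by (induction w) (auto intro: generate.intros)

lemma generate_imp_word:
  assumes "S \<subseteq> carrier G" "g \<in> generate G S"
  shows "\<exists>w. set w \<subseteq> S \<union> m_inv G ` S \<and> word_value G w = g"
  using assms(2)
proof induction
  case one then show ?case by (intro exI[of _ "[]"]) auto
next
  case (incl h) then show ?case using assms(1) by (intro exI[of _ "[h]"]) auto
next
  case (inv h) then show ?case using assms(1) by (intro exI[of _ "[inv h]"]) auto
next
  case (eng h1 h2)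
  then obtain w1 w2 where "set w1 \<subseteq> S \<union> m_inv G ` S" "word_value G w1 = h1"
    "set w2 \<subseteq> S \<union> m_inv G ` S" "word_value G w2 = h2" by auto
  moreover have "S \<union> m_inv G ` S \<subseteq> carrier G" using assms(1) by auto
  ultimately show ?case
    by (intro exI[of _ "w1 @ w2"]) (metis Un_least order_trans set_append word_value_append)
qed

lemma word_length_le:
  "set w \<subseteq> S \<union> m_inv G ` S \<Longrightarrow> word_length G S (word_value G w) \<le> length w"
  unfolding word_length_eq by (rule Least_le) auto

lemma word_length_witness:
  assumes "S \<subseteq> carrier G" "g \<in> generate G S"
  shows "\<exists>w. length w = word_length G S g \<and> set w \<subseteq> S \<union> m_inv G ` S \<and> word_value G w = g"
proof -
  have "\<exists>n w. length w = n \<and> set w \<subseteq> S \<union> m_inv G ` S \<and> word_value G w = g"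
    using generate_imp_word[OF assms] by auto
  from LeastI_ex[OF this] show ?thesis unfolding word_length_eq .
qed

lemma word_length_one [simp]: "word_length G S \<one> = 0"
  using word_length_le[of "[]" S] by simp

lemma word_length_eq_0_iff:
  assumes "S \<subseteq> carrier G" "g \<in> generate G S"
  shows "word_length G S g = 0 \<longleftrightarrow> g = \<one>"
  using word_length_witness[OF assms] by auto

lemma word_length_mult:
  assumes "S \<subseteq> carrier G" "g \<in> generate G S" "h \<in> generate G S"
  shows "word_length G S (g \<otimes> h) \<le> word_length G S g + word_length G S h"
proof -
  obtain u where u: "length u = word_length G S g" "set u \<subseteq> S \<union> m_inv G ` S" "word_value G u = g"
    using word_length_witness[OF assms(1,2)] by auto
  obtain w where w: "length w = word_length G S h" "set w \<subseteq> S \<union> m_inv G ` S" "word_value G w = h"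
    using word_length_witness[OF assms(1,3)] by auto
  have "word_value G (u @ w) = g \<otimes> h"
    using u w word_letters_closed[OF assms(1)] by (subst word_value_append) auto
  then show ?thesis using word_length_le[of "u @ w" S] u w by auto
qed

lemma word_length_inv_le:
  assumes "S \<subseteq> carrier G" "g \<in> generate G S"
  shows "word_length G S (inv g) \<le> word_length G S g"
proof -
  obtain u where u: "length u = word_length G S g" "set u \<subseteq> S \<union> m_inv G ` S" "word_value G u = g"
    using word_length_witness[OF assms] by auto
  have "m_inv G ` set u \<subseteq> S \<union> m_inv G ` S"
    using u(2) assms(1) by (fastforce simp: image_subset_iff)
  then show ?thesis
    using word_length_le[of "rev (map (m_inv G) u)" S] word_value_rev_inv[of u] u
      word_letters_closed[OF assms(1)] by auto
qed

lemma word_length_inv: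
  assumes "S \<subseteq> carrier G" "g \<in> generate G S"
  shows "word_length G S (inv g) = word_length G S g"
  by (rule antisym[OF word_length_inv_le[OF assms]])
    (metis assms generate_in_carrier generate_m_inv_closed inv_inv word_length_inv_le)

lemma word_ball_finite:
  assumes "finite S" "S \<subseteq> carrier G"
  shows "finite {g \<in> generate G S. word_length G S g \<le> n}"
proof (rule finite_subset)
  show "{g \<in> generate G S. word_length G S g \<le> n}
      \<subseteq> word_value G ` {w. set w \<subseteq> S \<union> m_inv G ` S \<and> length w \<le> n}"
    using word_length_witness[OF assms(2)] by (fastforce simp: image_iff)
  show "finite (word_value G ` {w. set w \<subseteq> S \<union> m_inv G ` S \<and> length w \<le> n})"
    using assms(1) by (intro finite_imageI finite_lists_length_le) auto
qed

lemma word_dist_left_mult: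
  assumes "g \<in> carrier G" "x \<in> carrier G" "y \<in> carrier G"
  shows "word_dist G S (g \<otimes> x) (g \<otimes> y) = word_dist G S x y"
proof -
  have "inv (g \<otimes> x) \<otimes> (g \<otimes> y) = inv x \<otimes> y"
    using assms by (simp add: inv_mult_group m_assoc inv_solve_left')
  then show ?thesis by (simp add: word_dist_def)
qed

lemma word_dist_mult_right:
  assumes "x \<in> carrier G" "y \<in> carrier G"
  shows "word_dist G S x (x \<otimes> y) = word_length G S y"
  using assms by (simp add: word_dist_def inv_solve_left' m_assoc[symmetric])

lemma word_value_take_split:
  assumes "set w \<subseteq> carrier G" "i \<le> j"
  shows "word_value G (take j w) = word_value G (take i w) \<otimes> word_value G (drop i (take j w))"
proof -
  have "take j w = take i w @ drop i (take j w)"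
    using assms(2) by (metis append_take_drop_id min.absorb1 take_take)
  moreover have "set (take i w) \<subseteq> carrier G" "set (drop i (take j w)) \<subseteq> carrier G"
    using assms(1) by (meson order_trans set_take_subset set_drop_subset)+
  ultimately show ?thesis by (metis word_value_append)
qed

text \<open>
  A shortcut between two prefixes would shorten the whole word.
\<close>

lemma geodesic_word_prefixes:
  assumes S: "S \<subseteq> carrier G" and w: "length w = word_length G S (word_value G w)" "set w \<subseteq> S \<union> m_inv G ` S"
    and ij: "i \<le> j" "j \<le> length w"
  shows "word_dist G S (word_value G (take i w)) (word_value G (take j w)) = real (j - i)"
proof -
  have wc: "set w \<subseteq> carrier G" using w(2) word_letters_closed[OF S] by auto
  have sub: "set (drop i (take j w)) \<subseteq> S \<union> m_inv G ` S" for i j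
    using w(2) by (meson order_trans set_take_subset set_drop_subset)
  have gen: "word_value G (drop i (take j w)) \<in> generate G S" for i j
    using word_value_in_generate[OF S sub] .
  have subt: "set (take i w) \<subseteq> S \<union> m_inv G ` S" for i
    using sub[of 0 i] by simp
  have gent: "word_value G (take i w) \<in> generate G S" for i
    using word_value_in_generate[OF S subt] .
  let ?m = "word_value G (drop i (take j w))"
  have split: "word_value G (take j w) = word_value G (take i w) \<otimes> ?m"
    by (rule word_value_take_split[OF wc ij(1)])
  have d: "word_dist G S (word_value G (take i w)) (word_value G (take j w)) = word_length G S ?m"
    unfolding split using generate_in_carrier[OF S gen] generate_in_carrier[OF S gent]
    by (intro word_dist_mult_right) auto
  have up: "word_length G S ?m \<le> j - i"
    using word_length_le[OF sub, of i j] ij by simp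
  have "word_value G (take (length w) w) = word_value G (take j w) \<otimes> word_value G (drop j (take (length w) w))"
    using ij by (intro word_value_take_split[OF wc]) simp
  then have "word_length G S (word_value G (take (length w) w)) \<le> word_length G S (word_value G (take j w))
      + word_length G S (word_value G (drop j (take (length w) w)))"
    by (simp only: word_length_mult[OF S gent gen])
  also have "word_length G S (word_value G (take j w)) \<le> word_length G S (word_value G (take i w)) + word_length G S ?m"
    unfolding split by (rule word_length_mult[OF S gent gen])
  also have "word_length G S (word_value G (take i w)) \<le> i"
    using word_length_le[OF subt, of i] by simp
  also have "word_length G S (word_value G (drop j (take (length w) w))) \<le> length w - j"
    using word_length_le[OF sub, of j "length w"] by simp
  finally have "j - i \<le> word_length G S ?m" using w(1) ij by simp
  with up d show ?thesis by simp
qed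

lemma word_geodesic_path:
  assumes S: "S \<subseteq> carrier G" and g: "g \<in> generate G S"
  obtains \<gamma> where "\<gamma> 0 = \<one>" "\<gamma> (word_length G S g) = g" "\<And>i. \<gamma> i \<in> generate G S"
    "\<And>i j. i \<le> j \<Longrightarrow> j \<le> word_length G S g \<Longrightarrow> word_dist G S (\<gamma> i) (\<gamma> j) = real (j - i)"
proof -
  obtain w where w: "length w = word_length G S g" "set w \<subseteq> S \<union> m_inv G ` S" "word_value G w = g"
    using word_length_witness[OF S g] by auto
  have "set (take i w) \<subseteq> S \<union> m_inv G ` S" for i using w(2) by (meson order_trans set_take_subset)
  then have "word_value G (take i w) \<in> generate G S" for i using word_value_in_generate[OF S] by blast
  then show ?thesis
    using geodesic_word_prefixes[OF S _ w(2)] w by (intro that[of "\<lambda>i. word_value G (take i w)"]) auto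
qed

end

locale finitely_generated_group = group G for G (structure) +
  fixes S :: "'a set"
  assumes finite_gens: "finite S" and gens_closed: "S \<subseteq> carrier G"
    and generate_gens: "generate G S = carrier G"
begin

abbreviation \<rho> :: "'a \<Rightarrow> 'a \<Rightarrow> real" where "\<rho> \<equiv> word_dist G S"

abbreviation word_norm :: "'a \<Rightarrow> real" where "word_norm g \<equiv> real (word_length G S g)"

lemma norm_mult: "g \<in> carrier G \<Longrightarrow> h \<in> carrier G \<Longrightarrow> word_norm (g \<otimes> h) \<le> word_norm g + word_norm h"
  using word_length_mult[OF gens_closed, of g h] generate_gens by simp

lemma norm_inv [simp]: "g \<in> carrier G \<Longrightarrow> word_norm (inv g) = word_norm g"
  using word_length_inv[OF gens_closed, of g] generate_gens by simp

lemma \<rho>_self [simp]: "x \<in> carrier G \<Longrightarrow> \<rho> x x = 0"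
  by (simp add: word_dist_def)

lemma \<rho>_commute:
  assumes "x \<in> carrier G" "y \<in> carrier G" shows "\<rho> x y = \<rho> y x"
  using norm_inv[of "inv x \<otimes> y"] assms by (simp add: word_dist_def inv_mult_group)

lemma \<rho>_triangle:
  assumes "x \<in> carrier G" "y \<in> carrier G" "z \<in> carrier G"
  shows "\<rho> x z \<le> \<rho> x y + \<rho> y z"
proof -
  have "inv x \<otimes> z = (inv x \<otimes> y) \<otimes> (inv y \<otimes> z)"
    using assms by (simp add: m_assoc)
  then show ?thesis
    using norm_mult[of "inv x \<otimes> y" "inv y \<otimes> z"] assms by (simp add: word_dist_def)
qed

lemma \<rho>_nonneg [simp]: "0 \<le> \<rho> x y"
  by (simp add: word_dist_def)

lemma geodesic_path:
  assumes "x \<in> carrier G" "y \<in> carrier G"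
  obtains \<gamma> n where "real n = \<rho> x y" "\<gamma> 0 = x" "\<gamma> n = y" "\<And>i. \<gamma> i \<in> carrier G"
    "\<And>i j. i \<le> j \<Longrightarrow> j \<le> n \<Longrightarrow> \<rho> (\<gamma> i) (\<gamma> j) = real (j - i)"
proof -
  have g: "inv x \<otimes> y \<in> generate G S" using assms generate_gens by simp
  obtain \<gamma> where \<gamma>: "\<gamma> 0 = \<one>" "\<gamma> (word_length G S (inv x \<otimes> y)) = inv x \<otimes> y"
    "\<And>i. \<gamma> i \<in> generate G S"
    "\<And>i j. i \<le> j \<Longrightarrow> j \<le> word_length G S (inv x \<otimes> y) \<Longrightarrow> word_dist G S (\<gamma> i) (\<gamma> j) = real (j - i)"
    using word_geodesic_path[OF gens_closed g] by metis
  have c: "\<gamma> i \<in> carrier G" for i using \<gamma>(3) generate_gens by simp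
  show ?thesis
  proof (rule that[of "word_length G S (inv x \<otimes> y)" "\<lambda>i. x \<otimes> \<gamma> i"])
    show "real (word_length G S (inv x \<otimes> y)) = \<rho> x y" by (simp add: word_dist_def)
    show "x \<otimes> \<gamma> 0 = x" "x \<otimes> \<gamma> (word_length G S (inv x \<otimes> y)) = y" "\<And>i. x \<otimes> \<gamma> i \<in> carrier G"
      using assms \<gamma>(1,2) c by simp_all
    show "\<rho> (x \<otimes> \<gamma> i) (x \<otimes> \<gamma> j) = real (j - i)" if "i \<le> j" "j \<le> word_length G S (inv x \<otimes> y)" for i j
      using \<gamma>(4)[OF that] c assms by (simp add: word_dist_left_mult)
  qed
qed

lemma ball_finite: "finite {g \<in> carrier G. word_norm g \<le> r}"
proof -
  have "{g \<in> carrier G. word_norm g \<le> r} \<subseteq> {g \<in> generate G S. word_length G S g \<le> nat \<lfloor>r\<rfloor>}"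
    using generate_gens le_nat_floor by blast
  then show ?thesis by (rule finite_subset[OF _ word_ball_finite[OF finite_gens gens_closed]])
qed

lemma step_bound_imp_dist_bound:
  assumes "\<And>i. p i \<in> carrier G" "\<And>i. i < n \<Longrightarrow> \<rho> (p i) (p (Suc i)) \<le> \<Lambda>" "i \<le> j" "j \<le> n"
  shows "\<rho> (p i) (p j) \<le> \<Lambda> * real (j - i)"
  using assms(3,4)
proof (induction j rule: dec_induct)
  case base then show ?case using assms(1) by simp
next
  case (step j)
  have "\<rho> (p i) (p (Suc j)) \<le> \<rho> (p i) (p j) + \<rho> (p j) (p (Suc j))"
    using assms(1) by (intro \<rho>_triangle)
  also have "\<dots> \<le> \<Lambda> * real (j - i) + \<Lambda>"
    using step assms(2) by (intro add_mono) auto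
  also have "\<dots> = \<Lambda> * real (Suc j - i)"
    using step by (simp add: Suc_diff_le algebra_simps)
  finally show ?case .
qed

end

section \<open>Quasi-geodesics in Cayley graphs\<close>

text \<open>
  Two vertices lie on a common closed edge only if they are equal or adjacent, and then the first clause of
  the path metric gives 0 or 1; otherwise each support is a single vertex and the minimum has one term.
\<close>

lemma cayley_dist_vertices:
  fixes G (structure)
  assumes "group G" "S \<subseteq> carrier G" "generate G S = carrier G" "g \<in> carrier G" "h \<in> carrier G"
  shows "cayley_dist G S (cayley_vertex g) (cayley_vertex h) = word_dist G S g h"
proof -
  interpret group G by fact
  have supp: "coord_support (cayley_vertex x) = {x}" for x :: 'a
    by (auto simp: coord_support_def cayley_vertex_def indicator_def)
  have val: "cayley_vertex x y = (if y = x then 1 else 0)" for x y :: 'a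
    by (auto simp: cayley_vertex_def indicator_def)
  show ?thesis
  proof (cases "\<exists>x y. cayley_adj G S x y \<and> {g} \<union> {h} \<subseteq> {x, y}")
    case True
    then obtain x y where xy: "cayley_adj G S x y" "{g} \<union> {h} \<subseteq> {x, y}" by blast
    have 1: "cayley_dist G S (cayley_vertex g) (cayley_vertex h) = (if g = h then 0 else 1)"
      using True unfolding cayley_dist_def supp by (auto simp: val)
    show ?thesis
    proof (cases "g = h")
      case True
      then show ?thesis using 1 assms by (simp add: word_dist_def)
    next
      case False
      then have "cayley_adj G S g h" using xy by (auto simp: cayley_adj_def)
      then obtain s where s: "s \<in> S" "h = g \<otimes> s \<or> g = h \<otimes> s" unfolding cayley_adj_def by auto
      have sc: "s \<in> carrier G" using s assms by auto
      have "inv g \<otimes> h = s \<or> inv g \<otimes> h = inv s"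
        using s(2) sc assms(4,5) by (auto simp: inv_mult_group m_assoc)
      then have "word_length G S (inv g \<otimes> h) \<le> 1"
        using word_length_le[of "[s]" S] word_length_le[of "[inv s]" S] s sc by auto
      moreover have "word_length G S (inv g \<otimes> h) \<noteq> 0"
      proof
        assume "word_length G S (inv g \<otimes> h) = 0"
        then have "inv g \<otimes> h = \<one>"
          using word_length_eq_0_iff[OF assms(2), of "inv g \<otimes> h"] assms by simp
        then have "g \<otimes> (inv g \<otimes> h) = g" using assms by simp
        then show False using False assms(4,5) by simp
      qed
      ultimately show ?thesis using 1 False by (simp add: word_dist_def)
    qed
  next
    case False
    show ?thesis
      unfolding cayley_dist_def supp if_not_P[OF False] by (simp add: val)
  qed
qed

lemma cayley_vertex_in_graph: "g \<in> carrier G \<Longrightarrow> cayley_vertex g \<in> cayley_graph G S"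
proof -
  assume g: "g \<in> carrier G"
  have supp: "coord_support (cayley_vertex g) = {g}"
    by (auto simp: coord_support_def cayley_vertex_def indicator_def)
  show ?thesis using g unfolding cayley_graph_def
    by (auto simp: supp) (auto simp: cayley_vertex_def)
qed

context finitely_generated_group
begin

lemma cayley_dist_eq_\<rho>:
  "g \<in> carrier G \<Longrightarrow> h \<in> carrier G \<Longrightarrow> cayley_dist G S (cayley_vertex g) (cayley_vertex h) = \<rho> g h"
  using cayley_dist_vertices[OF is_group gens_closed generate_gens] .

text \<open>
  Rounding down the parameter moves it by less than one, which costs \<open>l\<close> in the additive constant.
\<close>

lemma discrete_quasi_geodesic:
  assumes "l \<ge> 1" "c \<ge> 0" and p: "\<And>i. p i \<in> carrier G"
    and lo: "\<And>i j. i \<le> j \<Longrightarrow> j \<le> n \<Longrightarrow> real (j - i) / l - c \<le> \<rho> (p i) (p j)"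
    and up: "\<And>i j. i \<le> j \<Longrightarrow> j \<le> n \<Longrightarrow> \<rho> (p i) (p j) \<le> l * real (j - i) + c"
  shows "quasi_geodesic l (c + l) (cayley_graph G S) (cayley_dist G S) {0..real n}
    (\<lambda>t. cayley_vertex (p (nat \<lfloor>t\<rfloor>)))"
proof -
  have main: "\<bar>s - t\<bar> / l - (c + l) \<le> \<rho> (p (nat \<lfloor>s\<rfloor>)) (p (nat \<lfloor>t\<rfloor>)) \<and>
      \<rho> (p (nat \<lfloor>s\<rfloor>)) (p (nat \<lfloor>t\<rfloor>)) \<le> l * \<bar>s - t\<bar> + (c + l)"
    if st: "0 \<le> s" "s \<le> t" "t \<le> real n" for s t
  proof -
    let ?i = "nat \<lfloor>s\<rfloor>" and ?j = "nat \<lfloor>t\<rfloor>"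
    have ij: "?i \<le> ?j" "?j \<le> n" using st by (auto simp: floor_mono nat_mono) linarith
    have r: "\<bar>real (?j - ?i) - \<bar>s - t\<bar>\<bar> \<le> 1" using st ij(1) by linarith
    have "\<bar>s - t\<bar> / l \<le> (real (?j - ?i) + 1) / l"
      using r assms(1) by (intro divide_right_mono) auto
    also have "\<dots> \<le> real (?j - ?i) / l + l"
    proof -
      have "1 / l \<le> 1" using assms(1) by simp
      then show ?thesis using assms(1) unfolding add_divide_distrib by linarith
    qed
    finally have 1: "\<bar>s - t\<bar> / l - (c + l) \<le> \<rho> (p ?i) (p ?j)" using lo[OF ij] by linarith
    have "l * real (?j - ?i) \<le> l * (\<bar>s - t\<bar> + 1)" using r assms(1) by (intro mult_left_mono) auto
    then have 2: "\<rho> (p ?i) (p ?j) \<le> l * \<bar>s - t\<bar> + (c + l)"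
      using up[OF ij] by (simp add: algebra_simps)
    from 1 2 show ?thesis ..
  qed
  have main': "\<bar>s - t\<bar> / l - (c + l) \<le> \<rho> (p (nat \<lfloor>s\<rfloor>)) (p (nat \<lfloor>t\<rfloor>)) \<and>
      \<rho> (p (nat \<lfloor>s\<rfloor>)) (p (nat \<lfloor>t\<rfloor>)) \<le> l * \<bar>s - t\<bar> + (c + l)"
    if st: "s \<in> {0..real n}" "t \<in> {0..real n}" for s t
  proof (cases "s \<le> t")
    case True then show ?thesis using main[of s t] st by auto
  next
    case False
    then show ?thesis using main[of t s] st \<rho>_commute[OF p p] by (auto simp: abs_minus_commute)
  qed
  show ?thesis
    unfolding quasi_geodesic_def qi_embedding_def
    using main' assms(1,2) p cayley_vertex_in_graph[OF p]
    by (auto simp: cayley_dist_eq_\<rho> is_interval_def dist_real_def)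
qed

end

section \<open>Double cosets of a subgroup of infinite index\<close>

context group
begin

text \<open>
  B. H. Neumann's lemma. If \<open>K\<close> has infinite index, some coset of \<open>K\<close> is not among the finitely many that
  are used. It is disjoint from all of these that are cosets of \<open>K\<close>, so cosets of the other subgroups cover it.
  Right translates of these cosets cover every other coset of \<open>K\<close>, so the subgroup \<open>K\<close> can be dispensed with.
\<close>

lemma neumann_covering:
  assumes "finite \<K>" "\<And>K. K \<in> \<K> \<Longrightarrow> subgroup K G" "finite F" "F \<subseteq> \<K> \<times> carrier G"
    and "carrier G \<subseteq> (\<Union>(K, g)\<in>F. K #> g)"
  shows "\<exists>K\<in>\<K>. finite (rcosets K)"
  using assms
proof (induction \<K> arbitrary: F rule: finite_induct)
  case empty
  then show ?case using one_closed by auto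
next
  case (insert K \<K>)
  show ?case
  proof (cases "finite (rcosets K)")
    case False
    have K: "subgroup K G" using insert.prems(1) by simp
    then interpret K: subgroup K G .
    have "\<not> rcosets K \<subseteq> (\<lambda>(L, g). L #> g) ` F"
      using False finite_subset[OF _ finite_imageI[OF insert.prems(2)]] by blast
    then obtain Y where "Y \<in> rcosets K" "Y \<notin> (\<lambda>(L, g). L #> g) ` F" by blast
    then obtain x where x: "x \<in> carrier G" "K #> x \<notin> (\<lambda>(L, g). L #> g) ` F"
      unfolding RCOSETS_def by blast
    define F' where "F' = F \<inter> \<K> \<times> carrier G"
    have F': "\<exists>(L, g)\<in>F'. k \<otimes> x \<in> L #> g" if k: "k \<in> K" for k
    proof -
      have kx: "k \<otimes> x \<in> carrier G" using k x K.mem_carrier by simp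
      then obtain L g where Lg: "(L, g) \<in> F" "k \<otimes> x \<in> L #> g" using insert.prems(4) by blast
      have g: "g \<in> carrier G" using Lg insert.prems(3) by auto
      have "L \<noteq> K"
      proof
        assume LK: "L = K"
        have "k \<otimes> x \<in> K #> x" using k unfolding r_coset_def by blast
        then have "K #> x = K #> (k \<otimes> x)" by (rule repr_independence[OF _ x(1) K])
        also have "\<dots> = K #> g" using repr_independence[OF _ g K, of "k \<otimes> x"] Lg(2) LK by simp
        finally have "K #> x = (case (L, g) of (L, g) \<Rightarrow> L #> g)" using LK by simp
        then show False using x(2) imageI[OF Lg(1), of "\<lambda>(L, g). L #> g"] by simp
      qed
      then show ?thesis using Lg g insert.prems(3) unfolding F'_def by blast
    qed
    define F'' where "F'' = F' \<union> (\<lambda>((L, h), (M, g)). (L, h \<otimes> inv x \<otimes> g)) ` (F' \<times> F)"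
    have fin: "finite F''" using insert.prems(2) unfolding F''_def F'_def by auto
    have sub: "F'' \<subseteq> \<K> \<times> carrier G"
      using insert.prems(3) x(1) unfolding F''_def F'_def by auto
    have cov: "carrier G \<subseteq> (\<Union>(L, g)\<in>F''. L #> g)"
    proof
      fix y assume "y \<in> carrier G"
      then obtain M g where Mg: "(M, g) \<in> F" "y \<in> M #> g" using insert.prems(4) by blast
      have g: "g \<in> carrier G" using Mg insert.prems(3) by auto
      show "y \<in> (\<Union>(L, g)\<in>F''. L #> g)"
      proof (cases "M = K")
        case True
        then obtain k where k: "k \<in> K" "y = k \<otimes> g" using Mg by (auto simp: r_coset_def)
        obtain L h where Lh: "(L, h) \<in> F'" "k \<otimes> x \<in> L #> h" using F'[OF k(1)] by blast
        then obtain l where l: "l \<in> L" "k \<otimes> x = l \<otimes> h" by (auto simp: r_coset_def)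
        have h: "h \<in> carrier G" "L \<in> \<K>" using Lh unfolding F'_def by auto
        have lc: "l \<in> carrier G" using l(1) h(2) insert.prems(1) subgroup.mem_carrier by (metis insertCI)
        have kc: "k \<in> carrier G" using k(1) by (rule K.mem_carrier)
        have "y = (k \<otimes> x) \<otimes> (inv x \<otimes> g)" using k(2) kc x(1) g by (simp add: m_assoc)
        also have "\<dots> = l \<otimes> (h \<otimes> inv x \<otimes> g)" unfolding l(2) using lc h x(1) g by (simp add: m_assoc)
        finally have "y \<in> L #> (h \<otimes> inv x \<otimes> g)" using l(1) by (auto simp: r_coset_def)
        moreover have "(L, h \<otimes> inv x \<otimes> g) \<in> F''" using Lh(1) Mg(1) unfolding F''_def by force
        ultimately show ?thesis by blast
      next
        case False
        then have "(M, g) \<in> F''" using Mg(1) insert.prems(3) unfolding F''_def F'_def by auto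
        then show ?thesis using Mg(2) by blast
      qed
    qed
    show ?thesis using insert.IH[OF _ fin sub cov] insert.prems(1) by blast
  qed simp
qed

lemma subgroup_conjugate:
  assumes "subgroup H G" "a \<in> carrier G" shows "subgroup ((\<lambda>h. a \<otimes> h \<otimes> inv a) ` H) G"
proof -
  interpret H: subgroup H G by fact
  show ?thesis
  proof (rule subgroupI)
    show "(\<lambda>h. a \<otimes> h \<otimes> inv a) ` H \<subseteq> carrier G" using assms(2) H.mem_carrier by auto
    show "(\<lambda>h. a \<otimes> h \<otimes> inv a) ` H \<noteq> {}" using H.one_closed by blast
    fix x assume "x \<in> (\<lambda>h. a \<otimes> h \<otimes> inv a) ` H"
    then obtain h where h: "h \<in> H" "x = a \<otimes> h \<otimes> inv a" by blast
    then have "inv x = a \<otimes> inv h \<otimes> inv a" using assms(2) H.mem_carrier by (simp add: inv_mult_group m_assoc)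
    then show "inv x \<in> (\<lambda>h. a \<otimes> h \<otimes> inv a) ` H" using h(1) H.m_inv_closed by blast
    fix y assume "y \<in> (\<lambda>h. a \<otimes> h \<otimes> inv a) ` H"
    then obtain k where k: "k \<in> H" "y = a \<otimes> k \<otimes> inv a" by blast
    then have "x \<otimes> y = a \<otimes> (h \<otimes> k) \<otimes> inv a" using h assms(2) H.mem_carrier by (simp add: m_assoc)
    then show "x \<otimes> y \<in> (\<lambda>h. a \<otimes> h \<otimes> inv a) ` H" using h(1) k(1) H.m_closed by blast
  qed
qed

lemma infinite_index_conjugate:
  assumes "subgroup H G" "a \<in> carrier G" "finite (rcosets ((\<lambda>h. a \<otimes> h \<otimes> inv a) ` H))"
  shows "finite (rcosets H)"
proof -
  interpret H: subgroup H G by fact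
  let ?K = "(\<lambda>h. a \<otimes> h \<otimes> inv a) ` H"
  have "H #> x = inv a <# (?K #> (a \<otimes> x))" if "x \<in> carrier G" for x
    using assms(2) that H.mem_carrier by (auto simp: r_coset_def l_coset_def m_assoc)
  then have "rcosets H \<subseteq> (\<lambda>Y. inv a <# Y) ` (rcosets ?K)"
    using assms(2) by (auto simp: RCOSETS_def)
  then show ?thesis using assms(3) finite_surj by blast
qed

text \<open>
  The set \<open>a H b\<close> is the coset of \<open>a H a\<inverse>\<close> that contains \<open>a b\<close>, so Neumann's lemma applies to the conjugates
  of \<open>H\<close>.
\<close>

lemma infinite_index_not_covered:
  assumes H: "subgroup H G" "infinite (rcosets H)" and "finite A" "A \<subseteq> carrier G" "finite B" "B \<subseteq> carrier G"
  shows "\<exists>v\<in>carrier G. \<forall>a\<in>A. \<forall>h\<in>H. \<forall>b\<in>B. v \<noteq> a \<otimes> h \<otimes> b"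
proof (rule ccontr)
  interpret H: subgroup H G by fact
  assume "\<not> ?thesis"
  then have cov: "\<exists>a\<in>A. \<exists>h\<in>H. \<exists>b\<in>B. v = a \<otimes> h \<otimes> b" if "v \<in> carrier G" for v using that by blast
  let ?c = "\<lambda>a. (\<lambda>h. a \<otimes> h \<otimes> inv a) ` H"
  have "\<exists>K\<in>?c ` A. finite (rcosets K)"
  proof (rule neumann_covering)
    show "finite ((\<lambda>(a, b). (?c a, a \<otimes> b)) ` (A \<times> B))" using assms by simp
    show "(\<lambda>(a, b). (?c a, a \<otimes> b)) ` (A \<times> B) \<subseteq> ?c ` A \<times> carrier G" using assms by auto
    show "subgroup K G" if "K \<in> ?c ` A" for K using that subgroup_conjugate[OF H(1)] assms by auto
    show "carrier G \<subseteq> (\<Union>(K, g)\<in>(\<lambda>(a, b). (?c a, a \<otimes> b)) ` (A \<times> B). K #> g)"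
    proof
      fix v assume "v \<in> carrier G"
      then obtain a h b where v: "a \<in> A" "h \<in> H" "b \<in> B" "v = a \<otimes> h \<otimes> b" using cov by blast
      then have c: "a \<in> carrier G" "b \<in> carrier G" "h \<in> carrier G" using assms H.mem_carrier by auto
      have "v = (a \<otimes> h \<otimes> inv a) \<otimes> (a \<otimes> b)" using v(4) c by (simp add: m_assoc)
      then have "v \<in> ?c a #> (a \<otimes> b)" using v(2) by (auto simp: r_coset_def)
      then show "v \<in> (\<Union>(K, g)\<in>(\<lambda>(a, b). (?c a, a \<otimes> b)) ` (A \<times> B). K #> g)" using v(1,3) by blast
    qed
  qed (use assms in simp)
  then show False using infinite_index_conjugate[OF H(1)] H(2) assms(4) by blast
qed

end

section \<open>Gromov products along orbits\<close>

locale hyperbolic_action = group G for G (structure) +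
  fixes X :: "'b set" and d :: "'b \<Rightarrow> 'b \<Rightarrow> real" and \<phi> :: "'a \<Rightarrow> 'b \<Rightarrow> 'b" and \<delta> :: real and x\<^sub>0 :: 'b
  assumes metric: "Metric_space X d"
    and action: "group_action G X \<phi>"
    and isometry: "g \<in> carrier G \<Longrightarrow> x \<in> X \<Longrightarrow> y \<in> X \<Longrightarrow> d (\<phi> g x) (\<phi> g y) = d x y"
    and \<delta>_nonneg: "0 \<le> \<delta>"
    and four_point: "w \<in> X \<Longrightarrow> x \<in> X \<Longrightarrow> y \<in> X \<Longrightarrow> z \<in> X \<Longrightarrow>
      min (gromov_product d w x y) (gromov_product d w y z) - \<delta> \<le> gromov_product d w x z"
    and base: "x\<^sub>0 \<in> X"
begin

abbreviation gp :: "'b \<Rightarrow> 'b \<Rightarrow> 'b \<Rightarrow> real" where "gp \<equiv> gromov_product d"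

lemma d_commute: "d x y = d y x"
  using Metric_space.commute[OF metric] .

lemma d_nonneg [simp]: "0 \<le> d x y"
  using Metric_space.nonneg[OF metric] .

lemma d_self [simp]: "x \<in> X \<Longrightarrow> d x x = 0"
  using Metric_space.mdist_zero[OF metric] .

lemma d_triangle: "x \<in> X \<Longrightarrow> y \<in> X \<Longrightarrow> z \<in> X \<Longrightarrow> d x z \<le> d x y + d y z"
  using Metric_space.triangle[OF metric] .

lemma act_closed [simp]: "g \<in> carrier G \<Longrightarrow> x \<in> X \<Longrightarrow> \<phi> g x \<in> X"
  using group_action.element_image[OF action] by blast

lemma act_mult: "g \<in> carrier G \<Longrightarrow> h \<in> carrier G \<Longrightarrow> x \<in> X \<Longrightarrow> \<phi> (g \<otimes> h) x = \<phi> g (\<phi> h x)"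
  using group_action.composition_rule[OF action] .

lemma act_one [simp]: "x \<in> X \<Longrightarrow> \<phi> \<one> x = x"
  using group_action.id_eq_one[OF action] by (metis restrict_apply)

lemma act_inv_act [simp]: "g \<in> carrier G \<Longrightarrow> x \<in> X \<Longrightarrow> \<phi> (inv g) (\<phi> g x) = x"
  by (simp add: act_mult[symmetric])

lemma act_act_inv [simp]: "g \<in> carrier G \<Longrightarrow> x \<in> X \<Longrightarrow> \<phi> g (\<phi> (inv g) x) = x"
  by (simp add: act_mult[symmetric])

lemma d_act_left: "g \<in> carrier G \<Longrightarrow> x \<in> X \<Longrightarrow> y \<in> X \<Longrightarrow> d (\<phi> g x) y = d x (\<phi> (inv g) y)"
  using isometry[of g x "\<phi> (inv g) y"] by simp

lemma gp_commute: "gp w x y = gp w y x"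
  by (simp add: gromov_product_def d_commute)

lemma gp_act: "g \<in> carrier G \<Longrightarrow> w \<in> X \<Longrightarrow> x \<in> X \<Longrightarrow> y \<in> X \<Longrightarrow> gp (\<phi> g w) (\<phi> g x) (\<phi> g y) = gp w x y"
  by (simp add: gromov_product_def isometry)

lemma gp_le_left: "w \<in> X \<Longrightarrow> x \<in> X \<Longrightarrow> y \<in> X \<Longrightarrow> gp w x y \<le> d w x"
  using d_triangle[of w x y] d_commute by (simp add: gromov_product_def field_simps)

lemma gp_nonneg: "w \<in> X \<Longrightarrow> x \<in> X \<Longrightarrow> y \<in> X \<Longrightarrow> 0 \<le> gp w x y"
  using d_triangle[of x w y] d_commute[of x w] by (simp add: gromov_product_def)

text \<open>
  If a geodesic triangle is compared with a tripod, the two products are the parts into which the centre of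
  the tripod divides the side between \<open>w\<close> and \<open>x\<close>.
\<close>

lemma gp_swap: "gp w x y + gp x w y = d w x"
  by (simp add: gromov_product_def d_commute field_simps)

lemma gp_perturb:
  assumes "w \<in> X" "x \<in> X" "y \<in> X" "w' \<in> X" "x' \<in> X" "y' \<in> X"
  shows "gp w x y \<le> gp w' x' y' + d w w' + d x x' + d y y'"
proof -
  have "d w x \<le> d w w' + d w' x' + d x' x"
    using d_triangle[of w w' x] d_triangle[of w' x' x] assms by linarith
  moreover have "d w y \<le> d w w' + d w' y' + d y' y"
    using d_triangle[of w w' y] d_triangle[of w' y' y] assms by linarith
  moreover have "d x' y' \<le> d x' x + d x y + d y y'"
    using d_triangle[of x' x y'] d_triangle[of x y y'] assms by linarith
  ultimately show ?thesis using d_commute[of x x'] d_commute[of y y']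
    by (simp add: gromov_product_def field_simps)
qed

section \<open>Broken geodesics\<close>

text \<open>
  A list of group elements encodes the broken geodesic of \<open>X\<close> whose vertices are the images of the base point
  under the values of the prefixes. The letter \<open>e\<close> contributes a segment of length \<open>d x\<^sub>0 (\<phi> e x\<^sub>0)\<close>, and the
  Gromov product at the corner between \<open>e\<close> and the next letter \<open>f\<close> is, after translation to the base point, that of
  \<open>\<phi> (inv e) x\<^sub>0\<close> and \<open>\<phi> f x\<^sub>0\<close>. The path does not backtrack if the segments are longer than the products at
  their two ends together; the margin \<open>4 * \<delta> + 1\<close> covers the loss of \<open>\<delta>\<close> at each corner and leaves a gain of at
  least one for each segment.
\<close>

definition long_letter :: "real \<Rightarrow> 'a \<Rightarrow> bool"
  where "long_letter C e \<longleftrightarrow> e \<in> carrier G \<and> 2 * C + 4 * \<delta> + 1 \<le> d x\<^sub>0 (\<phi> e x\<^sub>0)"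

definition wide_corner :: "real \<Rightarrow> 'a \<Rightarrow> 'a \<Rightarrow> bool"
  where "wide_corner C e f \<longleftrightarrow> gp x\<^sub>0 (\<phi> (inv e) x\<^sub>0) (\<phi> f x\<^sub>0) \<le> C"

definition admissible :: "real \<Rightarrow> 'a list \<Rightarrow> bool"
  where "admissible C w \<longleftrightarrow> (\<forall>e\<in>set w. long_letter C e) \<and> successively (wide_corner C) w"

lemma admissible_closed: "admissible C w \<Longrightarrow> set w \<subseteq> carrier G"
  by (auto simp: admissible_def long_letter_def)

lemma admissible_append_iff: "admissible C (u @ w) \<longleftrightarrow>
    admissible C u \<and> admissible C w \<and> (u = [] \<or> w = [] \<or> wide_corner C (last u) (hd w))"
  by (auto simp: admissible_def successively_append_iff)

lemma admissible_replicate: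
  assumes "long_letter C e" "wide_corner C e e"
  shows "admissible C (replicate n e)"
proof (induction n)
  case (Suc n)
  then show ?case using assms
    by (cases n) (auto simp: admissible_def)
qed (simp add: admissible_def)

lemma d_inv_base: "f \<in> carrier G \<Longrightarrow> d x\<^sub>0 (\<phi> (inv f) x\<^sub>0) = d x\<^sub>0 (\<phi> f x\<^sub>0)"
  using d_act_left[of f x\<^sub>0 x\<^sub>0] d_commute[of x\<^sub>0 "\<phi> f x\<^sub>0"] base by simp

lemma long_letter_step:
  assumes "long_letter C f" "x \<in> X" "gp x\<^sub>0 (\<phi> (inv f) x\<^sub>0) x \<le> C + \<delta>"
  shows "d x\<^sub>0 x + 1 \<le> d x\<^sub>0 (\<phi> f x)"
proof -
  have fc: "f \<in> carrier G" and D: "2 * C + 4 * \<delta> + 1 \<le> d x\<^sub>0 (\<phi> f x\<^sub>0)"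
    using assms(1) by (auto simp: long_letter_def)
  have "d x\<^sub>0 (\<phi> f x) = d (\<phi> (inv f) x\<^sub>0) x"
    using d_act_left[OF fc assms(2) base] d_commute by metis
  then have "d x\<^sub>0 (\<phi> f x) = d x\<^sub>0 (\<phi> f x\<^sub>0) + d x\<^sub>0 x - 2 * gp x\<^sub>0 (\<phi> (inv f) x\<^sub>0) x"
    using d_inv_base[OF fc] by (simp add: gromov_product_def field_simps)
  then show ?thesis using D assms(3) \<delta>_nonneg by linarith
qed

text \<open>
  Both claims are proved together by induction on the path. By the induction hypothesis the path after the
  first segment leaves the end of that segment at an angle, so its end point is seen from the base point in the
  direction of the first segment. The hyperbolic inequality therefore bounds the product of the end point with
  \<open>\<phi> (inv e) x\<^sub>0\<close> by the product at the first corner, up to a single \<open>\<delta>\<close> that does not accumulate.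
\<close>

lemma admissible_corner:
  assumes "admissible C w" "w \<noteq> []" "long_letter C e" "wide_corner C e (hd w)"
  shows "real (length w) \<le> d x\<^sub>0 (\<phi> (word_value G w) x\<^sub>0) \<and>
    gp x\<^sub>0 (\<phi> (inv e) x\<^sub>0) (\<phi> (word_value G w) x\<^sub>0) \<le> C + \<delta>"
  using assms
proof (induction w arbitrary: e)
  case (Cons f w)
  have ec: "e \<in> carrier G" and fc: "f \<in> carrier G" and wc: "set w \<subseteq> carrier G"
    and f: "long_letter C f" and aw: "admissible C w"
    using Cons.prems by (auto simp: long_letter_def admissible_def successively_Cons)
  have wv: "word_value G w \<in> carrier G" using wc by simp
  have Df: "2 * C + 4 * \<delta> + 1 \<le> d x\<^sub>0 (\<phi> f x\<^sub>0)" using f by (simp add: long_letter_def)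
  have C0: "0 \<le> C"
    using Cons.prems(4) gp_nonneg[of x\<^sub>0 "\<phi> (inv e) x\<^sub>0" "\<phi> f x\<^sub>0"] base ec fc by (simp add: wide_corner_def)
  show ?case
  proof (cases "w = []")
    case True
    then show ?thesis using Cons.prems(4) Df C0 \<delta>_nonneg fc by (simp add: wide_corner_def)
  next
    case False
    then have "wide_corner C f (hd w)" using Cons.prems(1) by (auto simp: admissible_def successively_Cons)
    note IH = Cons.IH[OF aw False f this]
    let ?x = "\<phi> (word_value G w) x\<^sub>0"
    have x: "?x \<in> X" using wv base by simp
    have fx: "\<phi> (word_value G (f # w)) x\<^sub>0 = \<phi> f ?x" using fc wv base by (simp add: act_mult)
    have f1: "d x\<^sub>0 (\<phi> (inv f) x\<^sub>0) = d x\<^sub>0 (\<phi> f x\<^sub>0)"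
      by (rule d_inv_base[OF fc])
    have len: "real (length (f # w)) \<le> d x\<^sub>0 (\<phi> f ?x)"
      using long_letter_step[OF f x] IH by simp
    have "gp x\<^sub>0 (\<phi> f x\<^sub>0) (\<phi> f ?x) = gp (\<phi> (inv f) x\<^sub>0) x\<^sub>0 ?x"
      using gp_act[OF fc _ base x, of "\<phi> (inv f) x\<^sub>0"] fc base by simp
    also have "\<dots> = d x\<^sub>0 (\<phi> f x\<^sub>0) - gp x\<^sub>0 (\<phi> (inv f) x\<^sub>0) ?x"
      using gp_swap[of x\<^sub>0 "\<phi> (inv f) x\<^sub>0" ?x] f1 by linarith
    finally have big: "gp x\<^sub>0 (\<phi> f ?x) (\<phi> f x\<^sub>0) > C + \<delta>"
      using IH Df \<delta>_nonneg C0 by (simp add: gp_commute)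
    have "min (gp x\<^sub>0 (\<phi> (inv e) x\<^sub>0) (\<phi> f ?x)) (gp x\<^sub>0 (\<phi> f ?x) (\<phi> f x\<^sub>0)) - \<delta> \<le> gp x\<^sub>0 (\<phi> (inv e) x\<^sub>0) (\<phi> f x\<^sub>0)"
      using ec fc x base by (intro four_point) auto
    also have "\<dots> \<le> C" using Cons.prems(4) by (simp add: wide_corner_def)
    finally show ?thesis using big len fx by (simp add: min_def split: if_splits)
  qed
qed simp

lemma admissible_length:
  assumes "admissible C w" "0 \<le> C" shows "real (length w) \<le> d x\<^sub>0 (\<phi> (word_value G w) x\<^sub>0)"
proof (cases w)
  case (Cons f u)
  have f: "long_letter C f" and au: "admissible C u"
    using assms(1) Cons by (auto simp: admissible_def successively_Cons)
  have fc: "f \<in> carrier G" using f by (simp add: long_letter_def)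
  have uc: "word_value G u \<in> carrier G" using admissible_closed[OF au] by simp
  show ?thesis
  proof (cases "u = []")
    case True
    then show ?thesis using f fc assms(2) \<delta>_nonneg Cons by (simp add: long_letter_def)
  next
    case False
    then have "wide_corner C f (hd u)" using assms(1) Cons by (auto simp: admissible_def successively_Cons)
    from admissible_corner[OF au False f this]
    show ?thesis using long_letter_step[OF f, of "\<phi> (word_value G u) x\<^sub>0"] uc fc base Cons
      by (simp add: act_mult)
  qed
qed simp

section \<open>Orbits of loxodromic elements\<close>

lemma quasi_axis_closed: "quasi_axis X d \<phi> f \<alpha> \<Longrightarrow> \<alpha> t \<in> X"
  by (auto simp: quasi_axis_def quasi_geodesic_def qi_embedding_def)

lemma quasi_axis_inv:
  assumes "f \<in> carrier G" "quasi_axis X d \<phi> f \<alpha>" shows "quasi_axis X d \<phi> (inv f) \<alpha>"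
proof -
  obtain \<tau> where \<tau>: "\<tau> \<noteq> 0" "\<And>t. \<phi> f (\<alpha> t) = \<alpha> (t + \<tau>)" using assms(2) by (auto simp: quasi_axis_def)
  have "\<phi> (inv f) (\<alpha> t) = \<alpha> (t + - \<tau>)" for t
    using \<tau>(2)[of "t - \<tau>"] act_inv_act[OF assms(1) quasi_axis_closed[OF assms(2)], of "t - \<tau>"] by simp
  then show ?thesis using assms(2) \<tau>(1) unfolding quasi_axis_def
    by (metis neg_equal_0_iff_equal)
qed

lemma translation_pow:
  assumes "f \<in> carrier G" "\<And>t. \<phi> f (\<alpha> t) = \<alpha> (t + \<tau>)" "\<And>t. \<alpha> t \<in> X"
  shows "\<phi> (f [^] n) (\<alpha> t) = \<alpha> (t + real n * \<tau>)"
proof (induction n)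
  case 0
  then show ?case using assms(3) by simp
next
  case (Suc n)
  then show ?case using assms nat_pow_Suc2[OF assms(1), of n]
    by (simp add: act_mult algebra_simps)
qed

lemma quasi_axis_pow:
  assumes "f \<in> carrier G" "quasi_axis X d \<phi> f \<alpha>" "0 < n" shows "quasi_axis X d \<phi> (f [^] (n::nat)) \<alpha>"
proof -
  obtain \<tau> where \<tau>: "\<tau> \<noteq> 0" "\<And>t. \<phi> f (\<alpha> t) = \<alpha> (t + \<tau>)" using assms(2) by (auto simp: quasi_axis_def)
  have "\<forall>t. \<phi> (f [^] n) (\<alpha> t) = \<alpha> (t + real n * \<tau>)"
    using translation_pow[where f = f and \<alpha> = \<alpha> and \<tau> = \<tau>, OF assms(1) \<tau>(2) quasi_axis_closed[OF assms(2)]] by blast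
  moreover have "real n * \<tau> \<noteq> 0" using \<tau>(1) assms(3) by simp
  ultimately show ?thesis using assms(2) unfolding quasi_axis_def by blast
qed

lemma orbit_linear_growth:
  assumes "f \<in> carrier G" "quasi_axis X d \<phi> f \<alpha>"
  obtains \<epsilon> c where "0 < \<epsilon>" "\<And>n::nat. \<epsilon> * real n - c \<le> d x\<^sub>0 (\<phi> (f [^] n) x\<^sub>0)"
proof -
  obtain \<tau> where \<tau>: "\<tau> \<noteq> 0" "\<And>t. \<phi> f (\<alpha> t) = \<alpha> (t + \<tau>)" using assms(2) by (auto simp: quasi_axis_def)
  obtain l c where lc: "l \<ge> 1" "c \<ge> 0"
    "\<And>s t. \<bar>s - t\<bar> / l - c \<le> d (\<alpha> s) (\<alpha> t)"
    using assms(2) by (auto simp: quasi_axis_def quasi_geodesic_def qi_embedding_def dist_real_def)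
  have a: "\<alpha> t \<in> X" for t using quasi_axis_closed[OF assms(2)] .
  show ?thesis
  proof (rule that[of "\<bar>\<tau>\<bar> / l" "c + 2 * d x\<^sub>0 (\<alpha> 0)"])
    show "0 < \<bar>\<tau>\<bar> / l" using \<tau> lc by simp
    fix n :: nat
    have fn: "f [^] n \<in> carrier G" using assms(1) by simp
    have "\<bar>\<tau>\<bar> / l * real n - c \<le> d (\<alpha> 0) (\<phi> (f [^] n) (\<alpha> 0))"
      using lc(3)[of 0 "real n * \<tau>"] translation_pow[where f = f and \<alpha> = \<alpha> and \<tau> = \<tau> and n = n and t = 0, OF assms(1) \<tau>(2) a]
      by (simp add: abs_mult mult.commute)
    also have "\<dots> \<le> d (\<alpha> 0) x\<^sub>0 + d x\<^sub>0 (\<phi> (f [^] n) x\<^sub>0) + d (\<phi> (f [^] n) x\<^sub>0) (\<phi> (f [^] n) (\<alpha> 0))"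
      using d_triangle[of "\<alpha> 0" x\<^sub>0 "\<phi> (f [^] n) (\<alpha> 0)"]
        d_triangle[of x\<^sub>0 "\<phi> (f [^] n) x\<^sub>0" "\<phi> (f [^] n) (\<alpha> 0)"] a base fn by simp
    finally show "\<bar>\<tau>\<bar> / l * real n - (c + 2 * d x\<^sub>0 (\<alpha> 0)) \<le> d x\<^sub>0 (\<phi> (f [^] n) x\<^sub>0)"
      using isometry[OF fn base a] d_commute[of x\<^sub>0 "\<alpha> 0"] by simp
  qed
qed

text \<open>
  Otherwise \<open>D (2 ^ k)\<close> would grow at most linearly in \<open>k\<close>.
\<close>

lemma linear_growth_doubling:
  fixes D :: "nat \<Rightarrow> real"
  assumes "0 < \<epsilon>" "\<And>n. \<epsilon> * real n - c \<le> D n"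
  shows "\<exists>p>0. D p + B \<le> D (2 * p)"
proof (rule ccontr)
  assume no: "\<not> ?thesis"
  have lt: "D (2 * p) < D p + \<bar>B\<bar>" if "0 < p" for p
  proof -
    have "\<not> D p + B \<le> D (2 * p)" using that no by blast
    then show ?thesis by linarith
  qed
  have log: "D (2 ^ k) \<le> D 1 + real k * \<bar>B\<bar>" for k
  proof (induction k)
    case (Suc k)
    then show ?case using lt[of "2 ^ k"] by (simp add: algebra_simps)
  qed simp
  define m where "m = Suc (nat \<lceil>max ((2 * \<bar>B\<bar> + 1) / \<epsilon>) (c + D 1)\<rceil>)"
  have m: "(2 * \<bar>B\<bar> + 1) / \<epsilon> \<le> real m" "c + D 1 < real m"
    unfolding m_def by linarith+
  have "(2 * \<bar>B\<bar> + 1) * real m \<le> (\<epsilon> * real m) * real m"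
    using m(1) assms(1) by (intro mult_right_mono) (simp_all add: pos_divide_le_eq mult.commute)
  also have "\<dots> = \<epsilon> * (real m * real m)" by simp
  also have "\<dots> \<le> \<epsilon> * (2 ^ m * 2 ^ m)"
    using assms(1) of_nat_less_two_power[of m, where 'a = real]
    by (intro mult_left_mono mult_mono) auto
  also have "\<dots> = \<epsilon> * real (2 ^ (2 * m))" by (simp add: power_add mult_2)
  also have "\<dots> \<le> D (2 ^ (2 * m)) + c" using assms(2)[of "2 ^ (2 * m)"] by simp
  also have "\<dots> \<le> D 1 + 2 * real m * \<bar>B\<bar> + c" using log[of "2 * m"] by simp
  finally show False using m(2) by (simp add: algebra_simps)
qed

lemma long_letter_inv: "long_letter C y \<Longrightarrow> long_letter C (inv y)"
  by (auto simp: long_letter_def d_inv_base)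

lemma wide_corner_inv: "f \<in> carrier G \<Longrightarrow> e \<in> carrier G \<Longrightarrow> wide_corner C e f \<Longrightarrow> wide_corner C (inv f) (inv e)"
  by (simp add: wide_corner_def gp_commute)

text \<open>
  Let \<open>D n\<close> be the displacement of \<open>f [^] n\<close>. The product at the corner between two letters \<open>f [^] p\<close> is
  \<open>D p - D (2 * p) / 2\<close>. So a power with \<open>D p + 4 * \<delta> + 1 \<le> D (2 * p)\<close> is a long letter for
  \<open>C = (D p - (4 * \<delta> + 1)) / 2\<close>, and such a power exists because \<open>D\<close> grows linearly.
\<close>

lemma admissible_power:
  assumes "f \<in> carrier G" "quasi_axis X d \<phi> f \<alpha>"
  obtains p C where "0 < p" "0 \<le> C" "long_letter C (f [^] (p::nat))" "wide_corner C (f [^] p) (f [^] p)"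
proof -
  obtain \<epsilon> c where "0 < \<epsilon>" "\<And>n::nat. \<epsilon> * real n - c \<le> d x\<^sub>0 (\<phi> (f [^] n) x\<^sub>0)"
    using orbit_linear_growth[OF assms] by metis
  then obtain p :: nat where p: "0 < p"
    "d x\<^sub>0 (\<phi> (f [^] p) x\<^sub>0) + (4 * \<delta> + 1) \<le> d x\<^sub>0 (\<phi> (f [^] (2 * p)) x\<^sub>0)"
    using linear_growth_doubling[of \<epsilon> c "\<lambda>n. d x\<^sub>0 (\<phi> (f [^] n) x\<^sub>0)" "4 * \<delta> + 1"] by metis
  let ?y = "f [^] p" and ?D = "d x\<^sub>0 (\<phi> (f [^] p) x\<^sub>0)"
  let ?C = "?D / 2 - (4 * \<delta> + 1) / 2"
  have y: "?y \<in> carrier G" using assms(1) by simp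
  have "f [^] (2 * p) = ?y \<otimes> ?y" using assms(1) by (simp add: nat_pow_mult mult_2)
  then have "d (\<phi> (inv ?y) x\<^sub>0) (\<phi> ?y x\<^sub>0) = d x\<^sub>0 (\<phi> (f [^] (2 * p)) x\<^sub>0)"
    using y base by (simp add: d_act_left act_mult)
  then have w: "gp x\<^sub>0 (\<phi> (inv ?y) x\<^sub>0) (\<phi> ?y x\<^sub>0) \<le> ?C"
    using p(2) d_inv_base[OF y] by (simp add: gromov_product_def field_simps)
  have "0 \<le> gp x\<^sub>0 (\<phi> (inv ?y) x\<^sub>0) (\<phi> ?y x\<^sub>0)" using y base by (intro gp_nonneg) auto
  then show ?thesis
    using w y by (intro that[of p ?C]) (auto simp: long_letter_def wide_corner_def p(1) field_simps)
qed

lemma power_displacement: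
  assumes "long_letter C y" "wide_corner C y y" "0 \<le> C"
  shows "real n \<le> d x\<^sub>0 (\<phi> (y [^] n) x\<^sub>0)"
  using admissible_length[OF admissible_replicate[OF assms(1,2)] assms(3), of n] assms(1)
  by (simp add: word_value_replicate long_letter_def)

lemma power_corner_one:
  assumes "long_letter C y" "wide_corner C y y" "0 \<le> C"
  shows "gp x\<^sub>0 (\<phi> (inv y) x\<^sub>0) (\<phi> (y [^] (m::nat)) x\<^sub>0) \<le> C + \<delta>"
proof (cases "m = 0")
  case True
  then show ?thesis
    using assms base \<delta>_nonneg by (simp add: gromov_product_def d_commute long_letter_def)
next
  case False
  then show ?thesis
    using admissible_corner[OF admissible_replicate[OF assms(1,2), of m] _ assms(1)] assms
    by (simp add: word_value_replicate long_letter_def)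
qed

text \<open>
  The points \<open>\<phi> (inv y) x\<^sub>0\<close> and \<open>\<phi> (inv (y [^] n)) x\<^sub>0\<close> lie in the same direction from the base point, so the
  bound for the first, which is that of an admissible path, carries over to the second.
\<close>

lemma power_corner:
  assumes y: "long_letter C y" "wide_corner C y y" "0 \<le> C"
  shows "gp x\<^sub>0 (\<phi> (inv (y [^] (n::nat))) x\<^sub>0) (\<phi> (y [^] (m::nat)) x\<^sub>0) \<le> C + 2 * \<delta>"
proof (cases n)
  case 0
  then show ?thesis using assms base \<delta>_nonneg by (simp add: gromov_product_def d_commute)
next
  case (Suc k)
  have yc: "y \<in> carrier G" using y by (simp add: long_letter_def)
  have y': "long_letter C (inv y)" "wide_corner C (inv y) (inv y)"
    using y yc by (auto intro: long_letter_inv wide_corner_inv)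
  have inv_pow: "inv (y [^] j) = inv y [^] j" for j :: nat using yc by (simp add: nat_pow_inv)
  have eq: "\<phi> (inv (y [^] n)) x\<^sub>0 = \<phi> (inv y) (\<phi> (inv (y [^] k)) x\<^sub>0)"
    using nat_pow_Suc2[of "inv y" k] yc base unfolding Suc inv_pow
    by (simp add: act_mult del: nat_pow_Suc)
  have "gp (\<phi> (inv y) x\<^sub>0) x\<^sub>0 (\<phi> (inv (y [^] n)) x\<^sub>0) = gp x\<^sub>0 (\<phi> y x\<^sub>0) (\<phi> (inv (y [^] k)) x\<^sub>0)"
    using gp_act[of "inv y" x\<^sub>0 "\<phi> y x\<^sub>0" "\<phi> (inv (y [^] k)) x\<^sub>0"] yc base eq by simp
  also have "\<dots> \<le> C + \<delta>" using power_corner_one[OF y' y(3), of k] yc by (simp add: inv_pow)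
  finally have "gp x\<^sub>0 (\<phi> (inv y) x\<^sub>0) (\<phi> (inv (y [^] n)) x\<^sub>0) > C + 2 * \<delta>"
    using gp_swap[of x\<^sub>0 "\<phi> (inv y) x\<^sub>0" "\<phi> (inv (y [^] n)) x\<^sub>0"] y'(1) y(3) \<delta>_nonneg
    by (simp add: long_letter_def)
  moreover have "min (gp x\<^sub>0 (\<phi> (inv y) x\<^sub>0) (\<phi> (inv (y [^] n)) x\<^sub>0))
      (gp x\<^sub>0 (\<phi> (inv (y [^] n)) x\<^sub>0) (\<phi> (y [^] m) x\<^sub>0)) - \<delta> \<le> gp x\<^sub>0 (\<phi> (inv y) x\<^sub>0) (\<phi> (y [^] m) x\<^sub>0)"
    using yc base by (intro four_point) auto
  moreover note power_corner_one[OF y, of m]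
  ultimately show ?thesis by (simp add: min_def split: if_splits)
qed

section \<open>Orbit rays and their end points\<close>

text \<open>
  The inequality says that \<open>u\<close> converges to a boundary point at a definite rate.
\<close>

definition ray :: "real \<Rightarrow> (nat \<Rightarrow> 'b) \<Rightarrow> bool"
  where "ray A u \<longleftrightarrow> range u \<subseteq> X \<and> (\<forall>n m. real (min n m) - A \<le> gp x\<^sub>0 (u n) (u m))"

lemma orbit_ray:
  assumes y: "long_letter C y" "wide_corner C y y" "0 \<le> C"
  shows "ray (C + 2 * \<delta>) (\<lambda>n. \<phi> (y [^] n) x\<^sub>0)"
proof -
  have yc: "y \<in> carrier G" using y by (simp add: long_letter_def)
  have le: "real n - (C + 2 * \<delta>) \<le> gp x\<^sub>0 (\<phi> (y [^] n) x\<^sub>0) (\<phi> (y [^] m) x\<^sub>0)" if "n \<le> m" for n m :: nat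
  proof -
    let ?g = "y [^] n"
    have g: "?g \<in> carrier G" using yc by simp
    have "\<phi> (y [^] m) x\<^sub>0 = \<phi> ?g (\<phi> (y [^] (m - n)) x\<^sub>0)"
      using that yc base by (simp add: act_mult[symmetric] nat_pow_mult)
    then have "gp (\<phi> ?g x\<^sub>0) x\<^sub>0 (\<phi> (y [^] m) x\<^sub>0) = gp x\<^sub>0 (\<phi> (inv ?g) x\<^sub>0) (\<phi> (y [^] (m - n)) x\<^sub>0)"
      using gp_act[OF g base, of "\<phi> (inv ?g) x\<^sub>0" "\<phi> (y [^] (m - n)) x\<^sub>0"] g yc base by simp
    then show ?thesis
      using gp_swap[of x\<^sub>0 "\<phi> ?g x\<^sub>0" "\<phi> (y [^] m) x\<^sub>0"] power_corner[OF y, of n "m - n"]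
        power_displacement[OF y, of n] by linarith
  qed
  show ?thesis unfolding ray_def
  proof (intro conjI allI)
    show "real (min n m) - (C + 2 * \<delta>) \<le> gp x\<^sub>0 (\<phi> (y [^] n) x\<^sub>0) (\<phi> (y [^] m) x\<^sub>0)" for n m :: nat
      using le[of n m] le[of m n] by (cases "n \<le> m") (auto simp: gp_commute min_def)
  qed (use yc base in auto)
qed

text \<open>
  A change of base point changes Gromov products by a bounded amount.
\<close>

lemma products_to_infinity_iff:
  assumes "range u \<subseteq> X" "range v \<subseteq> X"
  shows "products_to_infinity X d u v \<longleftrightarrow> (\<forall>B. \<exists>N. \<forall>n\<ge>N. \<forall>m\<ge>N. B \<le> gp x\<^sub>0 (u n) (v m))"
proof
  assume "products_to_infinity X d u v"
  then have "filterlim (\<lambda>(i, j). gp x\<^sub>0 (u i) (v j)) at_top (sequentially \<times>\<^sub>F sequentially)"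
    using base by (simp add: products_to_infinity_def)
  then show "\<forall>B. \<exists>N. \<forall>n\<ge>N. \<forall>m\<ge>N. B \<le> gp x\<^sub>0 (u n) (v m)"
    by (simp add: filterlim_at_top eventually_prod_sequentially) blast
next
  assume *: "\<forall>B. \<exists>N. \<forall>n\<ge>N. \<forall>m\<ge>N. B \<le> gp x\<^sub>0 (u n) (v m)"
  show "products_to_infinity X d u v"
    unfolding products_to_infinity_def filterlim_at_top eventually_prod_sequentially
  proof (intro ballI allI)
    fix w B assume w: "w \<in> X"
    obtain N where N: "\<And>n m. n \<ge> N \<Longrightarrow> m \<ge> N \<Longrightarrow> B + d x\<^sub>0 w \<le> gp x\<^sub>0 (u n) (v m)"
      using * by meson
    have "B \<le> gp w (u n) (v m)" if "n \<ge> N" "m \<ge> N" for n m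
      using N[OF that] gp_perturb[of x\<^sub>0 "u n" "v m" w "u n" "v m"] assms w base
      by (auto simp: image_subset_iff)
    then show "\<exists>N. \<forall>m\<ge>N. \<forall>n\<ge>N. B \<le> (case (n, m) of (i, j) \<Rightarrow> gp w (u i) (v j))"
      by auto
  qed
qed

text \<open>
  Replacing the two points by points at bounded distance changes their Gromov product by a bounded amount.
\<close>

lemma products_to_infinity_shadow:
  assumes u: "range u \<subseteq> X" "range v \<subseteq> X" and a: "range a \<subseteq> X" "range b \<subseteq> X"
    and inf: "products_to_infinity X d u v"
    and \<kappa>: "filterlim \<kappa> at_top sequentially" "\<And>k. d (a k) (u (\<kappa> k)) \<le> A"
    and \<mu>: "filterlim \<mu> at_top sequentially" "\<And>k. d (b k) (v (\<mu> k)) \<le> B"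
  shows "products_to_infinity X d a b"
  unfolding products_to_infinity_iff[OF a]
proof
  fix K
  obtain N where N: "\<And>n m. n \<ge> N \<Longrightarrow> m \<ge> N \<Longrightarrow> K + A + B \<le> gp x\<^sub>0 (u n) (v m)"
    using inf unfolding products_to_infinity_iff[OF u] by meson
  obtain N1 where N1: "\<And>k. k \<ge> N1 \<Longrightarrow> N \<le> \<kappa> k"
    using \<kappa>(1) by (auto simp: filterlim_at_top eventually_sequentially)
  obtain N2 where N2: "\<And>k. k \<ge> N2 \<Longrightarrow> N \<le> \<mu> k"
    using \<mu>(1) by (auto simp: filterlim_at_top eventually_sequentially)
  have "K \<le> gp x\<^sub>0 (a n) (b m)" if "n \<ge> max N1 N2" "m \<ge> max N1 N2" for n m
    using N[OF N1[of n] N2[of m]] that gp_perturb[of x\<^sub>0 "u (\<kappa> n)" "v (\<mu> m)" x\<^sub>0 "a n" "b m"]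
      \<kappa>(2)[of n] \<mu>(2)[of m] u a base d_commute
    by (fastforce simp: image_subset_iff)
  then show "\<exists>N. \<forall>n\<ge>N. \<forall>m\<ge>N. K \<le> gp x\<^sub>0 (a n) (b m)" by blast
qed

text \<open>
  Points \<open>u n\<close> and \<open>v m\<close> with a very large product must be far out on their rays, hence close, as seen from the
  base point, to all later points of these rays up to any given index. So one such pair bounds \<open>gp x\<^sub>0 (u i) (v j)\<close>
  from below by about \<open>min i j\<close>.
\<close>

lemma rays_diverge_or_converge:
  assumes u: "ray A u" and v: "ray B v" and unb: "\<And>K. \<exists>n m. K < gp x\<^sub>0 (u n) (v m)"
  shows "products_to_infinity X d u v"
proof -
  have ux: "u n \<in> X" and vx: "v n \<in> X" for n using u v by (auto simp: ray_def)
  have lo: "real (min i j) - max A B - 2 * \<delta> \<le> gp x\<^sub>0 (u i) (v j)" for i j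
  proof -
    define K where "K = real (i + j) + \<bar>A\<bar> + Max ((\<lambda>n. d x\<^sub>0 (u n)) ` {..i}) + Max ((\<lambda>n. d x\<^sub>0 (v n)) ` {..j})"
    obtain n m where nm: "K < gp x\<^sub>0 (u n) (v m)" using unb by blast
    have M0: "0 \<le> Max ((\<lambda>n. d x\<^sub>0 (u n)) ` {..i})" "0 \<le> Max ((\<lambda>n. d x\<^sub>0 (v n)) ` {..j})"
      by (meson Max_ge atMost_iff d_nonneg finite_atMost finite_imageI image_eqI le0 order_trans)+
    have ni: "i \<le> n"
    proof (rule ccontr)
      assume "\<not> i \<le> n"
      then have "d x\<^sub>0 (u n) \<le> Max ((\<lambda>n. d x\<^sub>0 (u n)) ` {..i})" by (intro Max_ge) auto
      then show False using nm gp_le_left[OF base ux vx, of n m] M0 by (simp add: K_def)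
    qed
    have mj: "j \<le> m"
    proof (rule ccontr)
      assume "\<not> j \<le> m"
      then have "d x\<^sub>0 (v m) \<le> Max ((\<lambda>n. d x\<^sub>0 (v n)) ` {..j})" by (intro Max_ge) auto
      then show False using nm gp_le_left[OF base vx ux, of m n] M0 by (simp add: K_def gp_commute)
    qed
    have 1: "real i - A \<le> gp x\<^sub>0 (u i) (u n)"
      using u ni unfolding ray_def by (metis min.absorb1)
    have 2: "real j - B \<le> gp x\<^sub>0 (v m) (v j)"
      using v mj unfolding ray_def by (metis min.absorb2)
    have 3: "min (gp x\<^sub>0 (u i) (u n)) (gp x\<^sub>0 (u n) (v j)) - \<delta> \<le> gp x\<^sub>0 (u i) (v j)"
      using ux vx base by (intro four_point) auto
    have 4: "min (gp x\<^sub>0 (u n) (v m)) (gp x\<^sub>0 (v m) (v j)) - \<delta> \<le> gp x\<^sub>0 (u n) (v j)"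
      using ux vx base by (intro four_point) auto
    have 5: "real (min i j) - max A B \<le> gp x\<^sub>0 (u n) (v m)"
      using nm M0 unfolding K_def by linarith
    show ?thesis using 1 2 3 4 5 \<delta>_nonneg by (simp add: min_def max_def split: if_splits)
  qed
  have "\<exists>N. \<forall>n\<ge>N. \<forall>m\<ge>N. K \<le> gp x\<^sub>0 (u n) (v m)" for K
  proof (intro exI allI impI)
    fix n m assume "nat \<lceil>K + max A B + 2 * \<delta>\<rceil> \<le> n" "nat \<lceil>K + max A B + 2 * \<delta>\<rceil> \<le> m"
    then have "K + max A B + 2 * \<delta> \<le> real (min n m)" by linarith
    then show "K \<le> gp x\<^sub>0 (u n) (v m)" using lo[of n m] by linarith
  qed
  then show ?thesis using ux vx by (subst products_to_infinity_iff) auto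
qed

text \<open>
  The positive powers of \<open>y\<close> follow the half of the axis on the side of the translation, which is why \<open>s\<close> is the
  sign of the translation length \<open>\<tau>\<close>.
\<close>

lemma axis_shadows_orbit_ray:
  assumes "y \<in> carrier G" "quasi_axis X d \<phi> y \<alpha>"
  obtains s \<kappa> A where "s = 1 \<or> s = -1" "filterlim \<kappa> at_top sequentially"
    "\<And>k::nat. d (\<alpha> (s * real k)) (\<phi> (y [^] (\<kappa> k :: nat)) x\<^sub>0) \<le> A"
proof -
  obtain \<tau> where \<tau>: "\<tau> \<noteq> 0" "\<And>t. \<phi> y (\<alpha> t) = \<alpha> (t + \<tau>)" using assms(2) by (auto simp: quasi_axis_def)
  obtain l c where lc: "l \<ge> 1" "c \<ge> 0"
    "\<And>s t. d (\<alpha> s) (\<alpha> t) \<le> l * \<bar>s - t\<bar> + c"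
    using assms(2) by (auto simp: quasi_axis_def quasi_geodesic_def qi_embedding_def dist_real_def)
  have a: "\<alpha> t \<in> X" for t using quasi_axis_closed[OF assms(2)] .
  define \<kappa> where "\<kappa> k = nat \<lfloor>real k / \<bar>\<tau>\<bar>\<rfloor>" for k :: nat
  show ?thesis
  proof (rule that[of "sgn \<tau>" \<kappa> "l * \<bar>\<tau>\<bar> + c + d (\<alpha> 0) x\<^sub>0"])
    show "sgn \<tau> = 1 \<or> sgn \<tau> = - 1" using \<tau>(1) by (simp add: sgn_real_def)
    show "filterlim \<kappa> at_top sequentially"
      unfolding filterlim_at_top eventually_sequentially
    proof
      fix Z :: nat
      have "Z \<le> \<kappa> k" if "nat \<lceil>real Z * \<bar>\<tau>\<bar>\<rceil> \<le> k" for k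
      proof -
        have "real Z * \<bar>\<tau>\<bar> \<le> real k" using that by linarith
        then have "real Z \<le> real k / \<bar>\<tau>\<bar>" using \<tau>(1) by (simp add: pos_le_divide_eq)
        then show ?thesis unfolding \<kappa>_def by (simp add: le_nat_floor)
      qed
      then show "\<exists>N. \<forall>k\<ge>N. Z \<le> \<kappa> k" by blast
    qed
    fix k :: nat
    define r where "r = sgn \<tau> * real k - real (\<kappa> k) * \<tau>"
    have g: "y [^] \<kappa> k \<in> carrier G" using assms(1) by simp
    have "sgn \<tau> * (real k - real (\<kappa> k) * \<bar>\<tau>\<bar>) = sgn \<tau> * real k - real (\<kappa> k) * (sgn \<tau> * \<bar>\<tau>\<bar>)"
      by (simp add: algebra_simps)
    then have "r = sgn \<tau> * (real k - real (\<kappa> k) * \<bar>\<tau>\<bar>)"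
      unfolding r_def by (simp only: sgn_mult_abs)
    moreover have "0 \<le> real k / \<bar>\<tau>\<bar> - real (\<kappa> k)" "real k / \<bar>\<tau>\<bar> - real (\<kappa> k) \<le> 1"
      unfolding \<kappa>_def by simp_all linarith+
    then have "0 \<le> real k - real (\<kappa> k) * \<bar>\<tau>\<bar>" "real k - real (\<kappa> k) * \<bar>\<tau>\<bar> \<le> \<bar>\<tau>\<bar>"
      using \<tau>(1) by (simp_all add: field_simps)
    ultimately have r: "\<bar>r\<bar> \<le> \<bar>\<tau>\<bar>" using \<tau>(1) by (simp add: abs_mult)
    have eq: "\<alpha> (sgn \<tau> * real k) = \<phi> (y [^] \<kappa> k) (\<alpha> r)"
      unfolding r_def by (subst translation_pow[where f = y and \<alpha> = \<alpha> and \<tau> = \<tau>, OF assms(1) \<tau>(2) a]) simp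
    have "d (\<alpha> (sgn \<tau> * real k)) (\<phi> (y [^] \<kappa> k) x\<^sub>0) = d (\<alpha> r) x\<^sub>0"
      unfolding eq using isometry[OF g a base] .
    also have "\<dots> \<le> d (\<alpha> r) (\<alpha> 0) + d (\<alpha> 0) x\<^sub>0" using a base by (intro d_triangle)
    also have "d (\<alpha> r) (\<alpha> 0) \<le> l * \<bar>r\<bar> + c" using lc(3)[of r 0] by simp
    also have "l * \<bar>r\<bar> \<le> l * \<bar>\<tau>\<bar>" using r lc(1) by (intro mult_left_mono) auto
    finally show "d (\<alpha> (sgn \<tau> * real k)) (\<phi> (y [^] \<kappa> k) x\<^sub>0) \<le> l * \<bar>\<tau>\<bar> + c + d (\<alpha> 0) x\<^sub>0"
      by simp
  qed
qed

lemma ray_converges: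
  assumes "ray A u" shows "products_to_infinity X d u u"
proof -
  have "\<exists>N. \<forall>n\<ge>N. \<forall>m\<ge>N. K \<le> gp x\<^sub>0 (u n) (u m)" for K
  proof (intro exI allI impI)
    fix n m assume "nat \<lceil>K + A\<rceil> \<le> n" "nat \<lceil>K + A\<rceil> \<le> m"
    then have "K + A \<le> real (min n m)" by linarith
    moreover have "real (min n m) - A \<le> gp x\<^sub>0 (u n) (u m)" using assms unfolding ray_def by blast
    ultimately show "K \<le> gp x\<^sub>0 (u n) (u m)" by linarith
  qed
  then show ?thesis using assms by (subst products_to_infinity_iff) (auto simp: ray_def)
qed

lemma axis_end_in_boundary:
  assumes "a \<in> gromov_sequences X d"
  defines "R \<equiv> {(x, y). x \<in> gromov_sequences X d \<and> y \<in> gromov_sequences X d \<and> products_to_infinity X d x y}"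
  shows "R `` {a} \<in> gromov_boundary X d" "a \<in> R `` {a}"
proof -
  show "R `` {a} \<in> gromov_boundary X d"
    unfolding gromov_boundary_def R_def using assms(1) by (rule quotientI)
  show "a \<in> R `` {a}" using assms(1) by (simp add: R_def gromov_sequences_def)
qed

text \<open>
  If the products were unbounded, the two orbit rays, and with them one half of each axis, would converge to the
  same boundary point.
\<close>

lemma independent_rays:
  assumes y: "y \<in> carrier G" "quasi_axis X d \<phi> y \<alpha>" "ray A (\<lambda>n. \<phi> (y [^] n) x\<^sub>0)"
    and z: "z \<in> carrier G" "quasi_axis X d \<phi> z \<beta>" "ray B (\<lambda>n. \<phi> (z [^] n) x\<^sub>0)"
    and disj: "axis_ends X d \<alpha> \<inter> axis_ends X d \<beta> = {}"
  shows "\<exists>K. \<forall>n m. gp x\<^sub>0 (\<phi> (y [^] (n::nat)) x\<^sub>0) (\<phi> (z [^] (m::nat)) x\<^sub>0) \<le> K"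
proof (rule ccontr)
  let ?u = "\<lambda>n. \<phi> (y [^] (n::nat)) x\<^sub>0" and ?v = "\<lambda>n. \<phi> (z [^] (n::nat)) x\<^sub>0"
  assume "\<not> ?thesis"
  then have unb: "\<exists>n m. K < gp x\<^sub>0 (?u n) (?v m)" for K by (meson not_less)
  have uv: "products_to_infinity X d ?u ?v" by (rule rays_diverge_or_converge[OF y(3) z(3) unb])
  have uX: "range ?u \<subseteq> X" and vX: "range ?v \<subseteq> X" using y z base by auto
  obtain s \<kappa> A' where s: "s = 1 \<or> s = -1" "filterlim \<kappa> at_top sequentially"
    "\<And>k::nat. d (\<alpha> (s * real k)) (\<phi> (y [^] (\<kappa> k :: nat)) x\<^sub>0) \<le> A'"
    by (rule axis_shadows_orbit_ray[OF y(1,2)]) blast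
  obtain t \<mu> B' where t: "t = 1 \<or> t = -1" "filterlim \<mu> at_top sequentially"
    "\<And>k::nat. d (\<beta> (t * real k)) (\<phi> (z [^] (\<mu> k :: nat)) x\<^sub>0) \<le> B'"
    by (rule axis_shadows_orbit_ray[OF z(1,2)]) blast
  let ?a = "\<lambda>k::nat. \<alpha> (s * real k)" and ?b = "\<lambda>k::nat. \<beta> (t * real k)"
  have aX: "range ?a \<subseteq> X" and bX: "range ?b \<subseteq> X"
    using quasi_axis_closed[OF y(2)] quasi_axis_closed[OF z(2)] by auto
  have a: "?a \<in> gromov_sequences X d" unfolding gromov_sequences_def
    using products_to_infinity_shadow[OF uX uX aX aX ray_converges[OF y(3)] s(2,3) s(2,3)] aX by simp
  have b: "?b \<in> gromov_sequences X d" unfolding gromov_sequences_def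
    using products_to_infinity_shadow[OF vX vX bX bX ray_converges[OF z(3)] t(2,3) t(2,3)] bX by simp
  have ab: "products_to_infinity X d ?a ?b"
    by (rule products_to_infinity_shadow[OF uX vX aX bX uv s(2,3) t(2,3)])
  define R where "R = {(x, y). x \<in> gromov_sequences X d \<and> y \<in> gromov_sequences X d \<and> products_to_infinity X d x y}"
  let ?\<xi> = "R `` {?a}"
  have \<xi>: "?\<xi> \<in> gromov_boundary X d" "?a \<in> ?\<xi>"
    using axis_end_in_boundary[OF a] unfolding R_def by auto
  have b\<xi>: "?b \<in> ?\<xi>" using a b ab by (simp add: R_def)
  have "?\<xi> \<in> axis_ends X d \<alpha>" using \<xi> s(1) unfolding axis_ends_def by auto
  moreover have "?\<xi> \<in> axis_ends X d \<beta>" using \<xi>(1) b\<xi> t(1) unfolding axis_ends_def by auto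
  ultimately show False using disj by blast
qed

section \<open>Schottky pairs\<close>

definition with_inverse :: "'a \<Rightarrow> 'a set" where "with_inverse y = {y, inv y}"

text \<open>
  In the last clause, a point \<open>p\<close> with a small product with both \<open>\<phi> y x\<^sub>0\<close> and \<open>\<phi> (inv y) x\<^sub>0\<close> is one that the base
  point does not see in the direction of the axis of \<open>y\<close>.
\<close>

definition schottky_pair :: "real \<Rightarrow> 'a \<Rightarrow> 'a \<Rightarrow> bool"
  where "schottky_pair C y z \<longleftrightarrow> 0 \<le> C \<and> (\<forall>e \<in> with_inverse y \<union> with_inverse z. long_letter C e \<and> wide_corner C e e) \<and>
    (\<forall>e\<in>with_inverse y. \<forall>f\<in>with_inverse z. wide_corner C e f \<and> wide_corner C f e) \<and>
    (\<forall>p\<in>X. (\<forall>e\<in>with_inverse y. gp x\<^sub>0 (\<phi> e x\<^sub>0) p \<le> C) \<or> (\<forall>e\<in>with_inverse z. gp x\<^sub>0 (\<phi> e x\<^sub>0) p \<le> C))"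

lemma wide_corner_pow:
  assumes "long_letter C y" "wide_corner C y y" "0 \<le> C" "C + 2 * \<delta> \<le> C'"
  shows "wide_corner C' (y [^] (n::nat)) (y [^] n)"
  using power_corner[OF assms(1-3), of n n] assms(4) by (simp add: wide_corner_def)

text \<open>
  Suitable powers of two independent loxodromic elements have products along their orbits that are bounded by one
  constant for all exponents. Passing to a high power \<open>M\<close> makes the letters long without widening this bound.
  A point that is in the direction of both axes would make the product between the two axes large, so the last
  clause costs another \<open>\<delta>\<close>.
\<close>

lemma schottky_pair_exists:
  assumes "non_elementary G X d \<phi>"
  obtains C y z where "schottky_pair C y z"
proof -
  obtain f1 f2 \<alpha>1 \<alpha>2 where f: "f1 \<in> carrier G" "f2 \<in> carrier G" "quasi_axis X d \<phi> f1 \<alpha>1" "quasi_axis X d \<phi> f2 \<alpha>2"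
    and disj: "axis_ends X d \<alpha>1 \<inter> axis_ends X d \<alpha>2 = {}"
  proof -
    from assms obtain f1 f2 \<alpha>1 \<alpha>2 where "loxodromic G X d \<phi> f1" "loxodromic G X d \<phi> f2"
      "quasi_axis X d \<phi> f1 \<alpha>1" "quasi_axis X d \<phi> f2 \<alpha>2" "axis_ends X d \<alpha>1 \<inter> axis_ends X d \<alpha>2 = {}"
      unfolding non_elementary_def by (elim exE conjE)
    then show ?thesis by (intro that[of f1 f2 \<alpha>1 \<alpha>2]) (simp_all add: loxodromic_def)
  qed
  obtain p1 C1 where 1: "0 < p1" "0 \<le> C1" "long_letter C1 (f1 [^] (p1::nat))" "wide_corner C1 (f1 [^] p1) (f1 [^] p1)"
    using admissible_power[OF f(1,3)] by metis
  obtain p2 C2 where 2: "0 < p2" "0 \<le> C2" "long_letter C2 (f2 [^] (p2::nat))" "wide_corner C2 (f2 [^] p2) (f2 [^] p2)"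
    using admissible_power[OF f(2,4)] by metis
  define y where "y = f1 [^] p1"
  define z where "z = f2 [^] p2"
  note 1 = 1[folded y_def] and 2 = 2[folded z_def]
  have yc: "y \<in> carrier G" and zc: "z \<in> carrier G" using f by (auto simp: y_def z_def)
  have yi: "long_letter C1 (inv y)" "wide_corner C1 (inv y) (inv y)"
    using 1 yc by (auto intro: long_letter_inv wide_corner_inv)
  have zi: "long_letter C2 (inv z)" "wide_corner C2 (inv z) (inv z)"
    using 2 zc by (auto intro: long_letter_inv wide_corner_inv)
  have qy: "quasi_axis X d \<phi> e \<alpha>1 \<and> ray (C1 + 2 * \<delta>) (\<lambda>n. \<phi> (e [^] n) x\<^sub>0) \<and> e \<in> carrier G" if "e \<in> with_inverse y" for e
    using that orbit_ray[OF 1(3,4,2)] orbit_ray[OF yi 1(2)] quasi_axis_pow[OF f(1,3) 1(1)] yc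
      quasi_axis_inv[OF yc] unfolding with_inverse_def y_def by auto
  have qz: "quasi_axis X d \<phi> e \<alpha>2 \<and> ray (C2 + 2 * \<delta>) (\<lambda>n. \<phi> (e [^] n) x\<^sub>0) \<and> e \<in> carrier G" if "e \<in> with_inverse z" for e
    using that orbit_ray[OF 2(3,4,2)] orbit_ray[OF zi 2(2)] quasi_axis_pow[OF f(2,4) 2(1)] zc
      quasi_axis_inv[OF zc] unfolding with_inverse_def z_def by auto
  have "\<exists>K. \<forall>n m. gp x\<^sub>0 (\<phi> (e [^] (n::nat)) x\<^sub>0) (\<phi> (g [^] (m::nat)) x\<^sub>0) \<le> K"
    if "e \<in> with_inverse y" "g \<in> with_inverse z" for e g
    using independent_rays[of e \<alpha>1 "C1 + 2 * \<delta>" g \<alpha>2 "C2 + 2 * \<delta>"] qy[OF that(1)] qz[OF that(2)] disj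
    by blast
  then obtain K where K: "\<And>e g n m. e \<in> with_inverse y \<Longrightarrow> g \<in> with_inverse z \<Longrightarrow>
      gp x\<^sub>0 (\<phi> (e [^] (n::nat)) x\<^sub>0) (\<phi> (g [^] (m::nat)) x\<^sub>0) \<le> K e g"
    by metis
  define C0 where "C0 = max (max C1 C2 + 2 * \<delta>) (Max ((\<lambda>(e, g). K e g) ` (with_inverse y \<times> with_inverse z)))"
  have fin: "finite (with_inverse y \<times> with_inverse z)" by (simp add: with_inverse_def)
  have K0: "K e g \<le> C0" if "e \<in> with_inverse y" "g \<in> with_inverse z" for e g
  proof -
    have "K e g \<le> Max ((\<lambda>(e, g). K e g) ` (with_inverse y \<times> with_inverse z))"
      using fin that by (intro Max_ge) (auto simp: image_iff)
    then show ?thesis by (simp add: C0_def)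
  qed
  define C where "C = C0 + \<delta>"
  define M where "M = nat \<lceil>2 * C + 4 * \<delta> + 1\<rceil>"
  have C: "0 \<le> C" "C1 + 2 * \<delta> \<le> C" "C2 + 2 * \<delta> \<le> C"
    using 1(2) \<delta>_nonneg unfolding C_def C0_def by auto
  have M: "2 * C + 4 * \<delta> + 1 \<le> real M" unfolding M_def by linarith
  have fam_y: "e \<in> with_inverse (y [^] M) \<Longrightarrow> \<exists>f\<in>with_inverse y. e = f [^] M" for e
    using yc by (auto simp: with_inverse_def nat_pow_inv)
  have fam_z: "e \<in> with_inverse (z [^] M) \<Longrightarrow> \<exists>f\<in>with_inverse z. e = f [^] M" for e
    using zc by (auto simp: with_inverse_def nat_pow_inv)
  have fam_inv: "inv e \<in> with_inverse g" if "e \<in> with_inverse g" "g \<in> carrier G" for e g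
    using that by (auto simp: with_inverse_def)
  have cross: "gp x\<^sub>0 (\<phi> e x\<^sub>0) (\<phi> f x\<^sub>0) \<le> C0" if ef: "e \<in> with_inverse (y [^] M)" "f \<in> with_inverse (z [^] M)" for e f
  proof -
    obtain e' f' where "e' \<in> with_inverse y" "e = e' [^] M" "f' \<in> with_inverse z" "f = f' [^] M"
      using fam_y[OF ef(1)] fam_z[OF ef(2)] by blast
    then show ?thesis using order_trans[OF K K0] by simp
  qed
  have long: "long_letter C (e [^] M) \<and> wide_corner C (e [^] M) (e [^] M)"
    if "long_letter D e" "wide_corner D e e" "0 \<le> D" "D + 2 * \<delta> \<le> C" for e D
    using power_displacement[OF that(1-3), of M] wide_corner_pow[OF that] M that(1)
    by (auto simp: long_letter_def)
  have "schottky_pair C (y [^] M) (z [^] M)"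
    unfolding schottky_pair_def
  proof (intro conjI ballI)
    show "0 \<le> C" by (fact C)
    fix e assume e: "e \<in> with_inverse (y [^] M) \<union> with_inverse (z [^] M)"
    then have "long_letter C e \<and> wide_corner C e e"
    proof
      assume "e \<in> with_inverse (y [^] M)"
      then obtain f where "f \<in> with_inverse y" "e = f [^] M" using fam_y by blast
      then show ?thesis using long[OF 1(3,4,2) C(2)] long[OF yi 1(2) C(2)] by (auto simp: with_inverse_def)
    next
      assume "e \<in> with_inverse (z [^] M)"
      then obtain f where "f \<in> with_inverse z" "e = f [^] M" using fam_z by blast
      then show ?thesis using long[OF 2(3,4,2) C(3)] long[OF zi 2(2) C(3)] by (auto simp: with_inverse_def)
    qed
    then show "long_letter C e" "wide_corner C e e" by auto
  next
    fix e f assume e: "e \<in> with_inverse (y [^] M)" and f: "f \<in> with_inverse (z [^] M)"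
    show "wide_corner C e f"
      using cross[OF fam_inv[OF e] f] yc \<delta>_nonneg by (simp add: wide_corner_def C_def)
    show "wide_corner C f e"
      using cross[OF e fam_inv[OF f]] zc \<delta>_nonneg by (simp add: wide_corner_def C_def gp_commute)
  next
    fix p assume p: "p \<in> X"
    show "(\<forall>e\<in>with_inverse (y [^] M). gp x\<^sub>0 (\<phi> e x\<^sub>0) p \<le> C) \<or> (\<forall>e\<in>with_inverse (z [^] M). gp x\<^sub>0 (\<phi> e x\<^sub>0) p \<le> C)"
    proof (rule ccontr)
      assume "\<not> ?thesis"
      then obtain e f where ef: "e \<in> with_inverse (y [^] M)" "f \<in> with_inverse (z [^] M)"
        "C < gp x\<^sub>0 (\<phi> e x\<^sub>0) p" "C < gp x\<^sub>0 (\<phi> f x\<^sub>0) p" by (auto simp: not_le)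
      have "e \<in> carrier G" "f \<in> carrier G" using ef yc zc by (auto simp: with_inverse_def)
      then have "min (gp x\<^sub>0 (\<phi> e x\<^sub>0) p) (gp x\<^sub>0 p (\<phi> f x\<^sub>0)) - \<delta> \<le> gp x\<^sub>0 (\<phi> e x\<^sub>0) (\<phi> f x\<^sub>0)"
        using p base by (intro four_point) auto
      then show False using cross[OF ef(1,2)] ef(3,4)
        by (simp add: C_def gp_commute min_def split: if_splits)
    qed
  qed
  then show ?thesis by (rule that)
qed

end

section \<open>Periodic paths\<close>

text \<open>
  The value of the first \<open>t\<close> letters of the periodic infinite word \<open>U U U \<dots>\<close>. Writing it with powers of the value of
  \<open>U\<close> makes the action of that element on the path explicit.
\<close>

definition cyclic_path :: "('a, 'm) monoid_scheme \<Rightarrow> 'a list \<Rightarrow> nat \<Rightarrow> 'a"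
  where "cyclic_path G U t =
    word_value G U [^]\<^bsub>G\<^esub> (t div length U) \<otimes>\<^bsub>G\<^esub> word_value G (take (t mod length U) U)"

context group
begin

lemma cyclic_path_closed [simp]: "set U \<subseteq> carrier G \<Longrightarrow> cyclic_path G U t \<in> carrier G"
  unfolding cyclic_path_def
  by (intro m_closed nat_pow_closed word_value_closed) (auto dest: in_set_takeD)

lemma cyclic_path_add:
  assumes U: "set U \<subseteq> carrier G" "U \<noteq> []" and r: "r \<le> length U"
  shows "cyclic_path G U (q * length U + r) = word_value G U [^] q \<otimes> word_value G (take r U)"
proof (cases "r = length U")
  case True
  then have eq: "q * length U + r = Suc q * length U" by simp
  show ?thesis unfolding cyclic_path_def eq using U True
    by (simp del: mult_Suc add: nat_pow_Suc)
next
  case False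
  then show ?thesis unfolding cyclic_path_def using r U by simp
qed

lemma cyclic_path_shift:
  assumes "set U \<subseteq> carrier G" "U \<noteq> []"
  shows "cyclic_path G U (q * length U + t) = word_value G U [^] q \<otimes> cyclic_path G U t"
proof -
  have "set (take (t mod length U) U) \<subseteq> carrier G" using assms by (auto dest: in_set_takeD)
  then show ?thesis unfolding cyclic_path_def using assms
    by (simp add: nat_pow_mult[symmetric] m_assoc)
qed

lemma cyclic_path_take:
  assumes U: "set U \<subseteq> carrier G" "U \<noteq> []" and t: "t < n * length U"
  shows "cyclic_path G U t = word_value G (take t (concat (replicate n U)))"
proof -
  define q where "q = t div length U"
  define r where "r = t mod length U"
  have tq: "t = q * length U + r" and r: "r < length U" using U by (auto simp: q_def r_def)
  have "q < n" using t unfolding q_def by (simp add: less_mult_imp_div_less)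
  then obtain k where k: "n = q + Suc k" by (metis add_Suc_right less_iff_Suc_add)
  have len: "length (concat (replicate q U)) = q * length U" by (simp add: length_concat sum_list_replicate)
  have "take t (concat (replicate n U)) = concat (replicate q U) @ take r U"
    unfolding k replicate_add concat_append using len r by (simp add: tq)
  moreover have "set (take r U) \<subseteq> carrier G" using U by (auto dest: in_set_takeD)
  moreover have "set (concat (replicate q U)) \<subseteq> carrier G" using U by auto
  ultimately show ?thesis
    using U by (simp add: word_value_append word_value_concat_replicate cyclic_path_def q_def r_def)
qed

lemma cyclic_path_Suc:
  assumes U: "set U \<subseteq> carrier G" "U \<noteq> []"
  shows "\<exists>e\<in>set U. cyclic_path G U (Suc t) = cyclic_path G U t \<otimes> e"
proof -
  define q where "q = t div length U"
  define r where "r = t mod length U"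
  have tq: "t = q * length U + r" and r: "r < length U" using U by (auto simp: q_def r_def)
  have c: "set (take r U) \<subseteq> carrier G" using U by (auto dest: in_set_takeD)
  have e: "U ! r \<in> set U" using r by simp
  then have ec: "U ! r \<in> carrier G" using U by auto
  have "cyclic_path G U (Suc t) = word_value G U [^] q \<otimes> word_value G (take (Suc r) U)"
    using cyclic_path_add[OF U, of "Suc r" q] r tq by simp
  also have "word_value G (take (Suc r) U) = word_value G (take r U) \<otimes> U ! r"
    using r c ec by (simp add: take_Suc_conv_app_nth word_value_append)
  also have "word_value G U [^] q \<otimes> (word_value G (take r U) \<otimes> U ! r) = cyclic_path G U t \<otimes> U ! r"
    using cyclic_path_add[OF U, of r q] r tq c ec U by (simp add: m_assoc)
  finally show ?thesis using e by blast
qed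

end

section \<open>Word length and displacement\<close>

locale acting_group = finitely_generated_group G S + hyperbolic_action G X d \<phi> \<delta> x\<^sub>0
  for G (structure) and S X d \<phi> \<delta> x\<^sub>0
begin

lemma orbit_map_lipschitz:
  obtains K where "1 \<le> K" "\<And>g. g \<in> carrier G \<Longrightarrow> d x\<^sub>0 (\<phi> g x\<^sub>0) \<le> K * word_norm g"
proof -
  define K where "K = Max (insert 1 ((\<lambda>s. d x\<^sub>0 (\<phi> s x\<^sub>0)) ` S))"
  have K1: "1 \<le> K" and KS: "s \<in> S \<Longrightarrow> d x\<^sub>0 (\<phi> s x\<^sub>0) \<le> K" for s
    unfolding K_def using finite_gens by (auto intro!: Max_ge)
  have letter: "d x\<^sub>0 (\<phi> s x\<^sub>0) \<le> K" if "s \<in> S \<union> m_inv G ` S" for s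
    using that KS gens_closed d_inv_base by auto
  have word: "d x\<^sub>0 (\<phi> (word_value G w) x\<^sub>0) \<le> K * real (length w)" if "set w \<subseteq> S \<union> m_inv G ` S" for w
    using that
  proof (induction w)
    case (Cons s w)
    have sc: "s \<in> carrier G" and wc: "word_value G w \<in> carrier G"
      using Cons.prems word_letters_closed[OF gens_closed] by auto
    have "d x\<^sub>0 (\<phi> (word_value G (s # w)) x\<^sub>0) \<le> d x\<^sub>0 (\<phi> s x\<^sub>0) + d (\<phi> s x\<^sub>0) (\<phi> s (\<phi> (word_value G w) x\<^sub>0))"
      using d_triangle[of x\<^sub>0 "\<phi> s x\<^sub>0" "\<phi> s (\<phi> (word_value G w) x\<^sub>0)"] sc wc base by (simp add: act_mult)
    also have "d (\<phi> s x\<^sub>0) (\<phi> s (\<phi> (word_value G w) x\<^sub>0)) = d x\<^sub>0 (\<phi> (word_value G w) x\<^sub>0)"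
      using isometry sc wc base by simp
    also have "\<dots> \<le> K * real (length w)" using Cons by simp
    also have "d x\<^sub>0 (\<phi> s x\<^sub>0) \<le> K" using letter Cons.prems by simp
    finally show ?case by (simp add: algebra_simps)
  qed (use base in simp)
  show ?thesis
  proof (rule that[OF K1])
    fix g assume "g \<in> carrier G"
    then obtain w where "length w = word_length G S g" "set w \<subseteq> S \<union> m_inv G ` S" "word_value G w = g"
      using word_length_witness[OF gens_closed] generate_gens by blast
    then show "d x\<^sub>0 (\<phi> g x\<^sub>0) \<le> K * word_norm g" using word[of w] by simp
  qed
qed

text \<open>
  Quasi-geodesics may jump, so the orbit of the powers of \<open>w\<close>, extended to be constant on unit intervals, is an axis.
\<close>

lemma loxodromicI:
  assumes w: "w \<in> carrier G" and grow: "\<And>n::nat. real n \<le> d x\<^sub>0 (\<phi> (w [^] n) x\<^sub>0)"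
  shows "loxodromic G X d \<phi> w"
proof -
  define \<alpha> where "\<alpha> t = \<phi> (w [^] \<lfloor>t\<rfloor>) x\<^sub>0" for t :: real
  define B where "B = d x\<^sub>0 (\<phi> w x\<^sub>0)"
  have B1: "1 \<le> B" using grow[of 1] w unfolding B_def by simp
  have up: "d x\<^sub>0 (\<phi> (w [^] n) x\<^sub>0) \<le> B * real n" for n :: nat
  proof (induction n)
    case (Suc n)
    have "d x\<^sub>0 (\<phi> (w [^] Suc n) x\<^sub>0) \<le> d x\<^sub>0 (\<phi> (w [^] n) x\<^sub>0) + d (\<phi> (w [^] n) x\<^sub>0) (\<phi> (w [^] n) (\<phi> w x\<^sub>0))"
      using d_triangle[of x\<^sub>0 "\<phi> (w [^] n) x\<^sub>0" "\<phi> (w [^] n) (\<phi> w x\<^sub>0)"] w base by (simp add: act_mult)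
    also have "d (\<phi> (w [^] n) x\<^sub>0) (\<phi> (w [^] n) (\<phi> w x\<^sub>0)) = B"
      unfolding B_def using isometry w base by simp
    finally show ?case using Suc by (simp add: algebra_simps)
  qed (use base in simp)
  have le: "\<bar>s - t\<bar> - 1 \<le> d (\<alpha> s) (\<alpha> t) \<and> d (\<alpha> s) (\<alpha> t) \<le> B * \<bar>s - t\<bar> + B" if "s \<le> t" for s t
  proof -
    define n where "n = nat (\<lfloor>t\<rfloor> - \<lfloor>s\<rfloor>)"
    have fl: "\<lfloor>t\<rfloor> = \<lfloor>s\<rfloor> + int n" using that by (simp add: n_def floor_mono)
    have "d (\<alpha> s) (\<alpha> t) = d x\<^sub>0 (\<phi> (w [^] n) x\<^sub>0)"
      unfolding \<alpha>_def fl using isometry w base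
      by (simp add: int_pow_mult act_mult int_pow_int)
    moreover have n: "\<bar>s - t\<bar> - 1 \<le> real n" "real n \<le> \<bar>s - t\<bar> + 1" using that fl by linarith+
    moreover have "B * real n \<le> B * (\<bar>s - t\<bar> + 1)" using n B1 by (intro mult_left_mono) auto
    ultimately show ?thesis using grow[of n] up[of n] by (simp add: algebra_simps)
  qed
  have bnd: "\<bar>s - t\<bar> / B - B \<le> d (\<alpha> s) (\<alpha> t) \<and> d (\<alpha> s) (\<alpha> t) \<le> B * \<bar>s - t\<bar> + B" for s t
  proof -
    have "\<bar>s - t\<bar> / B \<le> \<bar>s - t\<bar>" using B1 by (simp add: divide_le_eq mult_le_cancel_left1)
    then show ?thesis using le[of s t] le[of t s] B1 d_commute[of "\<alpha> s" "\<alpha> t"]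
      by (cases "s \<le> t") (auto simp: abs_minus_commute)
  qed
  have "quasi_geodesic B B X d UNIV \<alpha>"
    unfolding quasi_geodesic_def qi_embedding_def
    using bnd B1 w base by (auto simp: \<alpha>_def dist_real_def)
  moreover have "\<phi> w (\<alpha> t) = \<alpha> (t + 1)" for t
    unfolding \<alpha>_def using w base int_pow_mult[OF w, of 1 "\<lfloor>t\<rfloor>"] by (simp add: act_mult[symmetric] add.commute)
  ultimately have "(\<exists>l c. quasi_geodesic l c X d UNIV \<alpha>) \<and> (1::real) \<noteq> 0 \<and> (\<forall>t. \<phi> w (\<alpha> t) = \<alpha> (t + 1))"
    by auto
  then have "quasi_axis X d \<phi> w \<alpha>" unfolding quasi_axis_def by blast
  then show ?thesis using w unfolding loxodromic_def by blast
qed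

definition pow_word :: "'a \<Rightarrow> int \<Rightarrow> 'a list"
  where "pow_word a m = (if 0 \<le> m then replicate (nat m) a else replicate (nat (- m)) (inv a))"

lemma pow_word_value:
  assumes "a \<in> carrier G" shows "word_value G (pow_word a m) = a [^] m"
proof (cases "0 \<le> m")
  case True
  then show ?thesis using assms int_pow_int[of G a "nat m"]
    by (simp add: pow_word_def word_value_replicate)
next
  case False
  have "word_value G (pow_word a m) = inv a [^] nat (- m)"
    using assms False by (simp add: pow_word_def word_value_replicate)
  also have "\<dots> = inv (a [^] nat (- m))" using assms by (rule nat_pow_inv)
  also have "\<dots> = a [^] m" using False by (subst int_pow_def2) simp
  finally show ?thesis .
qed

lemma pow_word_length: "length (pow_word a m) = nat \<bar>m\<bar>"
  by (simp add: pow_word_def)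

lemma pow_word_letters: "e \<in> set (pow_word a m) \<Longrightarrow> e \<in> with_inverse a"
  by (simp add: pow_word_def with_inverse_def split: if_split_asm)

lemma pow_word_admissible:
  assumes "\<And>e. e \<in> with_inverse a \<Longrightarrow> long_letter C e \<and> wide_corner C e e"
  shows "admissible C (pow_word a m)"
  using assms[of a] assms[of "inv a"] by (simp add: pow_word_def with_inverse_def admissible_replicate)

lemma admissible_Cons_iff: "admissible C (e # w) \<longleftrightarrow>
    long_letter C e \<and> admissible C w \<and> (w = [] \<or> wide_corner C e (hd w))"
  by (auto simp: admissible_def successively_Cons)

text \<open>
  This is admissibility of \<open>a\<^sup>m v b\<^sup>n\<close>, for all signs of the exponents. The minimal element of \<open>\<langle>a\<rangle> v \<langle>b\<rangle>\<close> can lie on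
  either side, so the corners at \<open>v\<close> must be wide for \<open>a\<close>, \<open>b\<close> and their inverses alike.
\<close>

lemma two_sided_displacement:
  assumes a: "\<And>e. e \<in> with_inverse a \<Longrightarrow> long_letter C e \<and> wide_corner C e e \<and> wide_corner C e v"
    and b: "\<And>e. e \<in> with_inverse b \<Longrightarrow> long_letter C e \<and> wide_corner C e e \<and> wide_corner C v e"
    and v: "long_letter C v" and C: "0 \<le> C"
  shows "real_of_int (\<bar>m\<bar> + \<bar>n\<bar>) + 1 \<le> d x\<^sub>0 (\<phi> (a [^] m \<otimes> v \<otimes> b [^] n) x\<^sub>0)"
proof -
  have ac: "a \<in> carrier G" and bc: "b \<in> carrier G" and vc: "v \<in> carrier G"
    using a[of a] b[of b] v by (auto simp: with_inverse_def long_letter_def)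
  let ?w = "pow_word a m @ [v] @ pow_word b n"
  have adm: "admissible C ?w"
    using pow_word_admissible[of a C m] pow_word_admissible[of b C n] a b v
      pow_word_letters[OF last_in_set, of a m] pow_word_letters[OF hd_in_set, of b n]
    by (auto simp: admissible_append_iff admissible_Cons_iff)
  have cl: "set (pow_word a m) \<subseteq> carrier G" "set (pow_word b n) \<subseteq> carrier G"
    using ac bc by (auto simp: pow_word_def split: if_splits)
  have val: "word_value G ?w = a [^] m \<otimes> v \<otimes> b [^] n"
    using cl ac bc vc by (simp add: word_value_append pow_word_value m_assoc)
  have len: "real (length ?w) = real_of_int (\<bar>m\<bar> + \<bar>n\<bar>) + 1"
    unfolding length_append list.size pow_word_length by simp
  show ?thesis using admissible_length[OF adm C] unfolding val len .
qed

end

section \<open>Quasi-geodesics through a prescribed element\<close>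

context finitely_generated_group
begin

lemma norm_le_mult_right:
  assumes "g \<in> carrier G" "h \<in> carrier G" shows "word_norm g \<le> word_norm (g \<otimes> h) + word_norm h"
  using norm_mult[of "g \<otimes> h" "inv h"] assms by (simp add: m_assoc)

lemma \<rho>_one: "x \<in> carrier G \<Longrightarrow> \<rho> \<one> x = word_norm x"
  using word_dist_mult_right[of \<one> x] by simp

text \<open>
  A concatenation of three paths, each translated to the point where the previous one ends.
\<close>

definition bridge_path :: "'a \<Rightarrow> nat \<Rightarrow> (nat \<Rightarrow> 'a) \<Rightarrow> nat \<Rightarrow> 'a \<Rightarrow> nat \<Rightarrow> 'a"
  where "bridge_path a P \<gamma> n b t =
    (if t \<le> P then a [^] t
     else if t \<le> P + n then a [^] P \<otimes> \<gamma> (t - P)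
     else a [^] P \<otimes> (\<gamma> n \<otimes> b [^] (t - P - n)))"

text \<open>
  Hypothesis \<open>nearest\<close> says that \<open>\<gamma>\<close> joins nearest points of its two sides. If \<open>r\<close> is the part of \<open>\<gamma>\<close> between a point
  of \<open>\<gamma>\<close> and one of the sides, then every point of that side is at distance at least \<open>r\<close>, and the triangle inequality
  bounds the part of the path on the side as well. Between the two sides the distance is at least \<open>n\<close>, and by \<open>far\<close> it
  is comparable to the time spent on the sides unless this time is itself comparable to \<open>n\<close>.
\<close>

lemma bridge_path_lower_bound:
  assumes a: "a \<in> carrier G" "\<And>k::nat. real k \<le> K * word_norm (a [^] k)"
    and b: "b \<in> carrier G" "\<And>k::nat. real k \<le> K * word_norm (b [^] k)"
    and \<gamma>: "\<And>r. \<gamma> r \<in> carrier G" "\<gamma> 0 = \<one>"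
      "\<And>r r'. r \<le> r' \<Longrightarrow> r' \<le> n \<Longrightarrow> \<rho> (\<gamma> r) (\<gamma> r') = real (r' - r)"
    and nearest: "\<And>(p::nat) (q::nat). real n \<le> word_norm (a [^] p \<otimes> \<gamma> n \<otimes> b [^] q)"
    and far: "\<And>(p::nat) (q::nat). real (p + q) \<le> K * (word_norm (a [^] p \<otimes> \<gamma> n \<otimes> b [^] q) + real n)"
    and K: "1 \<le> K" and st: "s \<le> t"
  shows "real (t - s) \<le> (2 * K + 1) * \<rho> (bridge_path a P \<gamma> n b s) (bridge_path a P \<gamma> n b t)"
proof -
  have nonneg: "r \<le> (2 * K + 1) * N" if "r \<le> K * N" "0 \<le> N" for r N :: real
    using that K by (smt (verit, best) mult_right_mono)
  have apow: "a [^] P = a [^] s \<otimes> a [^] (P - s)" if "s \<le> P"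
    using that a(1) by (simp add: nat_pow_mult)
  consider "t \<le> P" | "s \<le> P" "P < t" "t \<le> P + n" | "s \<le> P" "P + n < t"
    | "P < s" "t \<le> P + n" | "P < s" "s \<le> P + n" "P + n < t" | "P + n < s"
    using st by linarith
  then show ?thesis
  proof cases
    case 1
    then have "a [^] t = a [^] s \<otimes> a [^] (t - s)" using st a(1) by (simp add: nat_pow_mult)
    then have "\<rho> (bridge_path a P \<gamma> n b s) (bridge_path a P \<gamma> n b t) = word_norm (a [^] (t - s))"
      using 1 st a(1) by (simp add: bridge_path_def word_dist_mult_right)
    then show ?thesis using a(2)[of "t - s"] nonneg by simp
  next
    case 2
    define x where "x = P - s"
    define r where "r = t - P"
    have r: "r \<le> n" "t - s = x + r" using 2 by (auto simp: x_def r_def)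
    let ?N = "word_norm (a [^] x \<otimes> \<gamma> r)"
    have eq: "\<rho> (bridge_path a P \<gamma> n b s) (bridge_path a P \<gamma> n b t) = ?N"
      using 2 a(1) \<gamma>(1) apow by (simp add: bridge_path_def m_assoc word_dist_mult_right x_def r_def)
    have "real n \<le> word_norm (a [^] x \<otimes> \<gamma> n)" using nearest[of x 0] a(1) \<gamma>(1) by simp
    also have "\<dots> = \<rho> \<one> (a [^] x \<otimes> \<gamma> n)" using a(1) \<gamma>(1) by (simp add: \<rho>_one)
    also have "\<dots> \<le> \<rho> \<one> (a [^] x \<otimes> \<gamma> r) + \<rho> (a [^] x \<otimes> \<gamma> r) (a [^] x \<otimes> \<gamma> n)"
      using a(1) \<gamma>(1) by (intro \<rho>_triangle) auto
    also have "\<dots> = ?N + real (n - r)"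
      using a(1) \<gamma>(1) \<gamma>(3)[of r n] r by (simp add: word_dist_left_mult \<rho>_one)
    finally have 1: "real r \<le> ?N" using r by simp
    have "word_norm (\<gamma> r) = real r" using \<gamma>(3)[of 0 r] \<gamma>(1,2) r by (simp add: \<rho>_one)
    then have "word_norm (a [^] x) \<le> 2 * ?N"
      using norm_le_mult_right[of "a [^] x" "\<gamma> r"] a(1) \<gamma>(1) 1 by simp
    then have "K * word_norm (a [^] x) \<le> K * (2 * ?N)" using K by (intro mult_left_mono) auto
    then show ?thesis unfolding eq r(2) using a(2)[of x] 1 by (simp add: algebra_simps)
  next
    case 3
    define x where "x = P - s"
    define q where "q = t - P - n"
    have ts: "t - s = x + n + q" using 3 by (auto simp: x_def q_def)
    let ?N = "word_norm (a [^] x \<otimes> \<gamma> n \<otimes> b [^] q)"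
    have eq: "\<rho> (bridge_path a P \<gamma> n b s) (bridge_path a P \<gamma> n b t) = ?N"
      using 3 a(1) b(1) \<gamma>(1) apow by (simp add: bridge_path_def m_assoc word_dist_mult_right x_def q_def)
    have "real (x + q) \<le> K * (?N + real n)" by (rule far)
    also have "\<dots> \<le> K * (2 * ?N)" using nearest[of x q] K by (intro mult_left_mono) auto
    finally show ?thesis unfolding eq ts using nearest[of x q] by (simp add: algebra_simps)
  next
    case 4
    then have "\<rho> (bridge_path a P \<gamma> n b s) (bridge_path a P \<gamma> n b t) = real (t - s)"
      using st a(1) \<gamma>(1) \<gamma>(3)[of "s - P" "t - P"] by (simp add: bridge_path_def word_dist_left_mult)
    moreover have "real (t - s) \<le> (2 * K + 1) * real (t - s)"
      using K by (simp add: mult_le_cancel_right1)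
    ultimately show ?thesis by simp
  next
    case 5
    define r where "r = s - P"
    define q where "q = t - P - n"
    have ts: "t - s = (n - r) + q" "r \<le> n" using 5 by (auto simp: r_def q_def)
    let ?N = "\<rho> (\<gamma> r) (\<gamma> n \<otimes> b [^] q)"
    have eq: "\<rho> (bridge_path a P \<gamma> n b s) (bridge_path a P \<gamma> n b t) = ?N"
      using 5 a(1) b(1) \<gamma>(1) by (simp add: bridge_path_def word_dist_left_mult r_def q_def)
    have "real n \<le> word_norm (\<gamma> n \<otimes> b [^] q)" using nearest[of 0 q] b(1) \<gamma>(1) by simp
    also have "\<dots> = \<rho> \<one> (\<gamma> n \<otimes> b [^] q)" using b(1) \<gamma>(1) by (simp add: \<rho>_one)
    also have "\<dots> \<le> \<rho> \<one> (\<gamma> r) + ?N" using b(1) \<gamma>(1) by (intro \<rho>_triangle) auto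
    also have "\<rho> \<one> (\<gamma> r) = real r" using \<gamma>(3)[of 0 r] \<gamma>(2) ts by simp
    finally have 1: "real (n - r) \<le> ?N" using ts by simp
    have "word_norm (b [^] q) = \<rho> (\<gamma> n) (\<gamma> n \<otimes> b [^] q)" using b(1) \<gamma>(1) by (simp add: word_dist_mult_right)
    also have "\<dots> \<le> \<rho> (\<gamma> n) (\<gamma> r) + ?N" using b(1) \<gamma>(1) by (intro \<rho>_triangle) auto
    also have "\<rho> (\<gamma> n) (\<gamma> r) = real (n - r)" using \<gamma>(3)[of r n] ts \<rho>_commute \<gamma>(1) by simp
    finally have "word_norm (b [^] q) \<le> 2 * ?N" using 1 by simp
    then have "K * word_norm (b [^] q) \<le> K * (2 * ?N)" using K by (intro mult_left_mono) auto
    then show ?thesis unfolding eq ts(1) using b(2)[of q] 1 by (simp add: algebra_simps)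
  next
    case 6
    have "b [^] (t - P - n) = b [^] (s - P - n) \<otimes> b [^] (t - s)"
      using 6 st b(1) by (simp add: nat_pow_mult)
    then have "\<rho> (bridge_path a P \<gamma> n b s) (bridge_path a P \<gamma> n b t) = word_norm (b [^] (t - s))"
      using 6 st a(1) b(1) \<gamma>(1) by (simp add: bridge_path_def word_dist_left_mult m_assoc[symmetric] word_dist_mult_right)
    then show ?thesis using b(2)[of "t - s"] nonneg by simp
  qed
qed

lemma word_value_norm_le:
  assumes "set w \<subseteq> carrier G" "\<And>e. e \<in> set w \<Longrightarrow> word_norm e \<le> \<Lambda>"
  shows "word_norm (word_value G w) \<le> \<Lambda> * real (length w)"
  using assms
proof (induction w)
  case (Cons e w)
  have "word_norm (e \<otimes> word_value G w) \<le> word_norm e + word_norm (word_value G w)"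
    using Cons.prems by (intro norm_mult) auto
  also have "\<dots> \<le> \<Lambda> + \<Lambda> * real (length w)"
    using Cons by (intro add_mono) auto
  finally show ?case by (simp add: algebra_simps)
qed simp

text \<open>
  The word \<open>V\<close> spells the single letter \<open>v\<close> of the skeleton \<open>A @ [v] @ Z\<close>. On a window of length at most
  \<open>length A\<close>, the path either sees only one \<open>V\<close> with its two neighbours, where \<open>window\<close> applies, or it runs along
  the skeleton. A longer window covers at least as many letters of the skeleton as half its length, up to a multiple
  of \<open>length V\<close>, and moving its two end points to the skeleton costs \<open>2 * \<Lambda> * length V\<close>. Both errors are absorbed because
  \<open>length A\<close> is a large multiple of \<open>length V\<close>.
\<close>

lemma cyclic_path_lower_bound:
  fixes A V Z :: "'a list" and v :: 'a and K \<Lambda> :: real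
  assumes cl: "set A \<subseteq> carrier G" "set V \<subseteq> carrier G" "set Z \<subseteq> carrier G"
    and v: "word_value G V = v" "V \<noteq> []" and V: "\<And>e. e \<in> set V \<Longrightarrow> word_norm e \<le> \<Lambda>"
    and lenZ: "length A \<le> length Z"
    and lenA: "(16 + 8 * K * \<Lambda>) * real (length V) \<le> real (length A)"
    and K: "1 \<le> K" "1 \<le> \<Lambda>"
    and skeleton: "\<And>s t. s \<le> t \<Longrightarrow>
      real (t - s) \<le> K * \<rho> (cyclic_path G (A @ [v] @ Z) s) (cyclic_path G (A @ [v] @ Z) t)"
    and window: "\<And>s t. s \<le> t \<Longrightarrow> t \<le> 2 * length A + length V \<Longrightarrow>
      real (t - s) \<le> 4 * K * \<rho> (word_value G (take s (A @ V @ Z))) (word_value G (take t (A @ V @ Z)))"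
    and st: "s \<le> t"
  shows "real (t - s) \<le> 4 * K * \<rho> (cyclic_path G (A @ V @ Z) s) (cyclic_path G (A @ V @ Z) t)"
proof -
  let ?U = "A @ V @ Z" and ?T = "A @ [v] @ Z"
  define N where "N = length A"
  define e where "e = length V"
  define M where "M = length ?U"
  define L where "L = length ?T"
  have e1: "1 \<le> e" using v(2) by (cases V) (auto simp: e_def)
  have lens: "M + 1 = L + e" "2 * N + e \<le> M" using lenZ by (auto simp: M_def L_def e_def N_def)
  have KL: "0 \<le> 8 * K * \<Lambda> * real e" using K by simp
  have N16: "16 * real e + 8 * K * \<Lambda> * real e \<le> real N" using lenA by (simp add: N_def e_def algebra_simps)
  then have N16': "16 * e \<le> N" using KL by linarith
  have vc: "v \<in> carrier G" using v(1) cl(2) by auto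
  have Uc: "set ?U \<subseteq> carrier G" "?U \<noteq> []" and Tc: "set ?T \<subseteq> carrier G" "?T \<noteq> []"
    using cl v(2) vc by auto
  have val: "word_value G ?U = word_value G ?T"
    using cl v(1) vc by (simp add: word_value_append)
  (* Time on the skeleton: the spelling V of the letter v takes a single unit, at its end. *)
  define \<sigma> where "\<sigma> r = (if r \<le> N then r else if r < N + e then N else r - e + 1)" for r
  have \<sigma>: "\<sigma> r \<le> r" "r \<le> \<sigma> r + e" for r using e1 by (auto simp: \<sigma>_def)
  have \<sigma>L: "\<sigma> r \<le> L" if "r \<le> M" for r
    using that lens e1 by (auto simp: \<sigma>_def)
  have prefix: "set (take r W) \<subseteq> carrier G" if "set W \<subseteq> carrier G" for r W
    using that by (auto dest: in_set_takeD)
  have exact: "word_value G (take r ?U) = word_value G (take (\<sigma> r) ?T)" if "r \<le> N \<or> N + e \<le> r" for r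
  proof (cases "r \<le> N")
    case True
    then show ?thesis by (simp add: \<sigma>_def N_def)
  next
    case False
    then have r: "N + e \<le> r" using that by simp
    have "take r ?U = A @ V @ take (r - N - e) Z" using r by (simp add: N_def e_def)
    moreover have "take (\<sigma> r) ?T = A @ [v] @ take (r - N - e) Z"
      using r e1 by (simp add: \<sigma>_def N_def Suc_diff_le add.commute)
    ultimately show ?thesis using cl v(1) vc prefix[OF cl(3)] by (simp add: word_value_append)
  qed
  have approx: "\<rho> (word_value G (take r ?U)) (word_value G (take (\<sigma> r) ?T)) \<le> \<Lambda> * real e" for r
  proof (cases "r \<le> N \<or> N + e \<le> r")
    case True
    then show ?thesis using exact[OF True] prefix[OF Tc(1)] K by simp
  next
    case False
    then have "take r ?U = A @ take (r - N) V" "take (\<sigma> r) ?T = A"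
      by (auto simp: \<sigma>_def N_def e_def)
    then have "\<rho> (word_value G (take r ?U)) (word_value G (take (\<sigma> r) ?T)) = word_norm (word_value G (take (r - N) V))"
      using cl(1) prefix[OF cl(2)] by (simp add: word_value_append \<rho>_commute word_dist_mult_right)
    also have "\<dots> \<le> \<Lambda> * real (length (take (r - N) V))"
      using prefix[OF cl(2)] V by (intro word_value_norm_le) (auto dest: in_set_takeD)
    also have "\<dots> \<le> \<Lambda> * real e" using K by (intro mult_left_mono) (auto simp: e_def)
    finally show ?thesis .
  qed
  have U_at: "cyclic_path G ?U (q * M + r) = word_value G ?U [^] q \<otimes> word_value G (take r ?U)" if "r \<le> M" for q r
    unfolding M_def using that by (intro cyclic_path_add[OF Uc]) (simp add: M_def)
  have T_at: "cyclic_path G ?T (q * L + \<sigma> r) = word_value G ?U [^] q \<otimes> word_value G (take (\<sigma> r) ?T)" if "r \<le> M" for q r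
    unfolding val unfolding L_def using \<sigma>L[OF that] by (intro cyclic_path_add[OF Tc]) (simp add: L_def)
  have exact': "cyclic_path G ?U (q * M + r) = cyclic_path G ?T (q * L + \<sigma> r)" if "r \<le> M" "r \<le> N \<or> N + e \<le> r" for q r
    unfolding U_at[OF that(1)] T_at[OF that(1)] exact[OF that(2)] ..
  have approx': "\<rho> (cyclic_path G ?U (q * M + r)) (cyclic_path G ?T (q * L + \<sigma> r)) \<le> \<Lambda> * real e" if "r \<le> M" for q r
    unfolding U_at[OF that] T_at[OF that] using approx[of r] Uc prefix[OF Uc(1)] prefix[OF Tc(1)]
    by (subst word_dist_left_mult) auto
  have Ucl: "cyclic_path G ?U r \<in> carrier G" and Tcl: "cyclic_path G ?T r \<in> carrier G" for r
    using cyclic_path_closed[OF Uc(1)] cyclic_path_closed[OF Tc(1)] by auto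
  define q1 r1 where "q1 = s div M" and "r1 = s mod M"
  have M0: "0 < M" using lens e1 by linarith
  have s: "s = q1 * M + r1" "r1 \<le> M" "r1 < M" using M0 by (auto simp: q1_def r1_def less_imp_le)
  show ?thesis
  proof (cases "t - s \<le> N")
    case short: True
    define r2 where "r2 = r1 + (t - s)"
    have t: "t = q1 * M + r2" using st s by (simp add: r2_def)
    have ts: "t - s = r2 - r1" "r1 \<le> r2" by (simp_all add: r2_def)
    show ?thesis
    proof (cases "r2 \<le> 2 * N + e")
      case True
      then have r2: "r2 \<le> M" using lens by simp
      have "\<rho> (cyclic_path G ?U s) (cyclic_path G ?U t) = \<rho> (word_value G (take r1 ?U)) (word_value G (take r2 ?U))"
        unfolding s(1) t U_at[OF s(2)] U_at[OF r2] using Uc prefix[OF Uc(1)] by (subst word_dist_left_mult) auto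
      then show ?thesis using window[of r1 r2] ts True by (simp add: N_def e_def)
    next
      case False
      then have r1: "N + e < r1" using short ts r2_def by linarith
      have "\<exists>k. cyclic_path G ?U t = cyclic_path G ?T k \<and> k = q1 * L + (r2 - e + 1)"
      proof (cases "r2 \<le> M")
        case True
        have "\<sigma> r2 = r2 - e + 1" using False by (auto simp: \<sigma>_def)
        then show ?thesis using exact'[OF True, of q1] False t by simp
      next
        case r2: False
        define r3 where "r3 = r2 - M"
        have r3: "r2 = M + r3" "r3 \<le> N" "r3 \<le> M"
          using r2 s(3) short ts lens unfolding r3_def r2_def by auto
        have "t = Suc q1 * M + r3" using t r3 by simp
        then have "cyclic_path G ?U t = cyclic_path G ?T (Suc q1 * L + \<sigma> r3)"
          using exact'[OF r3(3), of "Suc q1"] r3 by simp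
        moreover have "Suc q1 * L + \<sigma> r3 = q1 * L + (r2 - e + 1)"
          using r3 lens e1 by (simp add: \<sigma>_def)
        ultimately show ?thesis by metis
      qed
      moreover have "\<sigma> r1 = r1 - e + 1" using r1 by (auto simp: \<sigma>_def)
      then have "cyclic_path G ?U s = cyclic_path G ?T (q1 * L + (r1 - e + 1))"
        using exact'[OF s(2), of q1] r1 s(1) by simp
      ultimately have "real (t - s) \<le> K * \<rho> (cyclic_path G ?U s) (cyclic_path G ?U t)"
        using skeleton[of "q1 * L + (r1 - e + 1)" "q1 * L + (r2 - e + 1)"] ts r1 by auto
      also have "\<dots> \<le> 4 * K * \<rho> (cyclic_path G ?U s) (cyclic_path G ?U t)"
        using K by (intro mult_right_mono) auto
      finally show ?thesis .
    qed
  next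
    case long: False
    define q2 r2 where "q2 = t div M" and "r2 = t mod M"
    have t: "t = q2 * M + r2" "r2 \<le> M" using M0 by (auto simp: q2_def r2_def less_imp_le)
    let ?s = "q1 * L + \<sigma> r1" and ?t = "q2 * L + \<sigma> r2"
    have qq: "q1 \<le> q2" unfolding q1_def q2_def using st by (rule div_le_mono)
    define D where "D = q2 - q1"
    have q2: "q2 = q1 + D" using qq by (simp add: D_def)
    define \<Delta> where "\<Delta> = real ?t - real ?s"
    have e1': "1 \<le> real e" using e1 by simp
    (* Each full period has length L + e - 1 on the path and L on the skeleton, and e <= L; the two partial
       periods at the ends contribute the additive error. *)
    have F: "real t - real s \<le> 2 * \<Delta> + 4 * real e + 4"
    proof -
      have M': "real M = real L + real e - 1" using lens(1) by linarith
      have ts: "real t - real s = real D * real M + real r2 - real r1"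
        unfolding t(1) s(1) q2 by (simp add: algebra_simps)
      have tT: "\<Delta> = real D * real L + real (\<sigma> r2) - real (\<sigma> r1)"
        unfolding \<Delta>_def q2 by (simp add: algebra_simps)
      have sg: "real r2 \<le> real (\<sigma> r2) + real e" "real (\<sigma> r1) \<le> real r1"
        using \<sigma>(2)[of r2] \<sigma>(1)[of r1] by linarith+
      show ?thesis
      proof (cases "D = 0")
        case True
        then have "real r1 \<le> real r2" using ts st by simp
        then show ?thesis unfolding ts tT using True sg by simp
      next
        case False
        have "1 * (real L - real e + 1) \<le> real D * (real L - real e + 1)"
          using False N16' lens by (intro mult_right_mono) auto
        then have 1: "real L - real e + 1 \<le> real D * real L - real D * real e + real D"
          by (simp add: algebra_simps)
        have 2: "real D * real M = real D * real L + real D * real e - real D"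
          unfolding M' by (simp add: algebra_simps)
        have "real r1 \<le> real M" using s(2) by simp
        have arith: "DM + b - a \<le> 2 * (DL + b' - a') + 4 * ee + 4"
          if "a \<le> m" "0 \<le> b" "b \<le> b' + ee" "a' \<le> a" "m = l + ee - 1" "l - ee + 1 \<le> DL - De + D'" "DM = DL + De - D'"
          for DM DL De D' a b a' b' ee m l :: real
          using that by simp
        show ?thesis unfolding ts tT
          by (rule arith[OF \<open>real r1 \<le> real M\<close> _ sg M' 1 2]) simp
      qed
    qed
    have big: "real N < real t - real s" using long st by linarith
    have pos: "?s \<le> ?t"
    proof -
      have "0 < \<Delta>" using F big N16 KL e1' by linarith
      then have "real ?s < real ?t" unfolding \<Delta>_def by (simp only: diff_gt_0_iff_gt)
      then have "?s < ?t" by (simp only: of_nat_less_iff)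
      then show ?thesis by (rule less_imp_le)
    qed
    have diff: "real (?t - ?s) = \<Delta>" unfolding \<Delta>_def using pos by (simp only: of_nat_diff)
    have "\<rho> (cyclic_path G ?T ?s) (cyclic_path G ?T ?t) \<le> \<rho> (cyclic_path G ?T ?s) (cyclic_path G ?U s)
        + \<rho> (cyclic_path G ?U s) (cyclic_path G ?U t) + \<rho> (cyclic_path G ?U t) (cyclic_path G ?T ?t)"
      using \<rho>_triangle[OF Tcl[of ?s] Ucl[of s] Tcl[of ?t]] \<rho>_triangle[OF Ucl[of s] Ucl[of t] Tcl[of ?t]] by linarith
    also have "\<dots> \<le> \<rho> (cyclic_path G ?U s) (cyclic_path G ?U t) + 2 * \<Lambda> * real e"
      using approx'[OF s(2), of q1] approx'[OF t(2), of q2] \<rho>_commute[OF Tcl[of ?s] Ucl[of s]] s(1) t(1) by simp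
    finally have "K * \<rho> (cyclic_path G ?T ?s) (cyclic_path G ?T ?t) \<le>
        K * (\<rho> (cyclic_path G ?U s) (cyclic_path G ?U t) + 2 * \<Lambda> * real e)"
      using K by (intro mult_left_mono) auto
    then have "\<Delta> \<le> K * \<rho> (cyclic_path G ?U s) (cyclic_path G ?U t) + 2 * K * \<Lambda> * real e"
      using skeleton[OF pos] diff by (simp add: algebra_simps)
    moreover have "2 * K * \<Lambda> * real e * 4 = 8 * K * \<Lambda> * real e" by simp
    ultimately have "real t - real s \<le> 4 * (K * \<rho> (cyclic_path G ?U s) (cyclic_path G ?U t))"
      using F big N16 e1' by linarith
    then show ?thesis using st by (simp add: mult.assoc)
  qed
qed

end

context acting_group
begin

lemma admissible_concat_replicate:
  assumes "admissible C w" "w \<noteq> []" "wide_corner C (last w) (hd w)"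
  shows "admissible C (concat (replicate n w))"
proof (induction n)
  case (Suc n)
  have "concat (replicate n w) = [] \<or> hd (concat (replicate n w)) = hd w"
    using assms(2) by (cases n) auto
  then show ?case using Suc assms by (auto simp: admissible_append_iff)
qed (simp add: admissible_def)

lemma admissible_drop_take: "admissible C w \<Longrightarrow> admissible C (drop i (take j w))"
  by (metis admissible_append_iff append_take_drop_id)

lemma cyclic_admissible_lower_bound:
  assumes K: "\<And>g. g \<in> carrier G \<Longrightarrow> d x\<^sub>0 (\<phi> g x\<^sub>0) \<le> K * word_norm g"
    and w: "admissible C w" "w \<noteq> []" "wide_corner C (last w) (hd w)" "0 \<le> C" and st: "s \<le> t"
  shows "real (t - s) \<le> K * \<rho> (cyclic_path G w s) (cyclic_path G w t)"
proof -
  let ?W = "concat (replicate (Suc t) w)"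
  have wc: "set w \<subseteq> carrier G" using admissible_closed[OF w(1)] .
  have len: "t < Suc t * length w" using w(2) by (cases "length w") auto
  have Wc: "set ?W \<subseteq> carrier G" using wc by auto
  have "cyclic_path G w r = word_value G (take r ?W)" if "r \<le> t" for r
    using cyclic_path_take[OF wc w(2), of r "Suc t"] len that by simp
  then have eq: "cyclic_path G w s = word_value G (take s ?W)" "cyclic_path G w t = word_value G (take t ?W)"
    using st by blast+
  let ?m = "drop s (take t ?W)"
  have mc: "set ?m \<subseteq> carrier G" "set (take s ?W) \<subseteq> carrier G"
    using Wc by (meson order_trans set_take_subset set_drop_subset)+
  have "\<rho> (cyclic_path G w s) (cyclic_path G w t) = word_norm (word_value G ?m)"
    unfolding eq word_value_take_split[OF Wc st] using mc by (intro word_dist_mult_right) auto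
  moreover have "real (length ?m) \<le> d x\<^sub>0 (\<phi> (word_value G ?m) x\<^sub>0)"
    by (intro admissible_length[OF _ w(4)] admissible_drop_take admissible_concat_replicate w)
  moreover have "length ?m = t - s"
    using len by (simp add: length_concat sum_list_replicate)
  moreover have "d x\<^sub>0 (\<phi> (word_value G ?m) x\<^sub>0) \<le> K * word_norm (word_value G ?m)"
    using mc by (intro K) auto
  ultimately show ?thesis by simp
qed

lemma with_inverse_inv: "e \<in> with_inverse y \<Longrightarrow> y \<in> carrier G \<Longrightarrow> inv e \<in> with_inverse y"
  by (auto simp: with_inverse_def)

lemma with_inverse_closed: "e \<in> with_inverse y \<Longrightarrow> y \<in> carrier G \<Longrightarrow> e \<in> carrier G"
  by (auto simp: with_inverse_def)

lemma sign_choice: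
  fixes m :: int
  assumes a: "a \<in> carrier G"
  obtains e s i where "e \<in> with_inverse a" "s = 1 \<or> s = -1" "\<bar>m\<bar> = int i" "\<And>k::nat. e [^] k = a [^] (s * int k)"
    "s * int i = - m"
proof (cases "m \<le> 0")
  case True
  show ?thesis
    by (rule that[of a 1 "nat (- m)"]) (use True in \<open>auto simp: with_inverse_def int_pow_int\<close>)
next
  case False
  have "inv a [^] k = a [^] (- 1 * int k)" for k :: nat
    using a by (simp add: int_pow_neg_int nat_pow_inv)
  then show ?thesis
    by (intro that[of "inv a" "-1" "nat m"]) (use False in \<open>auto simp: with_inverse_def\<close>)
qed

text \<open>
  The letters \<open>a\<close> and \<open>b\<close> come from the clause of the Schottky pair about points, applied to \<open>\<phi> v x\<^sub>0\<close> and
  \<open>\<phi> (inv v) x\<^sub>0\<close>, and their signs from the exponents of a shortest element \<open>v' = a0\<^sup>m\<^sup>0 v b0\<^sup>n\<^sup>0\<close>. Applied to \<open>v'\<close> itself,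
  the displacement bound gives \<open>i + j \<le> K * length u\<close>: this is why the detour along \<open>a\<^sup>i\<close> and \<open>b\<^sup>j\<close> is short
  compared with \<open>v'\<close>, and why the final constant \<open>4 * K\<close> does not depend on \<open>v\<close>.
\<close>

lemma bridge_exists:
  assumes K: "1 \<le> K" "\<And>g. g \<in> carrier G \<Longrightarrow> d x\<^sub>0 (\<phi> g x\<^sub>0) \<le> K * word_norm g"
    and sp: "schottky_pair C y z"
    and \<Lambda>: "1 \<le> \<Lambda>" "word_norm y \<le> \<Lambda>" "word_norm z \<le> \<Lambda>"
    and v: "long_letter C v"
  obtains U N e where "set U \<subseteq> carrier G" "U \<noteq> []" "\<And>l. l \<in> set U \<Longrightarrow> word_norm l \<le> \<Lambda>"
    "loxodromic G X d \<phi> (word_value G U)"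
    "\<And>s t. s \<le> t \<Longrightarrow> real (t - s) \<le> 4 * K * \<rho> (cyclic_path G U s) (cyclic_path G U t)"
    "N + e \<le> length U" "word_value G (take (N + e) U) = word_value G (take N U) \<otimes> v"
proof -
  have C: "0 \<le> C" using sp by (simp add: schottky_pair_def)
  have vc: "v \<in> carrier G" using v by (simp add: long_letter_def)
  have self: "long_letter C e \<and> wide_corner C e e" if "e \<in> with_inverse y \<union> with_inverse z" for e
    using sp that by (simp add: schottky_pair_def)
  have cross: "wide_corner C e f \<and> wide_corner C f e" if "e \<in> with_inverse y" "f \<in> with_inverse z" for e f
    using sp that by (simp add: schottky_pair_def)
  have good: "\<exists>a\<in>{y, z}. \<forall>e\<in>with_inverse a. gp x\<^sub>0 (\<phi> e x\<^sub>0) p \<le> C" if "p \<in> X" for p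
    using sp that by (auto simp: schottky_pair_def)
  have yz: "y \<in> carrier G" "z \<in> carrier G"
    using self[of y] self[of z] by (auto simp: with_inverse_def long_letter_def)
  obtain a0 where a0: "a0 \<in> {y, z}" "\<And>e. e \<in> with_inverse a0 \<Longrightarrow> gp x\<^sub>0 (\<phi> e x\<^sub>0) (\<phi> v x\<^sub>0) \<le> C"
    using good[of "\<phi> v x\<^sub>0"] vc base by auto
  obtain b0 where b0: "b0 \<in> {y, z}" "\<And>e. e \<in> with_inverse b0 \<Longrightarrow> gp x\<^sub>0 (\<phi> e x\<^sub>0) (\<phi> (inv v) x\<^sub>0) \<le> C"
    using good[of "\<phi> (inv v) x\<^sub>0"] vc base by auto
  have ab0: "a0 \<in> carrier G" "b0 \<in> carrier G" using a0(1) b0(1) yz by auto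
  have fam_a: "long_letter C e \<and> wide_corner C e e \<and> wide_corner C e v" if "e \<in> with_inverse a0" for e
    using self[of e] a0(1) a0(2)[OF with_inverse_inv[OF that ab0(1)]] that by (auto simp: wide_corner_def)
  have fam_b: "long_letter C e \<and> wide_corner C e e \<and> wide_corner C v e" if "e \<in> with_inverse b0" for e
    using self[of e] b0(1) b0(2)[OF that] that by (auto simp: wide_corner_def gp_commute)
  have disp: "real_of_int (\<bar>m\<bar> + \<bar>n\<bar>) + 1 \<le> K * word_norm (a0 [^] m \<otimes> v \<otimes> b0 [^] n)" for m n :: int
    by (rule order_trans[OF two_sided_displacement[OF fam_a fam_b v C]]) (use ab0 vc in \<open>auto intro!: K(2)\<close>)
  have "\<exists>(m0::int) (n0::int). \<forall>(m::int) (n::int). word_length G S (a0 [^] m0 \<otimes> v \<otimes> b0 [^] n0)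
      \<le> word_length G S (a0 [^] m \<otimes> v \<otimes> b0 [^] n)"
    using ex_has_least_nat[of "\<lambda>_. True" undefined
      "\<lambda>mn. word_length G S (a0 [^] (fst mn :: int) \<otimes> v \<otimes> b0 [^] (snd mn :: int))"]
    by auto
  then obtain m0 n0 :: int where mn: "\<And>(m::int) (n::int). word_length G S (a0 [^] m0 \<otimes> v \<otimes> b0 [^] n0)
      \<le> word_length G S (a0 [^] m \<otimes> v \<otimes> b0 [^] n)" by blast
  define v' where "v' = a0 [^] m0 \<otimes> v \<otimes> b0 [^] n0"
  have v'c: "v' \<in> carrier G" using ab0 vc by (simp add: v'_def)
  have minimal: "word_norm v' \<le> word_norm (a0 [^] m \<otimes> v \<otimes> b0 [^] n)" for m n :: int
    using mn[of m n] by (simp add: v'_def)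
  obtain a sa i where a: "a \<in> with_inverse a0" "sa = 1 \<or> sa = -1" "\<bar>m0\<bar> = int i"
    "\<And>k::nat. a [^] k = a0 [^] (sa * int k)" "sa * int i = - m0"
    using sign_choice[OF ab0(1), of m0] by metis
  obtain b sb j where b: "b \<in> with_inverse b0" "sb = 1 \<or> sb = -1" "\<bar>n0\<bar> = int j"
    "\<And>k::nat. b [^] k = b0 [^] (sb * int k)" "sb * int j = - n0"
    using sign_choice[OF ab0(2), of n0] by metis
  have ac: "a \<in> carrier G" and bc: "b \<in> carrier G"
    using with_inverse_closed a(1) b(1) ab0 by auto
  have shift: "a [^] p \<otimes> v' \<otimes> b [^] q = a0 [^] (sa * int p + m0) \<otimes> v \<otimes> b0 [^] (n0 + sb * int q)" for p q :: nat
    unfolding a(4) b(4) v'_def using ab0 vc by (simp add: int_pow_mult m_assoc)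
  have v_eq: "a [^] i \<otimes> v' \<otimes> b [^] j = v" unfolding shift a(5) b(5) using vc by simp
  obtain u where u: "length u = word_length G S v'" "set u \<subseteq> S \<union> m_inv G ` S" "word_value G u = v'"
    using word_length_witness[OF gens_closed, of v'] v'c generate_gens by auto
  have uc: "set u \<subseteq> carrier G" using u(2) word_letters_closed[OF gens_closed] by blast
  define \<gamma> where "\<gamma> r = word_value G (take r u)" for r
  have utc: "set (take r u) \<subseteq> carrier G" for r using uc by (auto dest: in_set_takeD)
  have \<gamma>: "\<And>r. \<gamma> r \<in> carrier G" "\<gamma> 0 = \<one>" "\<gamma> (length u) = v'"
    "\<And>r r'. r \<le> r' \<Longrightarrow> r' \<le> length u \<Longrightarrow> \<rho> (\<gamma> r) (\<gamma> r') = real (r' - r)"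
    using utc u geodesic_word_prefixes[OF gens_closed _ u(2)] by (auto simp: \<gamma>_def)
  have pow_a: "real k \<le> K * word_norm (a [^] k)" for k :: nat
    using power_displacement[of C a k] fam_a[OF a(1)] C K(2)[of "a [^] k"] ac by force
  have pow_b: "real k \<le> K * word_norm (b [^] k)" for k :: nat
    using power_displacement[of C b k] fam_b[OF b(1)] C K(2)[of "b [^] k"] bc by force
  have nearest: "real (length u) \<le> word_norm (a [^] p \<otimes> \<gamma> (length u) \<otimes> b [^] q)" for p q :: nat
    unfolding \<gamma>(3) shift using minimal u(1) by simp
  have far: "real (p + q) \<le> K * (word_norm (a [^] p \<otimes> \<gamma> (length u) \<otimes> b [^] q) + real (length u))" for p q :: nat
  proof -
    have "int (p + q) \<le> (\<bar>sa * int p + m0\<bar> + \<bar>n0 + sb * int q\<bar>) + (\<bar>m0\<bar> + \<bar>n0\<bar>)"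
      using a(2) b(2) by auto
    then have "real (p + q) \<le> real_of_int (\<bar>sa * int p + m0\<bar> + \<bar>n0 + sb * int q\<bar>) + real_of_int (\<bar>m0\<bar> + \<bar>n0\<bar>)"
      by linarith
    also have "real_of_int (\<bar>sa * int p + m0\<bar> + \<bar>n0 + sb * int q\<bar>) \<le> K * word_norm (a [^] p \<otimes> v' \<otimes> b [^] q)"
      unfolding shift using disp[of "sa * int p + m0" "n0 + sb * int q"] by linarith
    also have "real_of_int (\<bar>m0\<bar> + \<bar>n0\<bar>) \<le> K * real (length u)"
      unfolding u(1) v'_def using disp[of m0 n0] by linarith
    finally show ?thesis unfolding \<gamma>(3) by (simp add: algebra_simps)
  qed
  have ab_fam: "a \<in> with_inverse y \<union> with_inverse z" "b \<in> with_inverse y \<union> with_inverse z" using a(1) b(1) a0(1) b0(1) by auto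
  (* Without c the word would end in b and start in a, and b could be the inverse of a. *)
  obtain c where c: "c \<in> with_inverse y \<union> with_inverse z" "wide_corner C b c" "wide_corner C c a"
  proof (cases "a0 = b0")
    case True
    show ?thesis
    proof (cases "a0 = y")
      case y: True
      then show ?thesis using that[of z] cross[of b z] cross[of a z] a(1) b(1) True by (simp add: with_inverse_def[of z])
    next
      case False
      then have "a0 = z" using a0(1) by simp
      then show ?thesis using that[of y] cross[of y b] cross[of y a] a(1) b(1) True by (simp add: with_inverse_def[of y])
    qed
  next
    case False
    then have "a0 = y \<and> b0 = z \<or> a0 = z \<and> b0 = y" using a0(1) b0(1) by auto
    then have "wide_corner C b a" using cross[of a b] cross[of b a] a(1) b(1) by auto
    then show ?thesis using that[OF ab_fam(2)] fam_b[OF b(1)] by simp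
  qed
  have cc: "c \<in> carrier G" "long_letter C c" "wide_corner C c c"
    using self[OF c(1)] by (auto simp: long_letter_def)
  define V where "V = replicate i a @ u @ replicate j b"
  have Vc: "set V \<subseteq> carrier G" using ac bc uc by (auto simp: V_def)
  have valV: "word_value G V = v"
    unfolding V_def using ac bc uc v_eq v'c u(3)
    by (simp add: word_value_append word_value_replicate m_assoc)
  have Vne: "V \<noteq> []"
  proof
    assume "V = []"
    then have "v = \<one>" using valV by simp
    then show False using v C \<delta>_nonneg base by (simp add: long_letter_def)
  qed
  (* N depends on v; the quasi-geodesic constants do not depend on N. *)
  define N where "N = nat \<lceil>(16 + 8 * K * \<Lambda>) * real (length V)\<rceil>"
  have N: "(16 + 8 * K * \<Lambda>) * real (length V) \<le> real N" unfolding N_def by linarith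
  have "0 < (16 + 8 * K * \<Lambda>) * real (length V)" using Vne K(1) \<Lambda>(1) by (intro mult_pos_pos) (auto intro: add_pos_nonneg)
  then have N0: "0 < N" using N by linarith
  define A where "A = replicate N a"
  define Z where "Z = replicate N b @ replicate N c"
  let ?U = "A @ V @ Z" and ?T = "A @ [v] @ Z"
  have Ac: "set A \<subseteq> carrier G" and Zc: "set Z \<subseteq> carrier G" using ac bc cc by (auto simp: A_def Z_def)
  have fam_norm: "word_norm e \<le> \<Lambda>" if "e \<in> with_inverse y \<union> with_inverse z" for e
    using that \<Lambda> yz by (auto simp: with_inverse_def)
  have gen_norm: "word_norm e \<le> \<Lambda>" if "e \<in> S \<union> m_inv G ` S" for e
  proof -
    have "e \<in> carrier G" using that word_letters_closed[OF gens_closed] by blast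
    then have "word_length G S e \<le> 1" using word_length_le[of "[e]" S] that by simp
    then show ?thesis using \<Lambda>(1) by linarith
  qed
  have Vn: "word_norm e \<le> \<Lambda>" if "e \<in> set V" for e
    using that fam_norm[OF ab_fam(1)] fam_norm[OF ab_fam(2)] gen_norm u(2)
    by (auto simp: V_def split: if_splits)
  have adm: "admissible C ?T"
    using N0 fam_a[OF a(1)] fam_b[OF b(1)] cc c(2) v
    by (simp add: A_def Z_def admissible_append_iff admissible_Cons_iff admissible_replicate)
  have turn: "wide_corner C (last ?T) (hd ?T)" using c(3) N0 by (simp add: A_def Z_def)
  have window: "real (t - s) \<le> 4 * K * \<rho> (word_value G (take s ?U)) (word_value G (take t ?U))"
    if st: "s \<le> t" "t \<le> 2 * length A + length V" for s t
  proof -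
    have tk: "word_value G (take r ?U) = bridge_path a (N + i) \<gamma> (length u) b r" if "r \<le> 2 * N + length V" for r
    proof -
      have U: "?U = replicate (N + i) a @ u @ replicate (N + j) b @ replicate N c"
        by (simp add: A_def V_def Z_def replicate_add[symmetric] add.commute)
      have r: "r \<le> N + i + length u + (N + j)" using that by (simp add: V_def)
      consider "r \<le> N + i" | "N + i < r" "r \<le> N + i + length u" | "N + i + length u < r" by linarith
      then show ?thesis
      proof cases
        case 1
        then show ?thesis unfolding U using ac by (simp add: bridge_path_def min_def word_value_replicate)
      next
        case 2
        then show ?thesis unfolding U using ac utc
          by (simp add: bridge_path_def word_value_append word_value_replicate \<gamma>_def)
      next
        case 3
        have r'': "r - (N + i + length u) \<le> N + j" using r by linarith
        have "take r ?U = replicate (N + i) a @ u @ replicate (r - (N + i) - length u) b"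
          unfolding U using 3 r'' by (simp add: min_def)
        then show ?thesis using 3 ac bc uc
          by (simp add: bridge_path_def word_value_append word_value_replicate u(3) \<gamma>(3))
      qed
    qed
    have "real (t - s) \<le> (2 * K + 1) * \<rho> (word_value G (take s ?U)) (word_value G (take t ?U))"
      using bridge_path_lower_bound[where \<gamma> = \<gamma> and n = "length u" and a = a and b = b and K = K and P = "N + i",
          OF ac pow_a bc pow_b \<gamma>(1,2,4) nearest far K(1) st(1)] tk[of s] tk[of t] st by (simp add: A_def)
    also have "\<dots> \<le> 4 * K * \<rho> (word_value G (take s ?U)) (word_value G (take t ?U))"
      using K(1) by (intro mult_right_mono) auto
    finally show ?thesis .
  qed
  have lower: "real (t - s) \<le> 4 * K * \<rho> (cyclic_path G ?U s) (cyclic_path G ?U t)" if "s \<le> t" for s t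
  proof (rule cyclic_path_lower_bound[OF Ac Vc Zc valV Vne Vn _ _ K(1) \<Lambda>(1) _ window that])
    show "length A \<le> length Z" by (simp add: A_def Z_def)
    show "(16 + 8 * K * \<Lambda>) * real (length V) \<le> real (length A)" using N by (simp add: A_def)
    show "real (t - s) \<le> K * \<rho> (cyclic_path G ?T s) (cyclic_path G ?T t)" if "s \<le> t" for s t
      using cyclic_admissible_lower_bound[OF K(2) adm _ turn C that] by simp
  qed
  have Tc: "set ?T \<subseteq> carrier G" and Uc: "set ?U \<subseteq> carrier G" using Ac Vc Zc vc by auto
  have val: "word_value G ?U = word_value G ?T"
    using Ac Vc Zc valV vc by (simp add: word_value_append)
  have lox: "loxodromic G X d \<phi> (word_value G ?U)"
  proof (rule loxodromicI)
    show "word_value G ?U \<in> carrier G" using Uc by simp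
    fix n :: nat
    have "real n \<le> real (length (concat (replicate n ?T)))"
      by (simp add: length_concat sum_list_replicate)
    also have "\<dots> \<le> d x\<^sub>0 (\<phi> (word_value G (concat (replicate n ?T))) x\<^sub>0)"
      by (intro admissible_length[OF _ C] admissible_concat_replicate adm turn) simp
    also have "word_value G (concat (replicate n ?T)) = word_value G ?U [^] n"
      unfolding val by (rule word_value_concat_replicate[OF Tc])
    finally show "real n \<le> d x\<^sub>0 (\<phi> (word_value G ?U [^] n) x\<^sub>0)" .
  qed
  show ?thesis
  proof (rule that[of ?U N "length V"])
    show "word_norm l \<le> \<Lambda>" if "l \<in> set ?U" for l
      using that Vn fam_norm[OF ab_fam(1)] fam_norm[OF ab_fam(2)] fam_norm[OF c(1)]
      by (auto simp: A_def Z_def split: if_splits)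
    show "word_value G (take (N + length V) ?U) = word_value G (take N ?U) \<otimes> v"
      using Ac Vc valV by (simp add: A_def word_value_append)
    show "N + length V \<le> length ?U" by (simp add: A_def)
    show "?U \<noteq> []" using Vne by simp
  qed (use Uc lox lower in auto)
qed

end

section \<open>Periodic quasi-geodesics near a stable subgroup\<close>

context finitely_generated_group
begin

text \<open>
  By the triangle inequality \<open>\<rho> x y \<le> 2 * \<rho> u y\<close>, since \<open>x\<close> is no farther from \<open>u\<close> than \<open>y\<close> is.
\<close>

lemma nearest_point_detour:
  assumes c: "u \<in> carrier G" "x \<in> carrier G" "y \<in> carrier G" and ux: "\<rho> u x \<le> \<rho> u y"
    and lo: "\<epsilon> * n \<le> \<rho> x y" "0 < \<epsilon>" "\<epsilon> \<le> 1"
  shows "\<epsilon> / 3 * (\<rho> u x + n) \<le> \<rho> u y"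
proof -
  have "\<rho> x y \<le> \<rho> x u + \<rho> u y" using c by (intro \<rho>_triangle)
  then have "\<epsilon> * n \<le> 2 * \<rho> u y" using ux lo(1) \<rho>_commute[OF c(1,2)] by linarith
  moreover have "\<epsilon> * \<rho> u x \<le> 1 * \<rho> u x" using lo by (intro mult_right_mono) auto
  then have "\<epsilon> * \<rho> u x \<le> \<rho> u y" using ux by linarith
  ultimately show ?thesis by (simp add: algebra_simps)
qed

text \<open>
  If \<open>P t0\<close> is nearest to \<open>z0\<close>, it is nearest to every point of the geodesic between them, so going through it is an
  efficient detour. The two geodesics do not interfere because the piece of \<open>P\<close> between them is longer than both; the
  length of the geodesics does not enter the constants.
\<close>

lemma glue_geodesics_to_nearest_points:
  assumes P: "\<And>t. P t \<in> carrier G" "\<And>t. \<rho> (P t) (P (Suc t)) \<le> \<Lambda>"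
      "\<And>s t. s \<le> t \<Longrightarrow> \<epsilon> * real (t - s) \<le> \<rho> (P s) (P t)"
    and \<epsilon>: "0 < \<epsilon>" "\<epsilon> \<le> 1" and \<Lambda>: "1 \<le> \<Lambda>"
    and z: "z0 \<in> carrier G" "z1 \<in> carrier G"
    and near0: "\<And>t. \<rho> z0 (P t0) \<le> \<rho> z0 (P t)" and near1: "\<And>t. \<rho> z1 (P t1) \<le> \<rho> z1 (P t)"
    and t01: "t0 \<le> t1" and far: "2 * (\<rho> z0 (P t0) + \<rho> z1 (P t1)) \<le> \<epsilon> * real (t1 - t0)"
  obtains \<kappa> n where "\<kappa> 0 = z0" "\<kappa> n = z1" "\<And>i. \<kappa> i \<in> carrier G"
    "\<And>s t. s \<le> t \<Longrightarrow> t \<le> n \<Longrightarrow> \<epsilon> / 3 * real (t - s) \<le> \<rho> (\<kappa> s) (\<kappa> t)"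
    "\<And>s t. s \<le> t \<Longrightarrow> t \<le> n \<Longrightarrow> \<rho> (\<kappa> s) (\<kappa> t) \<le> \<Lambda> * real (t - s)"
    "\<And>t. t0 \<le> t \<Longrightarrow> t \<le> t1 \<Longrightarrow> \<exists>s\<le>n. \<kappa> s = P t"
proof -
  obtain \<alpha> n0 where \<alpha>: "real n0 = \<rho> z0 (P t0)" "\<alpha> 0 = z0" "\<alpha> n0 = P t0" "\<And>i. \<alpha> i \<in> carrier G"
    "\<And>i j. i \<le> j \<Longrightarrow> j \<le> n0 \<Longrightarrow> \<rho> (\<alpha> i) (\<alpha> j) = real (j - i)"
    using geodesic_path[OF z(1) P(1)[of t0]] by metis
  obtain \<beta> n1 where \<beta>: "real n1 = \<rho> (P t1) z1" "\<beta> 0 = P t1" "\<beta> n1 = z1" "\<And>i. \<beta> i \<in> carrier G"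
    "\<And>i j. i \<le> j \<Longrightarrow> j \<le> n1 \<Longrightarrow> \<rho> (\<beta> i) (\<beta> j) = real (j - i)"
    using geodesic_path[OF P(1)[of t1] z(2)] by metis
  define M where "M = t1 - t0"
  define n where "n = n0 + M + n1"
  define \<kappa> where "\<kappa> t = (if t \<le> n0 then \<alpha> t else if t \<le> n0 + M then P (t0 + (t - n0)) else \<beta> (t - (n0 + M)))" for t
  have k1: "\<kappa> t = \<alpha> t" if "t \<le> n0" for t using that by (simp add: \<kappa>_def)
  have k2: "\<kappa> t = P (t0 + (t - n0))" if "n0 \<le> t" "t \<le> n0 + M" for t
    using that \<alpha>(3) by (cases "t = n0") (auto simp: \<kappa>_def)
  have k3: "\<kappa> t = \<beta> (t - (n0 + M))" if "n0 + M \<le> t" for t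
  proof (cases "t = n0 + M")
    case True
    then show ?thesis using k2[of t] \<beta>(2) t01 by (simp add: M_def)
  next
    case False
    then show ?thesis using that by (simp add: \<kappa>_def)
  qed
  have c: "\<kappa> t \<in> carrier G" for t using \<alpha>(4) \<beta>(4) P(1) by (simp add: \<kappa>_def)
  have near\<alpha>: "\<rho> (\<alpha> s) (P t0) = real (n0 - s) \<and> \<rho> (\<alpha> s) (P t0) \<le> \<rho> (\<alpha> s) (P t)" if "s \<le> n0" for s t
  proof -
    have 1: "\<rho> (\<alpha> s) (P t0) = real (n0 - s)" using \<alpha>(5)[of s n0] \<alpha>(3) that by simp
    have "\<rho> z0 (P t) \<le> real s + \<rho> (\<alpha> s) (P t)"
      using \<rho>_triangle[OF z(1) \<alpha>(4)[of s] P(1)[of t]] \<alpha>(5)[of 0 s] \<alpha>(2) that by simp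
    then show ?thesis using 1 near0[of t] \<alpha>(1) that by simp
  qed
  have near\<beta>: "\<rho> (\<beta> s) (P t1) = real s \<and> \<rho> (\<beta> s) (P t1) \<le> \<rho> (\<beta> s) (P t)" if "s \<le> n1" for s t
  proof -
    have 1: "\<rho> (\<beta> s) (P t1) = real s"
      using \<beta>(5)[of 0 s] \<beta>(2) that \<rho>_commute[OF \<beta>(4)[of s] P(1)[of t1]] by simp
    have "\<rho> z1 (P t) \<le> \<rho> z1 (\<beta> s) + \<rho> (\<beta> s) (P t)" by (intro \<rho>_triangle z \<beta>(4) P(1))
    moreover have "\<rho> z1 (\<beta> s) = real (n1 - s)"
      using \<beta>(5)[of s n1] \<beta>(3) that \<rho>_commute[OF \<beta>(4)[of s] z(2)] by simp
    moreover have "\<rho> z1 (P t1) = real n1" using \<beta>(1) \<rho>_commute[OF P(1)[of t1] z(2)] by simp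
    ultimately show ?thesis using 1 near1[of t] that by simp
  qed
  have small: "\<epsilon> / 3 * r \<le> r" "\<epsilon> / 3 * r \<le> \<epsilon> * r" if "0 \<le> r" for r :: real
  proof -
    have "\<epsilon> * r \<le> 1 * r" "0 \<le> \<epsilon> * r"
      using mult_right_mono[OF \<epsilon>(2) that] mult_nonneg_nonneg[of \<epsilon> r] \<epsilon>(1) that by auto
    then show "\<epsilon> / 3 * r \<le> r" "\<epsilon> / 3 * r \<le> \<epsilon> * r" using that by auto
  qed
  have lower: "\<epsilon> / 3 * real (t - s) \<le> \<rho> (\<kappa> s) (\<kappa> t)" if st: "s \<le> t" "t \<le> n" for s t
  proof -
    consider "t \<le> n0" | "s \<le> n0" "n0 \<le> t" "t \<le> n0 + M" | "s \<le> n0" "n0 + M \<le> t"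
      | "n0 \<le> s" "t \<le> n0 + M" | "n0 \<le> s" "s \<le> n0 + M" "n0 + M \<le> t" | "n0 + M \<le> s"
      using st by linarith
    then show ?thesis
    proof cases
      case 1
      then have "\<rho> (\<kappa> s) (\<kappa> t) = real (t - s)" using st k1 \<alpha>(5)[of s t] by simp
      then show ?thesis using small(1)[OF of_nat_0_le_iff, of "t - s"] by (simp only:)
    next
      case 2
      define t' where "t' = t0 + (t - n0)"
      have t': "t0 \<le> t'" "t' - t0 = t - n0" by (simp_all add: t'_def)
      have "\<epsilon> / 3 * (\<rho> (\<alpha> s) (P t0) + real (t' - t0)) \<le> \<rho> (\<alpha> s) (P t')"
        using near\<alpha>[OF 2(1), of t'] P(3)[OF t'(1)] \<epsilon> by (intro nearest_point_detour \<alpha>(4) P(1)) auto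
      moreover have "\<rho> (\<alpha> s) (P t0) + real (t' - t0) = real (t - s)"
        using near\<alpha>[OF 2(1)] 2 t' by simp
      ultimately show ?thesis using k1[OF 2(1)] k2[OF 2(2,3)] by (simp add: t'_def)
    next
      case 3
      define t' where "t' = t - (n0 + M)"
      have t': "t' \<le> n1" using st(2) by (simp add: t'_def n_def)
      have ts: "t - s = (n0 - s) + M + t'" using 3 by (simp add: t'_def)
      have "\<rho> (P t0) (P t1) \<le> \<rho> (P t0) (\<alpha> s) + \<rho> (\<alpha> s) (\<beta> t') + \<rho> (\<beta> t') (P t1)"
        using \<rho>_triangle[OF P(1)[of t0] \<alpha>(4)[of s] P(1)[of t1]] \<rho>_triangle[OF \<alpha>(4)[of s] \<beta>(4)[of t'] P(1)[of t1]] by linarith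
      also have "\<dots> = real (n0 - s) + \<rho> (\<alpha> s) (\<beta> t') + real t'"
        using near\<alpha>[OF 3(1)] near\<beta>[OF t'] \<rho>_commute[OF P(1)[of t0] \<alpha>(4)[of s]] by simp
      finally have "\<epsilon> * real M \<le> real n0 + real n1 + \<rho> (\<alpha> s) (\<beta> t')"
        using P(3)[OF t01] t' by (simp add: M_def)
      moreover have far': "2 * real n0 + 2 * real n1 \<le> \<epsilon> * real M"
        using far \<alpha>(1) \<beta>(1) \<rho>_commute[OF P(1)[of t1] z(2)] by (simp add: M_def)
      ultimately have 1: "\<epsilon> * real M \<le> 2 * \<rho> (\<alpha> s) (\<beta> t')" by linarith
      have "\<epsilon> * real M \<le> 1 * real M" using \<epsilon> by (intro mult_right_mono) auto
      then have "real (t - s) \<le> 3 / 2 * real M" unfolding ts using far' t' by simp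
      then have "\<epsilon> / 3 * real (t - s) \<le> \<epsilon> / 3 * (3 / 2 * real M)" using \<epsilon> by (intro mult_left_mono) auto
      also have "\<dots> \<le> \<rho> (\<alpha> s) (\<beta> t')" using 1 by simp
      finally show ?thesis using k1[OF 3(1)] k3[OF 3(2)] by (simp add: t'_def)
    next
      case 4
      have "\<epsilon> * real (t - s) \<le> \<rho> (\<kappa> s) (\<kappa> t)"
        using 4 st P(3)[of "t0 + (s - n0)" "t0 + (t - n0)"] k2 by simp
      with small(2)[OF of_nat_0_le_iff, of "t - s"] show ?thesis by (rule order_trans)
    next
      case 5
      define t' where "t' = t - (n0 + M)"
      define s' where "s' = t0 + (s - n0)"
      have t': "t' \<le> n1" using st(2) by (simp add: t'_def n_def)
      have s': "s' \<le> t1" "t1 - s' = n0 + M - s" using 5 t01 by (auto simp: s'_def M_def)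
      have c5: "\<rho> (P t1) (P s') = \<rho> (P s') (P t1)" by (intro \<rho>_commute P(1))
      have "\<epsilon> / 3 * (\<rho> (\<beta> t') (P t1) + real (t1 - s')) \<le> \<rho> (\<beta> t') (P s')"
        using near\<beta>[OF t', of s'] P(3)[OF s'(1)] \<epsilon> c5 by (intro nearest_point_detour \<beta>(4) P(1)) auto
      moreover have "\<rho> (\<beta> t') (P t1) + real (t1 - s') = real (t - s)"
        using near\<beta>[OF t'] s' 5 by (simp add: t'_def)
      ultimately show ?thesis using k2[OF 5(1,2)] k3[OF 5(3)] \<rho>_commute[OF \<beta>(4)[of t'] P(1)[of s']]
        by (simp add: t'_def s'_def)
    next
      case 6
      then have "\<rho> (\<kappa> s) (\<kappa> t) = real (t - s)"
        using st k3[of s] k3[of t] \<beta>(5)[of "s - (n0 + M)" "t - (n0 + M)"] by (simp add: n_def)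
      then show ?thesis using small(1)[OF of_nat_0_le_iff, of "t - s"] by (simp only:)
    qed
  qed
  have step: "\<rho> (\<kappa> i) (\<kappa> (Suc i)) \<le> \<Lambda>" if "i < n" for i
  proof -
    consider "Suc i \<le> n0" | "n0 \<le> i" "Suc i \<le> n0 + M" | "n0 + M \<le> i" by linarith
    then show ?thesis
    proof cases
      case 1
      then show ?thesis using k1[of i] k1[of "Suc i"] \<alpha>(5)[of i "Suc i"] \<Lambda> by simp
    next
      case 2
      then show ?thesis using k2[of i] k2[of "Suc i"] P(2)[of "t0 + (i - n0)"] by (simp add: Suc_diff_le)
    next
      case 3
      then show ?thesis using k3[of i] k3[of "Suc i"] \<beta>(5)[of "i - (n0 + M)" "Suc i - (n0 + M)"] \<Lambda> that
        by (simp add: n_def Suc_diff_le)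
    qed
  qed
  show ?thesis
  proof (rule that[of \<kappa> n])
    show "\<kappa> 0 = z0" using k1[of 0] \<alpha>(2) by simp
    show "\<kappa> n = z1" using k3[of n] \<beta>(3) by (simp add: n_def)
    show "\<rho> (\<kappa> s) (\<kappa> t) \<le> \<Lambda> * real (t - s)" if "s \<le> t" "t \<le> n" for s t
      using step_bound_imp_dist_bound[of \<kappa> n \<Lambda>, OF c step] that by blast
    show "\<exists>s\<le>n. \<kappa> s = P t" if "t0 \<le> t" "t \<le> t1" for t
      using k2[of "n0 + (t - t0)"] that by (intro exI[of _ "n0 + (t - t0)"]) (simp add: M_def n_def)
  qed (use c lower in auto)
qed

lemma nearest_point_exists:
  fixes P :: "nat \<Rightarrow> 'a"
  obtains t0 where "\<And>t. \<rho> z (P t0) \<le> \<rho> z (P t)"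
proof -
  have "\<exists>t0. \<forall>t. word_length G S (inv z \<otimes> P t0) \<le> word_length G S (inv z \<otimes> P t)"
    using ex_has_least_nat[of "\<lambda>_. True" undefined "\<lambda>t. word_length G S (inv z \<otimes> P t)"] by auto
  then show ?thesis using that unfolding word_dist_def by (meson of_nat_mono)
qed

text \<open>
  The points \<open>Q (n * k * L)\<close> of the translated path \<open>Q\<close> are at distance \<open>word_norm g\<close> from \<open>h [^] n \<in> H\<close>. So for large
  \<open>n\<close> geodesics from \<open>\<one>\<close> and from \<open>h [^] n\<close> to \<open>Q\<close> can be glued to a piece of \<open>Q\<close> that contains a whole period. The
  result is compared, by stability, with the path in \<open>H\<close> along a geodesic word in the generators \<open>T\<close> of \<open>H\<close>. Neither the
  quasi-geodesic constants nor \<open>R\<close> depend on \<open>g\<close>.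
\<close>

lemma stable_subgroup_near_periodic_path:
  assumes H: "subgroup H G" and T: "T \<subseteq> H" "generate G T = H"
    and emb: "qi_embedding l0 c H (word_dist G T) (cayley_graph G S) (cayley_dist G S) cayley_vertex"
    and l: "l0 \<le> l" "3 \<le> l" "\<Lambda> \<le> l" "1 \<le> \<Lambda>"
    and stab: "\<forall>p q a b a' b'. a \<le> b \<and> a' \<le> b' \<and>
      quasi_geodesic l (c + l) (cayley_graph G S) (cayley_dist G S) {a..b} p \<and>
      quasi_geodesic l (c + l) (cayley_graph G S) (cayley_dist G S) {a'..b'} q \<and>
      p a = q a' \<and> p b = q b' \<and> p a \<in> cayley_vertex ` H \<and> p b \<in> cayley_vertex ` H
      \<longrightarrow> (\<forall>s\<in>{a..b}. \<exists>t\<in>{a'..b'}. cayley_dist G S (p s) (q t) \<le> R)"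
    and P: "\<And>t. P t \<in> carrier G" "P 0 = \<one>" "\<And>t. \<rho> (P t) (P (Suc t)) \<le> \<Lambda>"
      "\<And>s t. s \<le> t \<Longrightarrow> 3 / l * real (t - s) \<le> \<rho> (P s) (P t)"
    and w: "w \<in> carrier G" and L: "0 < L" and period: "\<And>q t. P (q * L + t) = w [^] q \<otimes> P t"
    and k: "0 < k" and g: "g \<in> carrier G" and h: "h \<in> H" and conj: "w [^] (k::nat) = g \<otimes> h \<otimes> inv g"
  obtains q where "\<And>t. t \<le> L \<Longrightarrow> \<exists>h'\<in>H. \<rho> (inv g \<otimes> (w [^] (q::nat) \<otimes> P t)) h' \<le> R"
proof -
  interpret H: subgroup H G by fact
  have c0: "0 \<le> c" "1 \<le> l0" using emb by (auto simp: qi_embedding_def)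
  define \<epsilon> where "\<epsilon> = 3 / l"
  have \<epsilon>: "0 < \<epsilon>" "\<epsilon> \<le> 1" "\<epsilon> / 3 = 1 / l" using l by (auto simp: \<epsilon>_def)
  define Q where "Q t = inv g \<otimes> P t" for t
  have Qc: "Q t \<in> carrier G" for t using g P(1) by (simp add: Q_def)
  have Qd: "\<rho> (Q s) (Q t) = \<rho> (P s) (P t)" for s t
    unfolding Q_def using g P(1) by (simp add: word_dist_left_mult)
  have Q_lower: "\<epsilon> * real (t - s) \<le> \<rho> (Q s) (Q t)" if "s \<le> t" for s t
    using P(4)[OF that] by (simp add: Qd \<epsilon>_def)
  have hc: "h \<in> carrier G" using h by (rule H.mem_carrier)
  have hn: "h [^] n \<in> H" for n :: nat by (induction n) (auto simp: h)
  define r where "r = word_norm g"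
  have Q_end: "\<rho> (h [^] n) (Q (n * k * L)) = r" for n :: nat
  proof -
    have "P (n * k * L) = w [^] (k * n)" using period[of "n * k" 0] P(2) w by (simp add: mult.commute)
    also have "\<dots> = (g \<otimes> h \<otimes> inv g) [^] n" using w conj nat_pow_pow[OF w, of k n] by simp
    also have "\<dots> = g \<otimes> h [^] n \<otimes> inv g"
    proof (induction n)
      case (Suc n)
      then show ?case using g hc by (simp add: m_assoc)
    qed (use g in simp)
    finally have "Q (n * k * L) = h [^] n \<otimes> inv g"
      unfolding Q_def using g hc by (simp add: m_assoc)
    then show ?thesis using g hc by (simp add: word_dist_mult_right r_def)
  qed
  obtain t0 where t0: "\<And>t. \<rho> \<one> (Q t0) \<le> \<rho> \<one> (Q t)" using nearest_point_exists by metis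
  have r0: "\<rho> \<one> (Q t0) \<le> r" using t0[of 0] Q_end[of 0] by simp
  (* Large enough that, although t1 may fall short of n * k * L by 2 * r / \<epsilon>, the piece between t0 and t1 has
     length at least 4 * r / \<epsilon> and contains the period that starts at t0 * L. *)
  define n where "n = (t0 + 1) * L + nat \<lceil>6 * r / \<epsilon>\<rceil> + t0"
  obtain t1 where t1: "\<And>t. \<rho> (h [^] n) (Q t1) \<le> \<rho> (h [^] n) (Q t)" using nearest_point_exists by metis
  have r1: "\<rho> (h [^] n) (Q t1) \<le> r" using t1[of "n * k * L"] Q_end[of n] by simp
  have "n \<le> n * k * L" using k L by simp
  have t1_big: "real n - 2 * r / \<epsilon> \<le> real t1"
  proof (cases "n * k * L \<le> t1")
    case True
    then have "real n \<le> real t1" using \<open>n \<le> n * k * L\<close> by linarith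
    moreover have "0 \<le> 2 * r / \<epsilon>" using \<epsilon> by (simp add: r_def)
    ultimately show ?thesis by linarith
  next
    case False
    have "\<epsilon> * real (n * k * L - t1) \<le> \<rho> (Q t1) (Q (n * k * L))" using False by (intro Q_lower) simp
    also have "\<dots> \<le> \<rho> (Q t1) (h [^] n) + \<rho> (h [^] n) (Q (n * k * L))" using Qc hc by (intro \<rho>_triangle) auto
    also have "\<dots> \<le> 2 * r" using r1 Q_end[of n] \<rho>_commute[OF Qc[of t1], of "h [^] n"] hc by simp
    finally have "real (n * k * L - t1) * \<epsilon> \<le> 2 * r" by (simp only: mult.commute[of \<epsilon>])
    then have "real (n * k * L - t1) \<le> 2 * r / \<epsilon>" by (rule mult_imp_le_div_pos[OF \<epsilon>(1)])
    moreover have "real n \<le> real (n * k * L)" using \<open>n \<le> n * k * L\<close> by (simp only: of_nat_le_iff)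
    ultimately show ?thesis using False by (simp only: of_nat_diff)
  qed
  have rn: "6 * r / \<epsilon> \<le> real (nat \<lceil>6 * r / \<epsilon>\<rceil>)" by linarith
  have nn: "real n = real ((t0 + 1) * L) + real (nat \<lceil>6 * r / \<epsilon>\<rceil>) + real t0" by (simp add: n_def)
  have t1_far: "real ((t0 + 1) * L) + 4 * r / \<epsilon> + real t0 \<le> real t1"
  proof -
    have "6 * r / \<epsilon> = 2 * r / \<epsilon> + 4 * r / \<epsilon>" by (simp add: add_divide_distrib[symmetric])
    then show ?thesis using t1_big rn nn by linarith
  qed
  have re: "0 \<le> 4 * r / \<epsilon>" using \<epsilon> by (simp add: r_def)
  have t01: "t0 \<le> t1" using t1_far re by linarith
  have "4 * r / \<epsilon> \<le> real (t1 - t0)"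
    unfolding of_nat_diff[OF t01] using t1_far of_nat_0_le_iff[of "(t0 + 1) * L", where 'a = real] by linarith
  then have "4 * r \<le> \<epsilon> * real (t1 - t0)"
    unfolding pos_divide_le_eq[OF \<epsilon>(1)] by (simp only: mult.commute)
  moreover have "2 * (\<rho> \<one> (Q t0) + \<rho> (h [^] n) (Q t1)) \<le> 4 * r" using r0 r1 by simp
  ultimately have far: "2 * (\<rho> \<one> (Q t0) + \<rho> (h [^] n) (Q t1)) \<le> \<epsilon> * real (t1 - t0)"
    by (rule order_trans[rotated])
  have steps: "\<rho> (Q t) (Q (Suc t)) \<le> \<Lambda>" for t using P(3) by (simp add: Qd)
  obtain \<kappa> m where \<kappa>: "\<kappa> 0 = \<one>" "\<kappa> m = h [^] n" "\<And>i. \<kappa> i \<in> carrier G"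
    "\<And>s t. s \<le> t \<Longrightarrow> t \<le> m \<Longrightarrow> \<epsilon> / 3 * real (t - s) \<le> \<rho> (\<kappa> s) (\<kappa> t)"
    "\<And>s t. s \<le> t \<Longrightarrow> t \<le> m \<Longrightarrow> \<rho> (\<kappa> s) (\<kappa> t) \<le> \<Lambda> * real (t - s)"
    "\<And>t. t0 \<le> t \<Longrightarrow> t \<le> t1 \<Longrightarrow> \<exists>s\<le>m. \<kappa> s = Q t"
    by (rule glue_geodesics_to_nearest_points[OF Qc steps Q_lower \<epsilon>(1,2) l(4) one_closed _ t0 t1 t01 far])
      (use hc in auto)
  have l1: "1 \<le> l" using l by simp
  have qgp: "quasi_geodesic l (c + l) (cayley_graph G S) (cayley_dist G S) {0..real m}
      (\<lambda>t. cayley_vertex (\<kappa> (nat \<lfloor>t\<rfloor>)))"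
  proof (rule discrete_quasi_geodesic[OF l1 c0(1) \<kappa>(3)])
    fix i j assume ij: "i \<le> j" "j \<le> m"
    show "real (j - i) / l - c \<le> \<rho> (\<kappa> i) (\<kappa> j)" using \<kappa>(4)[OF ij] \<epsilon>(3) c0 by simp
    have "\<Lambda> * real (j - i) \<le> l * real (j - i)" using l by (intro mult_right_mono) auto
    then show "\<rho> (\<kappa> i) (\<kappa> j) \<le> l * real (j - i) + c" using \<kappa>(5)[OF ij] c0 by linarith
  qed
  have Tc: "T \<subseteq> carrier G" using T(1) H.subset by blast
  have hT: "h [^] n \<in> generate G T" using hn T(2) by simp
  obtain \<tau> where \<tau>: "\<tau> 0 = \<one>" "\<tau> (word_length G T (h [^] n)) = h [^] n" "\<And>i. \<tau> i \<in> generate G T"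
    "\<And>i j. i \<le> j \<Longrightarrow> j \<le> word_length G T (h [^] n) \<Longrightarrow> word_dist G T (\<tau> i) (\<tau> j) = real (j - i)"
    using word_geodesic_path[OF Tc hT] by metis
  define m' where "m' = word_length G T (h [^] n)"
  note \<tau> = \<tau>[folded m'_def]
  have \<tau>H: "\<tau> i \<in> H" and \<tau>c: "\<tau> i \<in> carrier G" for i using \<tau>(3) T(2) H.mem_carrier by auto
  have qgq: "quasi_geodesic l (c + l) (cayley_graph G S) (cayley_dist G S) {0..real m'}
      (\<lambda>t. cayley_vertex (\<tau> (nat \<lfloor>t\<rfloor>)))"
  proof (rule discrete_quasi_geodesic[OF l1 c0(1) \<tau>c])
    fix i j assume ij: "i \<le> j" "j \<le> m'"
    have e: "real (j - i) / l0 - c \<le> \<rho> (\<tau> i) (\<tau> j)" "\<rho> (\<tau> i) (\<tau> j) \<le> l0 * real (j - i) + c"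
    proof -
      have "word_dist G T (\<tau> i) (\<tau> j) / l0 - c \<le> cayley_dist G S (cayley_vertex (\<tau> i)) (cayley_vertex (\<tau> j)) \<and>
          cayley_dist G S (cayley_vertex (\<tau> i)) (cayley_vertex (\<tau> j)) \<le> l0 * word_dist G T (\<tau> i) (\<tau> j) + c"
        using emb \<tau>H[of i] \<tau>H[of j] unfolding qi_embedding_def by blast
      then show "real (j - i) / l0 - c \<le> \<rho> (\<tau> i) (\<tau> j)" "\<rho> (\<tau> i) (\<tau> j) \<le> l0 * real (j - i) + c"
        unfolding \<tau>(4)[OF ij] cayley_dist_eq_\<rho>[OF \<tau>c[of i] \<tau>c[of j]] by auto
    qed
    have "real (j - i) / l \<le> real (j - i) / l0" using l c0 by (intro divide_left_mono) auto
    then show "real (j - i) / l - c \<le> \<rho> (\<tau> i) (\<tau> j)" using e by linarith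
    have "l0 * real (j - i) \<le> l * real (j - i)" using l by (intro mult_right_mono) auto
    then show "\<rho> (\<tau> i) (\<tau> j) \<le> l * real (j - i) + c" using e by linarith
  qed
  have close: "\<exists>h'\<in>H. \<rho> (\<kappa> s) h' \<le> R" if s: "s \<le> m" for s
  proof -
    have all: "\<forall>s\<in>{0..real m}. \<exists>t\<in>{0..real m'}.
        cayley_dist G S (cayley_vertex (\<kappa> (nat \<lfloor>s\<rfloor>))) (cayley_vertex (\<tau> (nat \<lfloor>t\<rfloor>))) \<le> R"
      using stab[THEN spec, of "\<lambda>t. cayley_vertex (\<kappa> (nat \<lfloor>t\<rfloor>))", THEN spec,
        of "\<lambda>t. cayley_vertex (\<tau> (nat \<lfloor>t\<rfloor>))", THEN spec, of 0, THEN spec, of "real m",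
        THEN spec, of 0, THEN spec, of "real m'"] qgp qgq \<kappa>(1,2) \<tau>(1,2) H.one_closed hn[of n]
      by simp
    have "real s \<in> {0..real m}" using s by simp
    from bspec[OF all this] obtain t :: real where "cayley_dist G S (cayley_vertex (\<kappa> (nat \<lfloor>real s\<rfloor>))) (cayley_vertex (\<tau> (nat \<lfloor>t\<rfloor>))) \<le> R"
      by blast
    then show ?thesis using cayley_dist_eq_\<rho>[OF \<kappa>(3)[of s] \<tau>c] \<tau>H by auto
  qed
  show ?thesis
  proof (rule that[of t0])
    fix t assume t: "t \<le> L"
    have "t0 * L + t \<le> (t0 + 1) * L" using t by simp
    moreover have "real ((t0 + 1) * L) \<le> real t1" using t1_far re by linarith
    ultimately have le: "t0 * L + t \<le> t1" by (meson le_trans of_nat_le_iff)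
    have ge: "t0 \<le> t0 * L + t" using L by (simp add: trans_le_add1)
    obtain s where "s \<le> m" "\<kappa> s = Q (t0 * L + t)" using \<kappa>(6)[OF ge le] by blast
    then show "\<exists>h'\<in>H. \<rho> (inv g \<otimes> (w [^] t0 \<otimes> P t)) h' \<le> R"
      using close[of s] by (simp add: Q_def period)
  qed
qed

end

section \<open>A loxodromic element without powers in the conjugates\<close>

context acting_group
begin

text \<open>
  An element \<open>v\<close> outside the double cosets that moves the base point too little is replaced by \<open>v \<otimes> e\<close> with a fixed \<open>e\<close>
  of large displacement. For this to stay outside, \<open>v\<close> is chosen outside the double cosets with a larger ball on the
  right.
\<close>

lemma long_avoiding_element:
  assumes y: "long_letter C y" "wide_corner C y y" "0 \<le> C"
    and H: "subgroup H G" "infinite (rcosets H)"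
  obtains v where "long_letter C v"
    "\<And>a h b. a \<in> carrier G \<Longrightarrow> h \<in> H \<Longrightarrow> b \<in> carrier G \<Longrightarrow> word_norm a \<le> R \<Longrightarrow> word_norm b \<le> R \<Longrightarrow> v \<noteq> a \<otimes> h \<otimes> b"
proof -
  interpret H: subgroup H G by fact
  define D where "D = 2 * C + 4 * \<delta> + 1"
  define M where "M = nat \<lceil>2 * D\<rceil>"
  have yc: "y \<in> carrier G" using y(1) by (simp add: long_letter_def)
  define e where "e = y [^] M"
  have ec: "e \<in> carrier G" using yc by (simp add: e_def)
  have De: "2 * D \<le> d x\<^sub>0 (\<phi> e x\<^sub>0)"
    using power_displacement[OF y, of M] unfolding e_def M_def by linarith
  obtain v where v: "v \<in> carrier G" "\<And>a h b. a \<in> carrier G \<Longrightarrow> word_norm a \<le> R \<Longrightarrow> h \<in> H \<Longrightarrow>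
      b \<in> carrier G \<Longrightarrow> word_norm b \<le> R + word_norm e \<Longrightarrow> v \<noteq> a \<otimes> h \<otimes> b"
    using infinite_index_not_covered[OF H ball_finite[of R] _ ball_finite[of "R + word_norm e"]] by auto
  show ?thesis
  proof (cases "D \<le> d x\<^sub>0 (\<phi> v x\<^sub>0)")
    case True
    show ?thesis
    proof (rule that[of v])
      show "long_letter C v" using v(1) True by (simp add: long_letter_def D_def)
      show "v \<noteq> a \<otimes> h \<otimes> b" if "a \<in> carrier G" "h \<in> H" "b \<in> carrier G" "word_norm a \<le> R" "word_norm b \<le> R" for a h b
        using v(2)[of a h b] that by simp
    qed
  next
    case False
    have "d (\<phi> v x\<^sub>0) (\<phi> (v \<otimes> e) x\<^sub>0) = d x\<^sub>0 (\<phi> e x\<^sub>0)"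
      using isometry v(1) ec base by (simp add: act_mult)
    then have "D \<le> d x\<^sub>0 (\<phi> (v \<otimes> e) x\<^sub>0)"
      using d_triangle[of "\<phi> v x\<^sub>0" x\<^sub>0 "\<phi> (v \<otimes> e) x\<^sub>0"] d_commute[of x\<^sub>0 "\<phi> v x\<^sub>0"] False De v(1) ec base by simp
    show ?thesis
    proof (rule that[of "v \<otimes> e"])
      show "long_letter C (v \<otimes> e)" using v(1) ec \<open>D \<le> _\<close> by (simp add: long_letter_def D_def)
      fix a h b assume *: "a \<in> carrier G" "h \<in> H" "b \<in> carrier G" "word_norm a \<le> R" "word_norm b \<le> R"
      have hc: "h \<in> carrier G" using *(2) by (rule H.mem_carrier)
      show "v \<otimes> e \<noteq> a \<otimes> h \<otimes> b"
      proof
        assume "v \<otimes> e = a \<otimes> h \<otimes> b"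
        then have "v \<otimes> e \<otimes> inv e = a \<otimes> h \<otimes> b \<otimes> inv e" by simp
        then have "v = a \<otimes> h \<otimes> (b \<otimes> inv e)" using v(1) ec * hc by (simp add: m_assoc)
        moreover have "word_norm (b \<otimes> inv e) \<le> R + word_norm e"
          using norm_mult[of b "inv e"] * ec by simp
        ultimately show False using v(2)[of a h "b \<otimes> inv e"] * ec by simp
      qed
    qed
  qed
qed

end

theorem theorem5p1:
  fixes G :: "('a, 'm) monoid_scheme" (structure)
    and S H :: "'a set"
    and X :: "'b set" and d :: "'b \<Rightarrow> 'b \<Rightarrow> real" and \<phi> :: "'a \<Rightarrow> 'b \<Rightarrow> 'b"
  assumes "group G"
    and "finite S" and "S \<subseteq> carrier G" and "generate G S = carrier G"
    and "stable_subgroup G S H"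
    and "infinite (rcosets H)"
    and "hyperbolic_space X d"
    and "isometric_action G X d \<phi>"
    and "non_elementary G X d \<phi>"
    and "WPD_action G X d \<phi>"
  shows "\<exists>f\<in>carrier G. loxodromic G X d \<phi> f \<and>
           (\<forall>g\<in>carrier G. (g <# H #> inv g) \<inter> generate G {f} = {\<one>})"
proof -
  obtain \<delta> where \<delta>: "0 \<le> \<delta>" "\<forall>w\<in>X. \<forall>x\<in>X. \<forall>y\<in>X. \<forall>z\<in>X.
      gromov_product d w x z \<ge> min (gromov_product d w x y) (gromov_product d w y z) - \<delta>"
    using assms(7) unfolding hyperbolic_space_def by blast
  obtain f0 \<alpha>0 where "quasi_axis X d \<phi> f0 \<alpha>0" using assms(9) unfolding non_elementary_def by blast
  then have "\<alpha>0 0 \<in> X" by (auto simp: quasi_axis_def quasi_geodesic_def qi_embedding_def)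
  then obtain x\<^sub>0 where x0: "x\<^sub>0 \<in> X" by blast
  interpret group G by (rule assms(1))
  interpret acting_group G S X d \<phi> \<delta> x\<^sub>0
  proof (intro acting_group.intro finitely_generated_group.intro finitely_generated_group_axioms.intro
      hyperbolic_action.intro hyperbolic_action_axioms.intro)
    show "Metric_space X d" using assms(7) by (simp add: hyperbolic_space_def)
    show "group_action G X \<phi>" using assms(8) by (simp add: isometric_action_def)
    show "d (\<phi> g x) (\<phi> g y) = d x y" if "g \<in> carrier G" "x \<in> X" "y \<in> X" for g x y
      using assms(8) that by (simp add: isometric_action_def)
    show "min (gromov_product d w x y) (gromov_product d w y z) - \<delta> \<le> gromov_product d w x z"
      if "w \<in> X" "x \<in> X" "y \<in> X" "z \<in> X" for w x y z using \<delta>(2) that by blast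
  qed (use assms \<delta> x0 in auto)
  obtain C y z where sp: "schottky_pair C y z" using schottky_pair_exists[OF assms(9)] by metis
  obtain K where K: "1 \<le> K" "\<And>g. g \<in> carrier G \<Longrightarrow> d x\<^sub>0 (\<phi> g x\<^sub>0) \<le> K * word_norm g"
    using orbit_map_lipschitz by metis
  define \<Lambda> where "\<Lambda> = max 1 (max (word_norm y) (word_norm z))"
  have \<Lambda>: "1 \<le> \<Lambda>" "word_norm y \<le> \<Lambda>" "word_norm z \<le> \<Lambda>" by (simp_all add: \<Lambda>_def)
  have H: "subgroup H G" using assms(5) by (simp add: stable_subgroup_def)
  interpret H: subgroup H G by (rule H)
  obtain T l0 c where T: "T \<subseteq> H" "generate G T = H"
    and emb: "qi_embedding l0 c H (word_dist G T) (cayley_graph G S) (cayley_dist G S) cayley_vertex"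
    using assms(5) unfolding stable_subgroup_def by blast
  have l0: "1 \<le> l0" "0 \<le> c" using emb by (auto simp: qi_embedding_def)
  (* The periodic path has constant 4 * K, and gluing geodesics to it costs a factor 3. *)
  define l where "l = max l0 (max (12 * K) \<Lambda>)"
  have l: "l0 \<le> l" "3 \<le> l" "\<Lambda> \<le> l" "12 * K \<le> l" using K(1) by (auto simp: l_def)
  have "\<forall>l\<ge>1. \<forall>c\<ge>0. \<exists>R. \<forall>p q a b a' b'.
      a \<le> b \<and> a' \<le> b' \<and>
      quasi_geodesic l c (cayley_graph G S) (cayley_dist G S) {a..b} p \<and>
      quasi_geodesic l c (cayley_graph G S) (cayley_dist G S) {a'..b'} q \<and>
      p a = q a' \<and> p b = q b' \<and> p a \<in> cayley_vertex ` H \<and> p b \<in> cayley_vertex ` H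
      \<longrightarrow> (\<forall>s\<in>{a..b}. \<exists>t\<in>{a'..b'}. cayley_dist G S (p s) (q t) \<le> R)"
    using assms(5) unfolding stable_subgroup_def by (elim conjE)
  from this[THEN spec, of l, THEN mp, THEN spec, of "c + l", THEN mp]
  obtain R where R: "\<forall>p q a b a' b'.
      a \<le> b \<and> a' \<le> b' \<and>
      quasi_geodesic l (c + l) (cayley_graph G S) (cayley_dist G S) {a..b} p \<and>
      quasi_geodesic l (c + l) (cayley_graph G S) (cayley_dist G S) {a'..b'} q \<and>
      p a = q a' \<and> p b = q b' \<and> p a \<in> cayley_vertex ` H \<and> p b \<in> cayley_vertex ` H
      \<longrightarrow> (\<forall>s\<in>{a..b}. \<exists>t\<in>{a'..b'}. cayley_dist G S (p s) (q t) \<le> R)"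
    using l l0 by auto
  have y: "long_letter C y" "wide_corner C y y" "0 \<le> C"
    using sp by (auto simp: schottky_pair_def with_inverse_def)
  obtain v where v: "long_letter C v"
    "\<And>a h b. a \<in> carrier G \<Longrightarrow> h \<in> H \<Longrightarrow> b \<in> carrier G \<Longrightarrow> word_norm a \<le> R \<Longrightarrow> word_norm b \<le> R \<Longrightarrow> v \<noteq> a \<otimes> h \<otimes> b"
    using long_avoiding_element[OF y H assms(6), of R] by metis
  obtain U N e where U: "set U \<subseteq> carrier G" "U \<noteq> []" "\<And>l. l \<in> set U \<Longrightarrow> word_norm l \<le> \<Lambda>"
    "loxodromic G X d \<phi> (word_value G U)"
    "\<And>s t. s \<le> t \<Longrightarrow> real (t - s) \<le> 4 * K * \<rho> (cyclic_path G U s) (cyclic_path G U t)"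
    "N + e \<le> length U" "word_value G (take (N + e) U) = word_value G (take N U) \<otimes> v"
    using bridge_exists[OF K sp \<Lambda> v(1)] by metis
  define w where "w = word_value G U"
  define P where "P = cyclic_path G U"
  have wc: "w \<in> carrier G" using U(1) by (simp add: w_def)
  have vc: "v \<in> carrier G" using v(1) by (simp add: long_letter_def)
  have Pc: "P t \<in> carrier G" for t using U(1) by (simp add: P_def)
  have P_step: "\<rho> (P t) (P (Suc t)) \<le> \<Lambda>" for t
  proof -
    obtain s where "s \<in> set U" "P (Suc t) = P t \<otimes> s"
      using cyclic_path_Suc[OF U(1,2), of t] unfolding P_def by blast
    then show ?thesis using U(1,3) Pc[of t] by (auto simp: word_dist_mult_right)
  qed
  have P_lower: "3 / l * real (t - s) \<le> \<rho> (P s) (P t)" if "s \<le> t" for s t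
  proof -
    have "3 * real (t - s) \<le> 12 * K * \<rho> (P s) (P t)" using U(5)[OF that] by (simp add: P_def)
    also have "\<dots> \<le> l * \<rho> (P s) (P t)" using l by (intro mult_right_mono) auto
    finally show ?thesis using l by (simp add: pos_divide_le_eq mult.commute)
  qed
  have period: "P (q * length U + t) = w [^] q \<otimes> P t" for q t
    unfolding P_def w_def by (rule cyclic_path_shift[OF U(1,2)])
  have P_at: "P r = word_value G (take r U)" if "r \<le> length U" for r
  proof -
    have "set (take r U) \<subseteq> carrier G" using U(1) by (auto dest: in_set_takeD)
    then show ?thesis using cyclic_path_add[OF U(1,2) that, of 0] by (simp add: P_def)
  qed
  have Pv: "P (N + e) = P N \<otimes> v" using U(6,7) P_at[of N] P_at[of "N + e"] by simp
  have no_power: "w [^] (k::nat) \<noteq> g \<otimes> h \<otimes> inv g" if k: "0 < k" and g: "g \<in> carrier G" and h: "h \<in> H" for k g h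
  proof
    assume conj: "w [^] k = g \<otimes> h \<otimes> inv g"
    have P0: "P 0 = \<one>" using P_at[of 0] by simp
    have L: "0 < length U" using U(2) by simp
    obtain q where q: "\<And>t. t \<le> length U \<Longrightarrow> \<exists>h'\<in>H. \<rho> (inv g \<otimes> (w [^] (q::nat) \<otimes> P t)) h' \<le> R"
      using stable_subgroup_near_periodic_path[OF H T emb l(1,2,3) \<Lambda>(1) R Pc P0 P_step P_lower wc L period k g h conj]
      by metis
    define x where "x = inv g \<otimes> (w [^] q \<otimes> P N)"
    have xc: "x \<in> carrier G" using g wc Pc by (simp add: x_def)
    have xv: "inv g \<otimes> (w [^] q \<otimes> P (N + e)) = x \<otimes> v"
      unfolding x_def Pv using g wc Pc vc by (simp add: m_assoc)
    obtain h1 where h1: "h1 \<in> H" "\<rho> x h1 \<le> R" using q[of N] U(6) unfolding x_def by auto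
    obtain h2 where h2: "h2 \<in> H" "\<rho> (x \<otimes> v) h2 \<le> R" using q[OF U(6)] unfolding xv by auto
    have hc: "h1 \<in> carrier G" "h2 \<in> carrier G" using h1 h2 H.mem_carrier by auto
    have "v = (inv x \<otimes> h1) \<otimes> (inv h1 \<otimes> h2) \<otimes> (inv h2 \<otimes> (x \<otimes> v))"
      using xc vc hc by (simp add: m_assoc)
    moreover have "word_norm (inv x \<otimes> h1) \<le> R" using h1(2) by (simp add: word_dist_def)
    moreover have "word_norm (inv h2 \<otimes> (x \<otimes> v)) \<le> R"
      using h2(2) \<rho>_commute[of "x \<otimes> v" h2] xc vc hc by (simp add: word_dist_def)
    moreover have "inv h1 \<otimes> h2 \<in> H" using h1(1) h2(1) by simp
    ultimately show False
      using v(2)[of "inv x \<otimes> h1" "inv h1 \<otimes> h2" "inv h2 \<otimes> (x \<otimes> v)"] xc vc hc by simp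
  qed
  have "(g <# H #> inv g) \<inter> generate G {w} = {\<one>}" if g: "g \<in> carrier G" for g
  proof (intro equalityI subsetI)
    fix x assume "x \<in> (g <# H #> inv g) \<inter> generate G {w}"
    then obtain h k where h: "h \<in> H" "x = g \<otimes> h \<otimes> inv g" and k: "x = w [^] (k::int)"
      by (auto simp: l_coset_def r_coset_def generate_pow[OF wc])
    have hc: "h \<in> carrier G" using h(1) by (rule H.mem_carrier)
    consider "k = 0" | "0 < k" | "k < 0" by linarith
    then have "x = \<one>"
    proof cases
      case 1
      then show ?thesis using k by simp
    next
      case 2
      then have "w [^] nat k = g \<otimes> h \<otimes> inv g" using h(2) k int_pow_int[of G w "nat k"] by simp
      then show ?thesis using no_power[of "nat k" g h] 2 g h(1) by simp
    next
      case 3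
      have "w [^] nat (- k) = inv x"
        using 3 k int_pow_neg[OF wc, of k] int_pow_int[of G w "nat (- k)"] by simp
      also have "\<dots> = g \<otimes> inv h \<otimes> inv g" using g hc h(2) by (simp add: inv_mult_group m_assoc)
      finally show ?thesis using no_power[of "nat (- k)" g "inv h"] 3 g h(1) by simp
    qed
    then show "x \<in> {\<one>}" by simp
  next
    fix x assume "x \<in> {\<one>}"
    moreover have "\<one> = g \<otimes> \<one> \<otimes> inv g" using g by simp
    then have "\<one> \<in> g <# H #> inv g"
      using H.one_closed unfolding l_coset_def r_coset_def by blast
    ultimately show "x \<in> (g <# H #> inv g) \<inter> generate G {w}" using generate.one by auto
  qed
  then show ?thesis using wc U(4) unfolding w_def by blast
qed

end
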